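(* Let $G$ be a finite simple graph on $[d]$ and let $\widehat{G}$ be its suspension. Then $\mathcal{A}_{\widehat{G}}$ is unimodularly equivalent to a locally anti-blocking reflexive polytope, and $$h^*(\mathcal{A}_{\widehat{G}}, x) = \frac{1}{2^{d-1}}\sum_{H \in \mathrm{Cut}(G)} h^*(\mathcal{B}_H, x) = (x+1)^d f_G \left( \frac{4x}{(x+1)^2} \right), \quad\text{where } f_G (x)= \frac{1}{2^{d-1}} \sum_{H \in \mathrm{Cut}(G)} I_{\widetilde{H}} (x).$$ In particular, $h^*(\mathcal{A}_{\widehat{G}}, x)$ is $\gamma$-positive. Moreover, $h^*(\mathcal{A}_{\widehat{G}}, x)$ is real-rooted if and only if $f_G(x)$ is real-rooted.
   Context: For a finite simple graph $G$ on $[d]$, $\mathcal{A}_G=\mathrm{conv}\{\pm(\mathbf{e}_i-\mathbf{e}_j):\{i,j\}\in E(G)\}$. The suspension $\widehat{G}$ is the graph on $[d+1]$ with edge set $E(G)\cup\{\{i,d+1\}:i\in[d]\}$. For $S\subset[d]$, $E_S=\{e\in E(G):|e\cap S|=1\}$, identified with the bipartite graph on $[d]$ with edge set $E_S$ and bipartition $S\cup([d]\setminus S)$; since $E_S=E_{[d]\setminus S}$, $\mathrm{Cut}(G)$ denotes the collection (with multiplicity) of the $2^{d-1}$ graphs $E_S$, one for each unordered partition $\{S,[d]\setminus S\}$ of $[d]$. A lattice polytope $\mathcal{P}\subset\mathbb{R}^d_{\ge0}$ of dimension $d$ is anti-blocking if $\mathbf{y}\in\mathcal{P}$, $0\le x_i\le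 y_i$ imply $\mathbf{x}\in\mathcal{P}$; $\mathcal{P}^\pm=\{(\varepsilon_ix_i)_i:\varepsilon\in\{-1,1\}^d,\mathbf{x}\in\mathcal{P}\}$; a $d$-dimensional lattice polytope $\mathcal{P}$ is locally anti-blocking if for each $\varepsilon\in\{-1,1\}^d$ there is such a $\mathcal{P}_\varepsilon$ with $\mathcal{P}\cap\mathbb{R}^d_\varepsilon=\mathcal{P}_\varepsilon^\pm\cap\mathbb{R}^d_\varepsilon$, where $\mathbb{R}^d_\varepsilon=\{\mathbf{x}:\varepsilon_ix_i\ge0\}$. Reflexive: origin is the unique interior lattice point and the dual polytope is a lattice polytope. For a graph $H$ on $[d]$, $\mathcal{B}_H=B_H^\pm$ with $B_H=\mathrm{conv}(\{\mathbf{0},\mathbf{e}_1,\dots,\mathbf{e}_d\}\cup\{\mathbf{e}_i+\mathbf{e}_j:\{i,j\}\in E(H)\})$. For a bipartite graph $H$ on $[d]$ with bipartition $V_1\cup V_2=[d]$, $\widetilde{H}$ is the connected bipartite graph on $[d+2]$ with edge set $E(H)\cup\{\{i,d+1\}:i\in V_1\}\cup\{\{j,d+2\}:j\in V_2\cup\{d+1\}\}$. Interior polynomial: a hypergraph $\mathcal{H}=(V,E)$ has a finite multiset $E=\{e_1,\dots,e_n\}$ of nonempty subsets of $V$; $\mathrm{Bip}\,\mathcal{H}$ is the bipartite graph on $V\cup E$ with $v\sim e$ iff $v\in e$, assumed connected. A hypertree is $\mathbf{f}:E\to\mathbb{Z}_{\ge0}$ such that some spanning tree of $\mathrm{Bip}\,\mathcal{H}$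 has degree $\mathbf{f}(e)+1$ at every $e\in E$. A hyperedge $e_j$ is internally active for $\mathbf{f}$ if one cannot decrease $\mathbf{f}(e_j)$ by $1$ and increase some $\mathbf{f}(e_{j'})$, $j'<j$, by $1$ to obtain another hypertree; otherwise internally inactive, and $\overline{\iota}(\mathbf{f})$ counts these. $I_{\mathcal{H}}(x)=\sum_{\mathbf{f}}x^{\overline{\iota}(\mathbf{f})}$ over all hypertrees. For a connected bipartite graph $\Gamma$, $I_\Gamma=I_{\mathcal{H}}$ for a hypergraph $\mathcal{H}$ with $\mathrm{Bip}\,\mathcal{H}=\Gamma$. The $h^*$-polynomial of a $k$-dimensional lattice polytope $\mathcal{Q}\subset\mathbb{R}^n$: $1+\sum_{m\ge1}|m\mathcal{Q}\cap\mathbb{Z}^n|x^m=h^*(\mathcal{Q},x)/(1-x)^{k+1}$. A degree-$d$ polynomial $f$ is $\gamma$-positive if $f(x)=x^df(1/x)$ and $f=\sum_i\gamma_ix^i(1+x)^{d-2i}$ with $\gamma_i\ge0$. *)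

theory Defs
  imports
    "HOL-Analysis.Analysis"
    "HOL-Computational_Algebra.Computational_Algebra"
begin

section \<open>Graphs\<close>

text \<open>
  A graph is given by a vertex set and a set of edges, an edge being a two-element set of vertices.
  Graphs on \<open>[d]\<close> are modelled as graphs on all of a finite type \<open>'n\<close>, with \<open>d = CARD('n)\<close>;
  then \<open>[d + 1]\<close> is \<open>'n option\<close> and \<open>[d + 2]\<close> is \<open>'n option option\<close>.
\<close>

definition simple_graph :: "'a set \<Rightarrow> 'a set set \<Rightarrow> bool" where
  "simple_graph V E \<longleftrightarrow> finite V \<and> (\<forall>e\<in>E. e \<subseteq> V \<and> card e = 2)"

definition graph_connected :: "'a set \<Rightarrow> 'a set set \<Rightarrow> bool" where
  "graph_connected V E \<longleftrightarrow> (\<forall>u\<in>V. \<forall>v\<in>V. (u, v) \<in> {(a, b). {a, b} \<in> E}\<^sup>*)"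

definition is_cycle :: "'a set set \<Rightarrow> 'a list \<Rightarrow> bool" where
  "is_cycle E vs \<longleftrightarrow> 3 \<le> length vs \<and> distinct vs \<and>
     (\<forall>i<length vs. {vs ! i, vs ! (Suc i mod length vs)} \<in> E)"

definition spanning_tree :: "'a set \<Rightarrow> 'a set set \<Rightarrow> 'a set set \<Rightarrow> bool" where
  "spanning_tree V E T \<longleftrightarrow> T \<subseteq> E \<and> graph_connected V T \<and> (\<nexists>vs. is_cycle T vs)"

definition vertex_degree :: "'a set set \<Rightarrow> 'a \<Rightarrow> nat" where
  "vertex_degree E v = card {e \<in> E. v \<in> e}"

definition graph_isomorphic ::
    "'a set \<Rightarrow> 'a set set \<Rightarrow> 'b set \<Rightarrow> 'b set set \<Rightarrow> bool" where
  "graph_isomorphic V E V' E' \<longleftrightarrow> (\<exists>\<phi>. bij_betw \<phi> V V' \<and> E' = (\<lambda>e. \<phi> ` e) ` E)"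

definition suspension :: "'n set set \<Rightarrow> 'n option set set" where
  "suspension E = (\<lambda>e. Some ` e) ` E \<union> {{Some i, None} | i. True}"

definition cut_graph :: "'n set set \<Rightarrow> 'n set \<Rightarrow> 'n set set" where
  "cut_graph E S = {e \<in> E. card (e \<inter> S) = 1}"

text \<open>
  \<open>Cut(G)\<close> is indexed by the unordered partitions \<open>{S, -S}\<close> (one of the two blocks may be empty),
  so that graphs occurring for several partitions are counted with multiplicity.
  \<open>block P\<close> is a chosen block of \<open>P\<close>; it plays the role of \<open>S\<close> in \<open>E\<^sub>S\<close> and of \<open>V\<^sub>1\<close>
  in the bipartition of the corresponding graph. Exchanging the blocks leaves \<open>E\<^sub>S\<close> unchanged
  and replaces \<open>tilde_graph\<close> below by an isomorphic graph.
\<close>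

definition cut_partitions :: "'n set set set" where
  "cut_partitions = {{S, - S} | S. True}"

definition block :: "'n set set \<Rightarrow> 'n set" where
  "block P = (SOME S. S \<in> P)"

text \<open>
  The graph obtained from a bipartite graph with edge set \<open>F\<close> and bipartition \<open>V\<^sub>1\<close>, \<open>- V\<^sub>1\<close>.
  The vertex \<open>d + 1\<close> is \<open>Some None\<close>, and \<open>d + 2\<close> is \<open>None\<close>.
\<close>

definition tilde_graph :: "'n set \<Rightarrow> 'n set set \<Rightarrow> 'n option option set set" where
  "tilde_graph V\<^sub>1 F =
     (\<lambda>e. (\<lambda>i. Some (Some i)) ` e) ` F
     \<union> {{Some (Some i), Some None} | i. i \<in> V\<^sub>1}
     \<union> {{Some (Some j), None} | j. j \<in> - V\<^sub>1}
     \<union> {{Some None, None}}"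


section \<open>Interior polynomials\<close>

text \<open>
  A hypergraph has a vertex set \<open>V\<close> and a list \<open>es\<close> of hyperedges; the list carries both the
  multiplicities and the order \<open>e\<^sub>1, \<dots>, e\<^sub>n\<close> used for activity. The \<open>j\<close>-th hyperedge
  (counted from 0) is the vertex \<open>Inr j\<close> of the associated bipartite graph, and functions on the
  hyperedges are functions on indices that vanish outside \<open>{..<length es}\<close>.
\<close>

definition hypergraph :: "'v set \<Rightarrow> 'v set list \<Rightarrow> bool" where
  "hypergraph V es \<longleftrightarrow> finite V \<and> (\<forall>e\<in>set es. e \<noteq> {} \<and> e \<subseteq> V)"

definition bip_vertices :: "'v set \<Rightarrow> 'v set list \<Rightarrow> ('v + nat) set" where
  "bip_vertices V es = Inl ` V \<union> Inr ` {..<length es}"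

definition bip_edges :: "'v set list \<Rightarrow> ('v + nat) set set" where
  "bip_edges es = {{Inl v, Inr j} | v j. j < length es \<and> v \<in> es ! j}"

definition hypertree :: "'v set \<Rightarrow> 'v set list \<Rightarrow> (nat \<Rightarrow> nat) \<Rightarrow> bool" where
  "hypertree V es f \<longleftrightarrow> (\<forall>j\<ge>length es. f j = 0) \<and>
     (\<exists>T. spanning_tree (bip_vertices V es) (bip_edges es) T \<and>
          (\<forall>j<length es. vertex_degree T (Inr j) = f j + 1))"

definition internally_inactive :: "'v set \<Rightarrow> 'v set list \<Rightarrow> (nat \<Rightarrow> nat) \<Rightarrow> nat \<Rightarrow> bool" where
  "internally_inactive V es f j \<longleftrightarrow>
     f j > 0 \<and> (\<exists>j'<j. hypertree V es (f(j := f j - 1, j' := f j' + 1)))"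

definition interior_polynomial :: "'v set \<Rightarrow> 'v set list \<Rightarrow> real poly" where
  "interior_polynomial V es =
     (\<Sum>f | hypertree V es f. monom 1 (card {j. j < length es \<and> internally_inactive V es f j}))"

text \<open>
  The interior polynomial of a connected bipartite graph is that of a hypergraph inducing it. It does
  not depend on the choice (of the side used as hyperedges and of their order), and no particular
  choice is fixed here. Taking the hypergraph vertices in the vertex type of the graph is no
  restriction up to isomorphism.
\<close>

definition graph_interior_polynomial :: "'a set \<Rightarrow> 'a set set \<Rightarrow> real poly" where
  "graph_interior_polynomial W F =
     (SOME p. \<exists>(V :: 'a set) es. hypergraph V es \<and>
        graph_isomorphic (bip_vertices V es) (bip_edges es) W F \<and>
        p = interior_polynomial V es)"

definition f_poly :: "'n::finite set set \<Rightarrow> real poly" where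
  "f_poly E = smult (1 / 2 ^ (CARD('n) - 1))
     (\<Sum>P\<in>cut_partitions.
        graph_interior_polynomial UNIV (tilde_graph (block P) (cut_graph E (block P))))"


section \<open>Lattice polytopes\<close>

definition int_lattice :: "(real ^ 'n) set" where
  "int_lattice = {x. \<forall>i. x $ i \<in> \<int>}"

definition lattice_polytope :: "(real ^ 'n) set \<Rightarrow> bool" where
  "lattice_polytope P \<longleftrightarrow> (\<exists>A. finite A \<and> A \<subseteq> int_lattice \<and> P = convex hull A)"

definition ehrhart_series :: "(real ^ 'n) set \<Rightarrow> real fps" where
  "ehrhart_series Q =
     Abs_fps (\<lambda>m. if m = 0 then 1 else real (card ((\<lambda>x. real m *\<^sub>R x) ` Q \<inter> int_lattice)))"

definition h_star :: "(real ^ 'n) set \<Rightarrow> real poly" where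
  "h_star Q =
     (THE h. ehrhart_series Q = fps_of_poly h / (1 - fps_X) ^ (nat (aff_dim Q) + 1))"

definition unimodularly_equivalent :: "(real ^ 'm) set \<Rightarrow> (real ^ 'n) set \<Rightarrow> bool" where
  "unimodularly_equivalent P Q \<longleftrightarrow>
     (\<exists>L b. linear L \<and>
        bij_betw (\<lambda>x. L x + b) (int_lattice \<inter> affine hull P) (int_lattice \<inter> affine hull Q) \<and>
        (\<lambda>x. L x + b) ` P = Q)"

definition dual_polytope :: "(real ^ 'n) set \<Rightarrow> (real ^ 'n) set" where
  "dual_polytope P = {y. \<forall>x\<in>P. x \<bullet> y \<le> 1}"

definition reflexive_polytope :: "(real ^ 'n) set \<Rightarrow> bool" where
  "reflexive_polytope P \<longleftrightarrow> lattice_polytope P \<and>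
     interior P \<inter> int_lattice = {0} \<and> lattice_polytope (dual_polytope P)"

definition sign_vectors :: "(real ^ 'n) set" where
  "sign_vectors = {\<epsilon>. \<forall>i. \<epsilon> $ i = -1 \<or> \<epsilon> $ i = 1}"

definition orthant :: "real ^ 'n \<Rightarrow> (real ^ 'n) set" where
  "orthant \<epsilon> = {x. \<forall>i. \<epsilon> $ i * x $ i \<ge> 0}"

definition symmetrization :: "(real ^ 'n) set \<Rightarrow> (real ^ 'n) set" where
  "symmetrization P = {(\<chi> i. \<epsilon> $ i * x $ i) | \<epsilon> x. \<epsilon> \<in> sign_vectors \<and> x \<in> P}"

definition anti_blocking :: "(real ^ 'n) set \<Rightarrow> bool" where
  "anti_blocking P \<longleftrightarrow> lattice_polytope P \<and> aff_dim P = int (CARD('n)) \<and>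
     (\<forall>x\<in>P. \<forall>i. 0 \<le> x $ i) \<and>
     (\<forall>y\<in>P. \<forall>x. (\<forall>i. 0 \<le> x $ i \<and> x $ i \<le> y $ i) \<longrightarrow> x \<in> P)"

definition locally_anti_blocking :: "(real ^ 'n) set \<Rightarrow> bool" where
  "locally_anti_blocking P \<longleftrightarrow> lattice_polytope P \<and> aff_dim P = int (CARD('n)) \<and>
     (\<forall>\<epsilon>\<in>sign_vectors. \<exists>P\<^sub>\<epsilon>. anti_blocking P\<^sub>\<epsilon> \<and>
        P \<inter> orthant \<epsilon> = symmetrization P\<^sub>\<epsilon> \<inter> orthant \<epsilon>)"

definition A_polytope :: "'n set set \<Rightarrow> (real ^ 'n) set" where
  "A_polytope E = convex hull
     {x. \<exists>i j. {i, j} \<in> E \<and> (x = axis i 1 - axis j 1 \<or> x = - (axis i 1 - axis j 1))}"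

definition B_polytope :: "'n set set \<Rightarrow> (real ^ 'n) set" where
  "B_polytope F = symmetrization (convex hull
     ({0} \<union> {axis i 1 | i. True} \<union> {axis i 1 + axis j 1 | i j. {i, j} \<in> F}))"


section \<open>Polynomials\<close>

text \<open>\<open>reflect_poly f\<close> is \<open>x\<^sup>d f(1/x)\<close> for \<open>d = degree f\<close>.\<close>

definition gamma_positive :: "real poly \<Rightarrow> bool" where
  "gamma_positive f \<longleftrightarrow> reflect_poly f = f \<and>
     (\<exists>\<gamma> :: nat \<Rightarrow> real. (\<forall>i. \<gamma> i \<ge> 0) \<and>
        f = (\<Sum>i\<le>degree f div 2. smult (\<gamma> i) (monom 1 i * [:1, 1:] ^ (degree f - 2 * i))))"

definition real_rooted :: "real poly \<Rightarrow> bool" where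
  "real_rooted p \<longleftrightarrow> (\<forall>z :: complex. poly (map_poly of_real p) z = 0 \<longrightarrow> z \<in> \<real>)"

end

theory Submission imports Defs begin

text \<open>
  Forgetting the apex maps \<open>A_polytope (suspension E)\<close> to a polytope \<open>Q\<close> whose part in the orthant of a
  sign vector is, up to signs, the polytope of the cut graph of the set of positive coordinates.
  Exchanging the signs of an integer point with a sign vector turns this into a count of lattice points,
  which gives the first formula for the \<open>h\<^sup>*\<close>-polynomial.

  For a bipartite graph with sides \<open>X\<close>, \<open>Y\<close>, a lattice point of a dilate amounts to a pair of weights
  on \<open>X\<close> and \<open>Y\<close> that is transported by copies of the edges and vertices. For fixed weights on \<open>Y\<close> the
  possible weights on \<open>X\<close> are the fiber vectors of partial functions from a blow-up of \<open>Y\<close> to \<open>X\<close>. There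
  are as many of them as fiber vectors of partial functions in the opposite direction: for generic
  edge weights, both correspond to the spanning trees that support an optimal dual solution of a
  transport problem. The latter depend on the weights on \<open>Y\<close> in an explicit way, so that the Ehrhart
  series can be summed; it is expressed by the numbers of fiber vectors with given size of support.

  These numbers are also the coefficients of the interior polynomial. A hypertree of the extended
  bipartite graph is the fiber vector of a total function, the interior polynomial does not depend on
  the order of the hyperedges (it counts the integer points below a hypertree), and if the hyperedge
  containing all vertices comes first, a hyperedge is inactive exactly if it carries weight.
\<close>

section \<open>Fiber vectors of partial functions and their duality\<close>

text \<open>The argument of \<open>f_poly\<close> and the powers of \<open>x + 1\<close> come from
  one parameter. Give a lattice point the weight \<open>t\<close> to the number of its nonzero
  coordinates. For a bipartite graph on \<open>d\<close> vertices the weighted series, times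
  \<open>(1 - x)^(d + 1)\<close>, is the sum of \<open>(t^2 x)^k (1 + (t - 1) x)^(d - 2 k)\<close>
  over the fiber vectors, \<open>k\<close> being the size of the support. At \<open>t = 1\<close>
  this is the interior polynomial; at \<open>t = 2\<close> the weight counts sign patterns, and
  \<open>4 x\<close> and \<open>1 + x\<close> appear. The obstacle is that the summation uses the
  duality of fiber vectors weighted by \<open>t\<close>, and for all blow-ups of one side, whereas
  the trees yield equal cardinalities only. The unweighted case suffices to evaluate the series at
  \<open>t = 1\<close>, and the series does not distinguish the two sides. Genericity is obtained
  without perturbation: edge weights are polynomials, ordered by the sign of the leading
  coefficient, with one monomial for each edge.\<close>

definition fiber_count :: "'b set \<Rightarrow> ('b \<Rightarrow> 'a option) \<Rightarrow> 'a \<Rightarrow> nat" where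
  "fiber_count Y \<phi> x = card {y \<in> Y. \<phi> y = Some x}"

definition pfun :: "'a set \<Rightarrow> 'b set \<Rightarrow> ('a \<Rightarrow> 'b \<Rightarrow> bool) \<Rightarrow> ('b \<Rightarrow> 'a option) \<Rightarrow> bool" where
  "pfun X Y R \<phi> \<longleftrightarrow> (\<forall>y\<in>Y. \<forall>x. \<phi> y = Some x \<longrightarrow> x \<in> X \<and> R x y)"

text \<open>If a hyperedge containing everything is added, these are the hypertrees with the
  coordinate of that hyperedge dropped; \<open>None\<close> marks the elements assigned to
  it.\<close>

definition fiber_vectors :: "'a set \<Rightarrow> 'b set \<Rightarrow> ('a \<Rightarrow> 'b \<Rightarrow> bool) \<Rightarrow> ('a \<Rightarrow> nat) set" where
  "fiber_vectors X Y R = fiber_count Y ` {\<phi>. pfun X Y R \<phi>}"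

lemma fiber_count_outside: "pfun X Y R \<phi> \<Longrightarrow> x \<notin> X \<Longrightarrow> fiber_count Y \<phi> x = 0"
  by (auto simp: pfun_def fiber_count_def card_eq_0_iff)

lemma fiber_count_le: "finite Y \<Longrightarrow> fiber_count Y \<phi> x \<le> card Y"
  unfolding fiber_count_def by (intro card_mono) auto

lemma fiber_count_cong: "(\<And>y. y \<in> Y \<Longrightarrow> \<phi> y = \<psi> y) \<Longrightarrow> fiber_count Y \<phi> = fiber_count Y \<psi>"
  unfolding fiber_count_def by (intro ext arg_cong[where f = card]) auto

lemma fiber_vectors_outside: "p \<in> fiber_vectors X Y R \<Longrightarrow> x \<notin> X \<Longrightarrow> p x = 0"
  by (auto simp: fiber_vectors_def fiber_count_outside)

lemma finite_fiber_vectors: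
  assumes "finite X" "finite Y"
  shows "finite (fiber_vectors X Y R)"
proof (rule finite_subset)
  show "fiber_vectors X Y R \<subseteq> {f. \<forall>x. (x \<in> X \<longrightarrow> f x \<in> {..card Y}) \<and> (x \<notin> X \<longrightarrow> f x = 0)}"
    using assms by (auto simp: fiber_vectors_def fiber_count_outside fiber_count_le)
  show "finite {f. \<forall>x. (x \<in> X \<longrightarrow> f x \<in> {..card Y}) \<and> (x \<notin> X \<longrightarrow> f x = 0)}"
    by (rule finite_set_of_finite_funs) (use assms in auto)
qed

text \<open>A cost that depends on the value alone and vanishes at \<open>None\<close> is determined
  by the fiber vector. This is how functions with equal fiber vectors are compared through dual
  potentials.\<close>

lemma sum_option_fiber_count:
  fixes c :: "'a option \<Rightarrow> 'k::comm_ring_1"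
  assumes "finite X" "finite Y" "pfun X Y R \<phi>" "c None = 0"
  shows "(\<Sum>y\<in>Y. c (\<phi> y)) = (\<Sum>x\<in>X. of_nat (fiber_count Y \<phi> x) * c (Some x))"
proof -
  have "(\<Sum>y\<in>Y. c (\<phi> y)) = (\<Sum>i\<in>insert None (Some ` X). \<Sum>y\<in>{y\<in>Y. \<phi> y = i}. c (\<phi> y))"
    by (rule sum.group[symmetric]) (use assms in \<open>auto simp: pfun_def, metis imageI option.exhaust\<close>)
  also have "\<dots> = (\<Sum>i\<in>Some ` X. \<Sum>y\<in>{y\<in>Y. \<phi> y = i}. c (\<phi> y))"
    using assms by (subst sum.insert) auto
  also have "\<dots> = (\<Sum>x\<in>X. \<Sum>y\<in>{y\<in>Y. \<phi> y = Some x}. c (\<phi> y))"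
    by (subst sum.reindex) auto
  also have "\<dots> = (\<Sum>x\<in>X. of_nat (fiber_count Y \<phi> x) * c (Some x))"
    by (intro sum.cong) (auto simp: fiber_count_def)
  finally show ?thesis .
qed

section \<open>Optimal trees for generic edge weights\<close>

locale bipartite_weights =
  fixes X :: "'a set" and Y :: "'b set" and R :: "'a \<Rightarrow> 'b \<Rightarrow> bool"
    and idx :: "'a option \<times> 'b option \<Rightarrow> nat" and N :: nat
  assumes finX: "finite X" and finY: "finite Y"
    and inj_idx: "inj_on idx (insert None (Some ` X) \<times> insert None (Some ` Y))"
    and idx_less: "\<And>e. e \<in> insert None (Some ` X) \<times> insert None (Some ` Y) \<Longrightarrow> idx e < N"
begin

abbreviation "X' \<equiv> insert None (Some ` X)"
abbreviation "Y' \<equiv> insert None (Some ` Y)"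

text \<open>\<open>None\<close> is the additional vertex on either side. The monomials make the weights linearly
  independent, and \<open>monom 1 N\<close> makes the edges at the additional vertex on the right outweigh all
  others, so that shortest paths use them only when no other path exists.\<close>

definition w :: "'a option \<Rightarrow> 'b option \<Rightarrow> int poly" where
  "w i j = (if j = None then monom 1 N else 0) + monom 1 (idx (i, j))"

text \<open>A spanning tree of the graph with both additional vertices, rooted at the edge joining
  these two, which stays implicit: \<open>\<phi> y\<close> and \<open>\<psi> x\<close> are parents,
  the potentials are tight along the other edges and 0 at both roots, and \<open>rk\<close> rules
  out cycles.\<close>

definition tree :: "('b \<Rightarrow> 'a option) \<Rightarrow> ('a \<Rightarrow> 'b option) \<Rightarrow> ('a option \<Rightarrow> int poly) \<Rightarrow>
    ('b option \<Rightarrow> int poly) \<Rightarrow> ('a \<Rightarrow> nat) \<Rightarrow> bool" where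
  "tree \<phi> \<psi> u v rk \<longleftrightarrow> pfun X Y R \<phi> \<and> pfun Y X (\<lambda>y x. R x y) \<psi> \<and> u None = 0 \<and> v None = 0 \<and>
     (\<forall>y\<in>Y. u (\<phi> y) + v (Some y) = w (\<phi> y) (Some y)) \<and>
     (\<forall>x\<in>X. u (Some x) + v (\<psi> x) = w (Some x) (\<psi> x)) \<and>
     (\<forall>x\<in>X. \<forall>y z. \<psi> x = Some y \<longrightarrow> \<phi> y = Some z \<longrightarrow> rk z < rk x)"

definition feasible :: "('a option \<Rightarrow> int poly) \<Rightarrow> ('b option \<Rightarrow> int poly) \<Rightarrow> bool" where
  "feasible u v \<longleftrightarrow> (\<forall>x\<in>X. \<forall>y\<in>Y. R x y \<longrightarrow> u (Some x) + v (Some y) \<le> w (Some x) (Some y)) \<and>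
     (\<forall>x\<in>X. u (Some x) \<le> w (Some x) None) \<and> (\<forall>y\<in>Y. v (Some y) \<le> w None (Some y))"

lemma coeff_w:
  assumes "i \<in> X'" "j \<in> Y'" "e \<in> X' \<times> Y'"
  shows "coeff (w i j) (idx e) = (if e = (i, j) then 1 else 0)"
proof -
  have "idx e \<noteq> N" using idx_less[OF assms(3)] by simp
  moreover have "(i, j) \<in> X' \<times> Y'" using assms(1,2) by (rule SigmaI)
  then have "idx (i, j) = idx e \<longleftrightarrow> e = (i, j)" using inj_onD[OF inj_idx _ _ assms(3)] by auto
  ultimately show ?thesis by (simp add: w_def)
qed

lemma treeD:
  assumes "tree \<phi> \<psi> u v rk"
  shows "pfun X Y R \<phi>" "pfun Y X (\<lambda>y x. R x y) \<psi>" "u None = 0" "v None = 0"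
    "\<And>y. y \<in> Y \<Longrightarrow> u (\<phi> y) + v (Some y) = w (\<phi> y) (Some y)"
    "\<And>x. x \<in> X \<Longrightarrow> u (Some x) + v (\<psi> x) = w (Some x) (\<psi> x)"
    "\<And>x y z. x \<in> X \<Longrightarrow> \<psi> x = Some y \<Longrightarrow> \<phi> y = Some z \<Longrightarrow> rk z < rk x"
    "\<And>y. y \<in> Y \<Longrightarrow> \<phi> y \<in> X'" "\<And>x. x \<in> X \<Longrightarrow> \<psi> x \<in> Y'"
    "\<And>x y. x \<in> X \<Longrightarrow> \<psi> x = Some y \<Longrightarrow> y \<in> Y"
    "\<And>x y. y \<in> Y \<Longrightarrow> \<phi> y = Some x \<Longrightarrow> x \<in> X"
proof -
  note t = assms[unfolded tree_def]
  show p: "pfun X Y R \<phi>" and q: "pfun Y X (\<lambda>y x. R x y) \<psi>" and "u None = 0" "v None = 0" using t by blast+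
  show "\<And>y. y \<in> Y \<Longrightarrow> u (\<phi> y) + v (Some y) = w (\<phi> y) (Some y)"
    and "\<And>x. x \<in> X \<Longrightarrow> u (Some x) + v (\<psi> x) = w (Some x) (\<psi> x)"
    and "\<And>x y z. x \<in> X \<Longrightarrow> \<psi> x = Some y \<Longrightarrow> \<phi> y = Some z \<Longrightarrow> rk z < rk x" using t by blast+
  show "\<phi> y \<in> X'" if "y \<in> Y" for y using p that by (cases "\<phi> y") (auto simp: pfun_def)
  show "\<psi> x \<in> Y'" if "x \<in> X" for x using q that by (cases "\<psi> x") (auto simp: pfun_def)
  show "\<And>x y. x \<in> X \<Longrightarrow> \<psi> x = Some y \<Longrightarrow> y \<in> Y" using q by (auto simp: pfun_def)
  show "\<And>x y. y \<in> Y \<Longrightarrow> \<phi> y = Some x \<Longrightarrow> x \<in> X" using p by (auto simp: pfun_def)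
qed

lemma tree_step:
  assumes "tree \<phi> \<psi> u v rk" "x \<in> X" "\<psi> x = Some y"
  shows "u (Some x) = w (Some x) (Some y) - w (\<phi> y) (Some y) + u (\<phi> y)"
  using treeD(5)[OF assms(1), of y] treeD(6)[OF assms(1,2)] treeD(10)[OF assms] assms(3)
  by (simp add: algebra_simps)

lemma tree_root:
  assumes "tree \<phi> \<psi> u v rk" "x \<in> X" "\<psi> x = None"
  shows "u (Some x) = w (Some x) None"
  using treeD(6)[OF assms(1,2)] treeD(4)[OF assms(1)] assms(3) by simp

lemma tree_induct [consumes 2, case_names root step]:
  assumes t: "tree \<phi> \<psi> u v rk" and x: "x \<in> X"
    and root: "\<And>x. x \<in> X \<Longrightarrow> \<psi> x = None \<Longrightarrow> P x"
    and step: "\<And>x y. x \<in> X \<Longrightarrow> y \<in> Y \<Longrightarrow> \<psi> x = Some y \<Longrightarrow>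
        (\<And>z. \<phi> y = Some z \<Longrightarrow> z \<in> X \<Longrightarrow> P z) \<Longrightarrow> P x"
  shows "P x"
  using x
proof (induction "rk x" arbitrary: x rule: less_induct)
  case less
  show ?case
  proof (cases "\<psi> x")
    case None then show ?thesis using root less by blast
  next
    case (Some y)
    then show ?thesis using step[of x y] less treeD(7,10,11)[OF t] by metis
  qed
qed

lemma tree_unique:
  assumes "tree \<phi> \<psi> u v rk" "tree \<phi> \<psi> u' v' rk'" "x \<in> X"
  shows "u (Some x) = u' (Some x)"
  using assms(1,3)
proof (induction rule: tree_induct)
  case (root x)
  then show ?case using tree_root assms by metis
next
  case (step x y)
  then show ?case
    using tree_step[OF assms(1), of x y] tree_step[OF assms(2), of x y] treeD(3)[OF assms(1)]
      treeD(3)[OF assms(2)] treeD(8,11)[OF assms(1), of y] by auto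
qed

lemma feasible_le:
  assumes "feasible u v" "u None = 0" "y \<in> Y" "pfun X Y R \<phi>"
  shows "u (\<phi> y) + v (Some y) \<le> w (\<phi> y) (Some y)"
  using assms unfolding feasible_def pfun_def by (cases "\<phi> y") auto

lemma feasible_le':
  assumes "feasible u v" "v None = 0" "x \<in> X" "pfun Y X (\<lambda>y x. R x y) \<psi>"
  shows "u (Some x) + v (\<psi> x) \<le> w (Some x) (\<psi> x)"
  using assms unfolding feasible_def pfun_def by (cases "\<psi> x") auto

text \<open>The comparison passes down the first tree: a larger \<open>u'\<close> at
  \<open>\<phi> y\<close> forces a smaller \<open>v'\<close> at \<open>y\<close> by feasibility, and
  the shared tight edge from \<open>x\<close> to \<open>\<psi> x\<close> turns this into a larger
  \<open>u'\<close> at \<open>x\<close>.\<close>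

lemma feasible_ge:
  assumes t: "tree \<phi> \<psi> u v rk" and t': "tree \<phi>' \<psi> u' v' rk'" and f': "feasible u' v'" and x: "x \<in> X"
  shows "u (Some x) \<le> u' (Some x)"
  using t x
proof (induction rule: tree_induct)
  case (root x)
  then show ?case using tree_root t t' by (metis order_refl)
next
  case (step x y)
  have "u (\<phi> y) \<le> u' (\<phi> y)"
    using step(4) treeD(3)[OF t] treeD(3)[OF t'] treeD(11)[OF t step(2)] by (cases "\<phi> y") auto
  moreover have "u' (Some x) = w (Some x) (Some y) - v' (Some y)"
    using treeD(6)[OF t' step(1)] step(3) by (simp add: algebra_simps)
  moreover have "u (Some x) = w (Some x) (Some y) - v (Some y)"
    using treeD(6)[OF t step(1)] step(3) by (simp add: algebra_simps)
  moreover have "u' (\<phi> y) + v' (Some y) \<le> u (\<phi> y) + v (Some y)"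
    using feasible_le[OF f' treeD(3)[OF t'] step(2) treeD(1)[OF t]] treeD(5)[OF t step(2)] by simp
  ultimately show ?case by (simp add: algebra_simps)
qed

text \<open>A potential is an alternating sum of the weights along the path to a root, so the
  monomial of an edge outside the tree does not occur in it.\<close>

lemma coeff_tree:
  assumes t: "tree \<phi> \<psi> u v rk" and e: "(i, j) \<in> X' \<times> Y'"
    and "\<And>y. y \<in> Y \<Longrightarrow> (\<phi> y, Some y) \<noteq> (i, j)" "\<And>x. x \<in> X \<Longrightarrow> (Some x, \<psi> x) \<noteq> (i, j)" "x \<in> X"
  shows "coeff (u (Some x)) (idx (i, j)) = 0"
  using t assms(5)
proof (induction rule: tree_induct)
  case (root x)
  then show ?case
    using tree_root[OF t root] assms(4)[OF root(1)] coeff_w[OF _ _ e, of "Some x" None]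
    by (cases j) auto
next
  case (step x y)
  have "coeff (u (\<phi> y)) (idx (i, j)) = 0"
    using step(4) treeD(3)[OF t] treeD(11)[OF t step(2)] by (cases "\<phi> y") auto
  moreover have "coeff (w (Some x) (Some y)) (idx (i, j)) = 0"
    using step assms(4)[of x] coeff_w[OF _ _ e, of "Some x" "Some y"] by auto
  moreover have "coeff (w (\<phi> y) (Some y)) (idx (i, j)) = 0"
    using step assms(3)[of y] coeff_w[OF treeD(8)[OF t step(2)] _ e, of "Some y"] by auto
  ultimately show ?case using tree_step[OF t step(1,3)] by simp
qed

text \<open>A tree is recovered from the function \<open>\<psi>\<close> by complementary slackness; the weights are
  linearly independent, so there are no ties.\<close>

lemma tree_determined:
  assumes t: "tree \<phi> \<psi> u v rk" and f: "feasible u v"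
    and t': "tree \<phi>' \<psi>' u' v' rk'" and f': "feasible u' v'"
    and eq: "fiber_count X \<psi> = fiber_count X \<psi>'"
  shows "fiber_count Y \<phi> = fiber_count Y \<phi>'"
proof -
  \<comment> \<open>Weak duality: \<open>\<psi>\<close> is tight for \<open>u\<close> and
    \<open>v\<close>, while \<open>\<psi>'\<close> has the same dual value and costs at least as
    much.\<close>
  have cost: "(\<Sum>x\<in>X. w (Some x) (\<psi> x)) \<le> (\<Sum>x\<in>X. w (Some x) (\<psi>' x))"
    if t: "tree \<phi> \<psi> u v rk" and f: "feasible u v"
    and t': "tree \<phi>' \<psi>' u' v' rk'" and eq: "fiber_count X \<psi> = fiber_count X \<psi>'" for \<phi> \<psi> u v rk \<phi>' \<psi>' u' v' rk'
  proof -
    have "(\<Sum>x\<in>X. w (Some x) (\<psi> x)) = (\<Sum>x\<in>X. u (Some x) + v (\<psi> x))"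
      using treeD(6)[OF t] by simp
    also have "\<dots> = (\<Sum>x\<in>X. u (Some x) + v (\<psi>' x))"
      using sum_option_fiber_count[OF finY finX treeD(2)[OF t], of v] sum_option_fiber_count[OF finY finX treeD(2)[OF t'], of v]
        treeD(4)[OF t] eq by (simp add: sum.distrib)
    also have "\<dots> \<le> (\<Sum>x\<in>X. w (Some x) (\<psi>' x))"
      by (rule sum_mono) (use feasible_le'[OF f treeD(4)[OF t] _ treeD(2)[OF t']] in auto)
    finally show ?thesis .
  qed
  have sums: "(\<Sum>x\<in>X. w (Some x) (\<psi> x)) = (\<Sum>x\<in>X. w (Some x) (\<psi>' x))"
    using cost[OF t f t' eq] cost[OF t' f' t eq[symmetric]] by simp
  \<comment> \<open>Equal sums have equal coefficients, and each edge owns a monomial, so the two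
    sums use the same edges.\<close>
  have psi: "\<psi>' x = \<psi> x" if x: "x \<in> X" for x
  proof -
    have c: "coeff (\<Sum>z\<in>X. w (Some z) (h z)) (idx (Some x, \<psi> x)) = (if h x = \<psi> x then 1 else 0)"
      if "\<And>z. z \<in> X \<Longrightarrow> h z \<in> Y'" for h
    proof -
      have "coeff (\<Sum>z\<in>X. w (Some z) (h z)) (idx (Some x, \<psi> x)) =
        (\<Sum>z\<in>X. if z = x then (if h x = \<psi> x then 1 else 0) else 0)"
        unfolding coeff_sum
        by (intro sum.cong refl, subst coeff_w) (use that x treeD(9)[OF t x] in auto)
      then show ?thesis using x finX by simp
    qed
    show ?thesis using c[of \<psi>] c[of \<psi>'] treeD(9)[OF t] treeD(9)[OF t'] sums
      by (metis one_neq_zero)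
  qed
  \<comment> \<open>With \<open>\<psi>\<close> shared, the domination of potentials applies in both
    directions.\<close>
  have t'': "tree \<phi>' \<psi> u' v' rk'"
    using t' psi treeD(2)[OF t] unfolding tree_def by simp
  have u: "u (Some x) = u' (Some x)" if "x \<in> X" for x
    using feasible_ge[OF t t'' f' that] feasible_ge[OF t'' t f that] by simp
  have u': "u i = u' i" if "i \<in> X'" for i
    using that u treeD(3)[OF t] treeD(3)[OF t'] by auto
  have v: "v (Some y) = v' (Some y)" if "y \<in> Y" for y
    using feasible_le[OF f treeD(3)[OF t] that treeD(1)[OF t']] treeD(5)[OF t' that]
      feasible_le[OF f' treeD(3)[OF t'] that treeD(1)[OF t]] treeD(5)[OF t that]
      u'[OF treeD(8)[OF t that]] u'[OF treeD(8)[OF t' that]]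
    by (metis add_le_cancel_left order_antisym)
  \<comment> \<open>Two different edges at \<open>y\<close> would both be tight for the same
    potentials; the monomial of the second edge would then have to occur in potentials of the first
    tree.\<close>
  have "\<phi> y = \<phi>' y" if y: "y \<in> Y" for y
  proof (rule ccontr)
    assume ne: "\<phi> y \<noteq> \<phi>' y"
    have e: "(\<phi>' y, Some y) \<in> X' \<times> Y'" using treeD(8)[OF t' y] y by auto
    have c0: "coeff (u i) (idx (\<phi>' y, Some y)) = 0" if "i \<in> X'" for i
    proof (cases i)
      case None then show ?thesis using treeD(3)[OF t] by simp
    next
      case (Some x)
      \<comment> \<open>Otherwise \<open>x\<close> and \<open>y\<close> would be parents of each
        other in the second tree.\<close>
      have n2: "(Some x, \<psi> x) \<noteq> (\<phi>' y, Some y)" if "x \<in> X" for x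
        using treeD(7)[OF t'' that, of y x] by (metis Pair_inject less_irrefl)
      show ?thesis unfolding Some
        by (rule coeff_tree[OF t e]) (use ne n2 that Some in auto)
    qed
    have "w (\<phi>' y) (Some y) - w (\<phi> y) (Some y) = u (\<phi>' y) - u (\<phi> y)"
      using u'[OF treeD(8)[OF t' y]]
      by (simp add: treeD(5)[OF t y, symmetric] treeD(5)[OF t' y, symmetric] v[OF y])
    then have "coeff (w (\<phi>' y) (Some y)) (idx (\<phi>' y, Some y)) - coeff (w (\<phi> y) (Some y)) (idx (\<phi>' y, Some y)) = 0"
      using c0 treeD(8)[OF t y] treeD(8)[OF t' y] by (metis coeff_diff diff_self)
    then show False
      using coeff_w[OF treeD(8)[OF t' y] _ e, of "Some y"] coeff_w[OF treeD(8)[OF t y] _ e, of "Some y"] ne y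
      by auto
  qed
  then show ?thesis by (rule fiber_count_cong)
qed


section \<open>Existence of an optimal tree\<close>

lemma degree_w: "i \<in> X' \<Longrightarrow> j \<in> Y' \<Longrightarrow> degree (w i j) \<le> N"
  using idx_less[of "(i, j)"] unfolding w_def
  by (intro degree_add_le) (auto intro!: order_trans[OF degree_monom_le])

lemma coeff_w_N:
  "i \<in> X' \<Longrightarrow> j \<in> Y' \<Longrightarrow> coeff (w i j) N = (if j = None then 1 else 0)"
  using idx_less[of "(i, j)"] unfolding w_def by auto

text \<open>The step from a left vertex to its grandparent, which is again a left vertex.\<close>

definition par :: "('b \<Rightarrow> 'a option) \<Rightarrow> ('a \<Rightarrow> 'b option) \<Rightarrow> 'a option rel" where
  "par \<phi> \<psi> = {(Some z, \<phi> y) | z y. z \<in> X \<and> \<psi> z = Some y}"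

text \<open>On the path to a root, \<open>monom 1 N\<close> enters only through an edge at the right
  root, so the coefficient at \<open>N\<close> tells which of the two roots is reached.\<close>

lemma root_or_dominated:
  assumes t: "tree \<phi> \<psi> u v rk" and "x \<in> X"
  shows "degree (u (Some x)) \<le> N \<and>
    (coeff (u (Some x)) N = 1 \<or> coeff (u (Some x)) N = 0 \<and> (Some x, None) \<in> (par \<phi> \<psi>)\<^sup>*)"
  using assms
proof (induction rule: tree_induct)
  case (root x)
  then show ?case using tree_root[OF t root] degree_w[of "Some x" None] coeff_w_N[of "Some x" None] by simp
next
  case (step x y)
  have p: "(Some x, \<phi> y) \<in> par \<phi> \<psi>" using step by (auto simp: par_def)
  have *: "degree (u (\<phi> y)) \<le> N \<and>
    (coeff (u (\<phi> y)) N = 1 \<or> coeff (u (\<phi> y)) N = 0 \<and> (\<phi> y, None) \<in> (par \<phi> \<psi>)\<^sup>*)"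
    using step(4) treeD(3)[OF t] treeD(11)[OF t step(2)] by (cases "\<phi> y") auto
  have "degree (u (Some x)) \<le> N"
    unfolding tree_step[OF t step(1,3)] using * degree_w[of "Some x" "Some y"]
      degree_w[of "\<phi> y" "Some y"] treeD(8)[OF t step(2)] step(1,2)
    by (intro degree_add_le degree_diff_le) auto
  moreover have "coeff (u (Some x)) N = coeff (u (\<phi> y)) N"
    unfolding tree_step[OF t step(1,3)] using coeff_w_N[of "Some x" "Some y"]
      coeff_w_N[of "\<phi> y" "Some y"] treeD(8)[OF t step(2)] step(1,2) by simp
  ultimately show ?case using * p by (auto intro: converse_rtrancl_into_rtrancl)
qed

lemma fiber_count_swap:
  assumes "y \<in> Y" "y1 \<in> Y"
  shows "fiber_count Y (\<phi>(y := \<phi> y1, y1 := \<phi> y)) = fiber_count Y \<phi>"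
proof
  fix x
  let ?t = "\<lambda>z. if z = y then y1 else if z = y1 then y else z"
  have "bij_betw ?t {z \<in> Y. (\<phi>(y := \<phi> y1, y1 := \<phi> y)) z = Some x} {z \<in> Y. \<phi> z = Some x}"
    by (rule bij_betw_byWitness[where f' = ?t]) (use assms in \<open>auto split: if_splits\<close>)
  then show "fiber_count Y (\<phi>(y := \<phi> y1, y1 := \<phi> y)) x = fiber_count Y \<phi> x"
    unfolding fiber_count_def by (rule bij_betw_same_card)
qed

text \<open>An alternating path: each right vertex on the chain takes as new value the child from
  which the chain enters it, along a tight tree edge, and only \<open>y\<close> acquires an edge
  that may fail to be tight. The last clause serves the induction: values changed so far lie closer
  to the root, hence \<open>y\<close> is still untouched.\<close>

lemma rotate:
  assumes t: "tree \<phi> \<psi> u v rk" and "(c, i) \<in> (par \<phi> \<psi>)\<^sup>*" "y \<in> Y" "\<phi> y = c"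
  shows "\<exists>\<phi>'. fiber_count Y \<phi>' = fiber_count Y \<phi> \<and> \<phi>' y = i \<and>
    (\<forall>y'\<in>Y. y' \<noteq> y \<longrightarrow> u (\<phi>' y') + v (Some y') = w (\<phi>' y') (Some y') \<and>
        (\<forall>x. \<phi>' y' = Some x \<longrightarrow> x \<in> X \<and> R x y')) \<and>
    (\<forall>y'\<in>Y. \<phi>' y' \<noteq> \<phi> y' \<longrightarrow> (case \<phi> y' of None \<Rightarrow> 0 | Some z \<Rightarrow> Suc (rk z)) \<le>
        (case c of None \<Rightarrow> 0 | Some z \<Rightarrow> Suc (rk z)))"
  using assms(2-)
proof (induction arbitrary: y rule: converse_rtrancl_induct)
  case base
  then show ?case
    using treeD(5)[OF t] treeD(1)[OF t] by (intro exI[of _ \<phi>]) (auto simp: pfun_def)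
next
  case (step c c1)
  let ?lev = "\<lambda>c. (case c of None \<Rightarrow> 0 | Some z \<Rightarrow> Suc (rk z))"
  obtain z y1 where z: "z \<in> X" "\<psi> z = Some y1" "c = Some z" "c1 = \<phi> y1"
    using step(1) by (auto simp: par_def)
  have y1: "y1 \<in> Y" using treeD(10)[OF t] z by blast
  have lev: "?lev c1 < ?lev c"
    using treeD(7)[OF t z(1,2)] z by (auto split: option.splits)
  obtain \<phi>1 where p1: "fiber_count Y \<phi>1 = fiber_count Y \<phi>" "\<phi>1 y1 = i"
    "\<And>y'. y' \<in> Y \<Longrightarrow> y' \<noteq> y1 \<Longrightarrow> u (\<phi>1 y') + v (Some y') = w (\<phi>1 y') (Some y') \<and>
        (\<forall>x. \<phi>1 y' = Some x \<longrightarrow> x \<in> X \<and> R x y')"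
    "\<And>y'. y' \<in> Y \<Longrightarrow> \<phi>1 y' \<noteq> \<phi> y' \<Longrightarrow> ?lev (\<phi> y') \<le> ?lev c1"
    using step(3)[OF y1 z(4)[symmetric]] by blast
  have yy: "y1 \<noteq> y" using lev z step by auto
  have p1y: "\<phi>1 y = c" using p1(4)[OF step(4)] step(5) lev by force
  let ?p = "\<phi>1(y := \<phi>1 y1, y1 := \<phi>1 y)"
  have "fiber_count Y ?p = fiber_count Y \<phi>" by (rule trans[OF fiber_count_swap[OF step(4) y1] p1(1)])
  moreover have "?p y = i" using yy p1 by auto
  moreover have "u (?p y') + v (Some y') = w (?p y') (Some y') \<and>
        (\<forall>x. ?p y' = Some x \<longrightarrow> x \<in> X \<and> R x y')" if "y' \<in> Y" "y' \<noteq> y" for y'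
    using p1(3)[OF that(1)] that(2) p1y treeD(6)[OF t z(1)] z treeD(2)[OF t] by (auto simp: pfun_def)
  moreover have "?lev (\<phi> y') \<le> ?lev c" if "y' \<in> Y" "?p y' \<noteq> \<phi> y'" for y'
    using that p1(4)[of y'] lev step(5) z(4) by (cases "y' = y"; cases "y' = y1") auto
  ultimately show ?case by blast
qed

lemma sum_w_less:
  assumes t: "tree \<phi> \<psi> u v rk" and p': "pfun X Y R \<phi>'" and fiber_count: "fiber_count Y \<phi>' = fiber_count Y \<phi>" and y: "y \<in> Y"
    and tight: "\<And>y'. y' \<in> Y \<Longrightarrow> y' \<noteq> y \<Longrightarrow> u (\<phi>' y') + v (Some y') = w (\<phi>' y') (Some y')"
    and less: "w (\<phi>' y) (Some y) < u (\<phi>' y) + v (Some y)"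
  shows "(\<Sum>y\<in>Y. w (\<phi>' y) (Some y)) < (\<Sum>y\<in>Y. w (\<phi> y) (Some y))"
proof -
  have "(\<Sum>y\<in>Y. w (\<phi>' y) (Some y)) < (\<Sum>y\<in>Y. u (\<phi>' y) + v (Some y))"
    by (rule sum_strict_mono_ex1[OF finY]) (use tight less y in \<open>force+\<close>)
  also have "\<dots> = (\<Sum>y\<in>Y. u (\<phi> y) + v (Some y))"
    using sum_option_fiber_count[OF finX finY treeD(1)[OF t], of u] sum_option_fiber_count[OF finX finY p', of u]
      treeD(3)[OF t] fiber_count by (simp add: sum.distrib)
  also have "\<dots> = (\<Sum>y\<in>Y. w (\<phi> y) (Some y))" using treeD(5)[OF t] by simp
  finally show ?thesis .
qed

text \<open>If the constraint at \<open>x\<close> and \<open>j\<close> is violated and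
  \<open>j\<close> does not lie below \<open>x\<close>, the subtree of \<open>x\<close> can be hung
  at \<open>j\<close>; this lowers its left potentials by the amount of the violation.\<close>

lemma reparent:
  assumes t: "tree \<phi> \<psi> u v rk" and x: "x \<in> X" and j: "j \<in> Y'"
    and Rj: "\<And>y. j = Some y \<Longrightarrow> R x y \<and> (\<phi> y, Some x) \<notin> (par \<phi> \<psi>)\<^sup>*"
    and less: "w (Some x) j < u (Some x) + v j"
  shows "\<exists>\<psi>' u' v' rk'. tree \<phi> \<psi>' u' v' rk' \<and> (\<Sum>x\<in>X. u' (Some x)) < (\<Sum>x\<in>X. u (Some x))"
proof -
  define D where "D = {z \<in> X. (Some z, Some x) \<in> (par \<phi> \<psi>)\<^sup>*}"
  define \<delta> where "\<delta> = u (Some x) + v j - w (Some x) j"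
  have \<delta>: "\<delta> > 0" using less by (simp add: \<delta>_def)
  define \<psi>' where "\<psi>' = \<psi>(x := j)"
  define u' where "u' = (\<lambda>i. if i \<in> Some ` D then u i - \<delta> else u i)"
  define v' where "v' = (\<lambda>j. case j of None \<Rightarrow> 0 | Some y \<Rightarrow> if \<phi> y \<in> Some ` D then v j + \<delta> else v j)"
  \<comment> \<open>The shift lifts the ranks in the moved subtree above the rank of its new
    grandparent.\<close>
  define K where "K = (case j of None \<Rightarrow> 0 | Some y \<Rightarrow> (case \<phi> y of None \<Rightarrow> 0 | Some z \<Rightarrow> Suc (rk z)))"
  define rk' where "rk' = (\<lambda>z. if z \<in> D then rk z + K else rk z)"
  have xD: "x \<in> D" using x by (auto simp: D_def)
  have Dstep: "\<phi> y \<in> Some ` D \<longleftrightarrow> x' \<in> D" if *: "x' \<in> X" "x' \<noteq> x" "\<psi> x' = Some y" for x' y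
  proof
    assume "\<phi> y \<in> Some ` D"
    then have "(\<phi> y, Some x) \<in> (par \<phi> \<psi>)\<^sup>*" by (auto simp: D_def)
    moreover have "(Some x', \<phi> y) \<in> par \<phi> \<psi>" using that by (auto simp: par_def)
    ultimately show "x' \<in> D" using that by (auto simp: D_def intro: converse_rtrancl_into_rtrancl)
  next
    assume "x' \<in> D"
    then obtain c where c: "(Some x', c) \<in> par \<phi> \<psi>" "(c, Some x) \<in> (par \<phi> \<psi>)\<^sup>*"
      using *(2) by (auto simp: D_def elim: converse_rtranclE)
    have cy: "c = \<phi> y" using c(1) that by (auto simp: par_def)
    obtain z where "c = Some z"
      using c(2) by (cases rule: converse_rtranclE) (auto simp: par_def)
    then show "\<phi> y \<in> Some ` D" using c cy treeD(11)[OF t treeD(10)[OF t that(1,3)]] by (auto simp: D_def)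
  qed
  have Droot: "x' \<notin> D" if *: "x' \<in> X" "x' \<noteq> x" "\<psi> x' = None" for x'
  proof
    assume "x' \<in> D"
    then obtain c where "(Some x', c) \<in> par \<phi> \<psi>"
      using *(2) by (auto simp: D_def elim: converse_rtranclE)
    then show False using that by (auto simp: par_def)
  qed
  have jD: "\<phi> y \<notin> Some ` D" if "j = Some y" for y
    using Rj[OF that] by (auto simp: D_def)
  have "tree \<phi> \<psi>' u' v' rk'"
    unfolding tree_def
  proof (intro conjI ballI allI impI)
    show "pfun X Y R \<phi>" using t treeD by blast
    show "pfun Y X (\<lambda>y x. R x y) \<psi>'" using treeD(2)[OF t] Rj j unfolding pfun_def \<psi>'_def by auto
    show "u' None = 0" "v' None = 0" using treeD(3)[OF t] by (auto simp: u'_def v'_def)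
  next
    fix y assume "y \<in> Y"
    then show "u' (\<phi> y) + v' (Some y) = w (\<phi> y) (Some y)"
      using treeD(5)[OF t, of y] by (auto simp: u'_def v'_def)
  next
    fix x' assume x': "x' \<in> X"
    show "u' (Some x') + v' (\<psi>' x') = w (Some x') (\<psi>' x')"
    proof (cases "x' = x")
      case True
      have "v' j = v j" using jD treeD(4)[OF t] by (auto simp: v'_def split: option.splits)
      then show ?thesis using True xD by (simp add: u'_def \<psi>'_def \<delta>_def)
    next
      case False
      then show ?thesis
        using treeD(6)[OF t x'] Dstep[OF x' False] Droot[OF x' False] treeD(4)[OF t]
        by (cases "\<psi> x'") (auto simp: u'_def \<psi>'_def v'_def)
    qed
  next
    fix x' y z assume x': "x' \<in> X" and y: "\<psi>' x' = Some y" and z: "\<phi> y = Some z"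
    show "rk' z < rk' x'"
    proof (cases "x' = x")
      case True
      then show ?thesis using y z jD xD by (auto simp: rk'_def \<psi>'_def K_def)
    next
      case False
      then show ?thesis using y z Dstep[OF x' False, of y] treeD(7)[OF t x', of y z]
        by (auto simp: rk'_def \<psi>'_def)
    qed
  qed
  moreover have "(\<Sum>x\<in>X. u' (Some x)) < (\<Sum>x\<in>X. u (Some x))"
    by (rule sum_strict_mono_ex1[OF finX]) (use xD x \<delta> in \<open>auto simp: u'_def\<close>)
  ultimately show ?thesis by blast
qed

text \<open>Two nested minimisations take the place of strong duality: \<open>\<phi>\<close> is
  cheapest for its fiber vector, and \<open>\<psi>\<close> then has the least sum of potentials
  among the trees over \<open>\<phi>\<close>. If a constraint between \<open>x\<close> and
  \<open>y\<close> fails, either \<open>x\<close> is an ancestor of \<open>y\<close> and a rotation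
  makes \<open>\<phi>\<close> cheaper, or the subtree of \<open>x\<close> can be hung at
  \<open>y\<close>.\<close>

lemma tree_exists:
  assumes p: "p \<in> fiber_vectors X Y R"
  shows "\<exists>\<phi> \<psi> u v rk. tree \<phi> \<psi> u v rk \<and> feasible u v \<and> fiber_count Y \<phi> = p"
proof -
  define \<Phi> where "\<Phi> = {\<phi>. pfun X Y R \<phi> \<and> fiber_count Y \<phi> = p \<and> (\<forall>y. y \<notin> Y \<longrightarrow> \<phi> y = None)}"
  have "\<Phi> \<subseteq> {f. \<forall>y. (y \<in> Y \<longrightarrow> f y \<in> X') \<and> (y \<notin> Y \<longrightarrow> f y = None)}"
  proof clarify
    fix \<phi> y assume "\<phi> \<in> \<Phi>"
    then show "(y \<in> Y \<longrightarrow> \<phi> y \<in> X') \<and> (y \<notin> Y \<longrightarrow> \<phi> y = None)"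
      by (cases "\<phi> y") (auto simp: \<Phi>_def pfun_def)
  qed
  then have fin: "finite \<Phi>"
    by (rule finite_subset) (rule finite_set_of_finite_funs, use finX finY in auto)
  have restr: "(\<lambda>y. if y \<in> Y then \<phi> y else None) \<in> \<Phi>" if "pfun X Y R \<phi>" "fiber_count Y \<phi> = p" for \<phi>
    using that fiber_count_cong[of Y "\<lambda>y. if y \<in> Y then \<phi> y else None" \<phi>] by (auto simp: \<Phi>_def pfun_def)
  then have "\<Phi> \<noteq> {}" using p by (auto simp: fiber_vectors_def)
  define cost where "cost = (\<lambda>\<phi>. \<Sum>y\<in>Y. w (\<phi> y) (Some y))"
  obtain \<phi> where \<phi>: "\<phi> \<in> \<Phi>" "\<And>\<phi>'. \<phi>' \<in> \<Phi> \<Longrightarrow> cost \<phi> \<le> cost \<phi>'"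
    using arg_min_if_finite[OF fin \<open>\<Phi> \<noteq> {}\<close>, of cost] by (meson not_le)
  have pf: "pfun X Y R \<phi>" and fp: "fiber_count Y \<phi> = p" using \<phi> by (auto simp: \<Phi>_def)
  have min\<phi>: "cost \<phi> \<le> cost \<phi>'" if "pfun X Y R \<phi>'" "fiber_count Y \<phi>' = p" for \<phi>'
    using \<phi>(2)[OF restr[OF that]] by (simp add: cost_def cong: sum.cong)
  define \<Psi> where "\<Psi> = {\<psi>. (\<exists>u v rk. tree \<phi> \<psi> u v rk) \<and> (\<forall>x. x \<notin> X \<longrightarrow> \<psi> x = None)}"
  have "\<Psi> \<subseteq> {f. \<forall>y. (y \<in> X \<longrightarrow> f y \<in> Y') \<and> (y \<notin> X \<longrightarrow> f y = None)}"
    unfolding \<Psi>_def using treeD(9) by blast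
  then have fin\<Psi>: "finite \<Psi>"
    by (rule finite_subset) (rule finite_set_of_finite_funs, use finX finY in auto)
  \<comment> \<open>The starting tree hangs every left vertex from the right root.\<close>
  define u0 where "u0 = (\<lambda>i. case i of None \<Rightarrow> 0 | Some x \<Rightarrow> w (Some x) None)"
  have "tree \<phi> (\<lambda>_. None) u0 (\<lambda>j. case j of None \<Rightarrow> 0 | Some y \<Rightarrow> w (\<phi> y) (Some y) - u0 (\<phi> y)) (\<lambda>_. 0)"
    using pf by (auto simp: tree_def pfun_def u0_def)
  then have "\<Psi> \<noteq> {}" unfolding \<Psi>_def by blast
  \<comment> \<open>By \<open>tree_unique\<close> the choice does not affect the values on
    \<open>X\<close>, so the sum below is a function of \<open>\<psi>\<close> alone.\<close>
  define pot where "pot = (\<lambda>\<psi>. SOME u. \<exists>v rk. tree \<phi> \<psi> u v rk)"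
  define val where "val = (\<lambda>\<psi>. \<Sum>x\<in>X. pot \<psi> (Some x))"
  obtain \<psi> where \<psi>: "\<psi> \<in> \<Psi>" "\<And>\<psi>'. \<psi>' \<in> \<Psi> \<Longrightarrow> val \<psi> \<le> val \<psi>'"
    using arg_min_if_finite[OF fin\<Psi> \<open>\<Psi> \<noteq> {}\<close>, of val] by (meson not_le)
  obtain u v rk where t: "tree \<phi> \<psi> u v rk" using \<psi> by (auto simp: \<Psi>_def)
  have val: "val \<psi> = (\<Sum>x\<in>X. u (Some x))" if t: "tree \<phi> \<psi> u v rk" for \<psi> u v rk
  proof -
    have "\<exists>u v rk. tree \<phi> \<psi> u v rk" using t by blast
    then have "\<exists>v rk. tree \<phi> \<psi> (pot \<psi>) v rk" unfolding pot_def by (rule someI_ex)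
    then show ?thesis unfolding val_def using tree_unique[OF t] by (metis (no_types, lifting) sum.cong)
  qed
  have min\<psi>: "(\<Sum>x\<in>X. u (Some x)) \<le> (\<Sum>x\<in>X. u' (Some x))" if t': "tree \<phi> \<psi>' u' v' rk'" for \<psi>' u' v' rk'
  proof -
    let ?p = "\<lambda>x. if x \<in> X then \<psi>' x else None"
    have "tree \<phi> ?p u' v' rk'" using t' by (auto simp: tree_def pfun_def)
    then show ?thesis using val[OF t] val[of ?p u' v' rk'] \<psi>(2)[of ?p] by (auto simp: \<Psi>_def)
  qed
  have rot: "u i + v (Some y) \<le> w i (Some y)"
    if *: "y \<in> Y" "(\<phi> y, i) \<in> (par \<phi> \<psi>)\<^sup>*" "\<And>x. i = Some x \<Longrightarrow> x \<in> X \<and> R x y" for y i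
  proof (rule ccontr)
    assume "\<not> u i + v (Some y) \<le> w i (Some y)"
    then have less: "w i (Some y) < u i + v (Some y)" by simp
    obtain \<phi>' where \<phi>': "fiber_count Y \<phi>' = fiber_count Y \<phi>" "\<phi>' y = i"
      "\<And>y'. y' \<in> Y \<Longrightarrow> y' \<noteq> y \<Longrightarrow> u (\<phi>' y') + v (Some y') = w (\<phi>' y') (Some y')"
      "\<And>y' x. y' \<in> Y \<Longrightarrow> y' \<noteq> y \<Longrightarrow> \<phi>' y' = Some x \<Longrightarrow> x \<in> X \<and> R x y'"
      using rotate[OF t *(2,1) refl] by blast
    have pf': "pfun X Y R \<phi>'" unfolding pfun_def using \<phi>'(2,4) that(3) by metis
    show False
      using sum_w_less[OF t pf' \<phi>'(1) that(1) \<phi>'(3)] less \<phi>'(2) min\<phi>[OF pf'] \<phi>'(1) fp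
      by (auto simp: cost_def)
  qed
  have rep: "u (Some x) + v j \<le> w (Some x) j"
    if "x \<in> X" "j \<in> Y'" "\<And>y. j = Some y \<Longrightarrow> R x y \<and> (\<phi> y, Some x) \<notin> (par \<phi> \<psi>)\<^sup>*" for x j
    using reparent[OF t that] min\<psi> by (metis not_le)
  have "feasible u v"
    unfolding feasible_def
  proof (intro conjI ballI impI)
    fix x y assume "x \<in> X" "y \<in> Y" "R x y"
    then show "u (Some x) + v (Some y) \<le> w (Some x) (Some y)"
      using rot[of y "Some x"] rep[of x "Some y"] by blast
  next
    fix x assume "x \<in> X"
    then show "u (Some x) \<le> w (Some x) None" using rep[of x None] treeD(4)[OF t] by simp
  next
    fix y assume y: "y \<in> Y"
    show "v (Some y) \<le> w None (Some y)"
    proof (cases "(\<phi> y, None) \<in> (par \<phi> \<psi>)\<^sup>*")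
      case True
      then show ?thesis using rot[OF y True] treeD(3)[OF t] by simp
    next
      case False
      then obtain x where x: "\<phi> y = Some x" by (cases "\<phi> y") auto
      then have xX: "x \<in> X" using treeD(11)[OF t y] by blast
      \<comment> \<open>The left root cannot be moved, and no rotation leads to it. Here
        \<open>y\<close> descends from the right root, so \<open>u\<close> contains
        \<open>monom 1 N\<close>; hence \<open>v\<close> at \<open>y\<close> is negative of order
        \<open>N\<close> and the constraint cannot fail.\<close>
      have c: "degree (u (Some x)) \<le> N" "coeff (u (Some x)) N = 1"
        using root_or_dominated[OF t xX] False x by auto
      show ?thesis
      proof (rule ccontr)
        assume "\<not> ?thesis"
        then have pos: "pos_poly (v (Some y) - w None (Some y))" by (simp add: less_poly_def not_le)
        have eq: "v (Some y) - w None (Some y) = w (Some x) (Some y) - u (Some x) - w None (Some y)"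
          using treeD(5)[OF t y] x by (simp add: algebra_simps)
        have "coeff (v (Some y) - w None (Some y)) N = - 1"
          unfolding eq using c coeff_w_N[of "Some x" "Some y"] coeff_w_N[of None "Some y"] xX y by simp
        moreover have "degree (v (Some y) - w None (Some y)) \<le> N"
          unfolding eq using c degree_w[of "Some x" "Some y"] degree_w[of None "Some y"] xX y
          by (intro degree_diff_le) auto
        ultimately have "degree (v (Some y) - w None (Some y)) = N"
          by (metis le_antisym le_degree one_neq_zero neg_equal_0_iff_equal)
        then show False
          using pos \<open>coeff (v (Some y) - w None (Some y)) N = - 1\<close> by (simp add: pos_poly_def)
      qed
    qed
  qed
  then show ?thesis using t fp by blast
qed

end

text \<open>A fiber vector is sent to the fiber vector of the opposite function in an optimal tree;
  by \<open>tree_determined\<close> the image recovers the argument.\<close>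

lemma card_fiber_vectors_le:
  assumes "finite X" "finite Y"
  shows "card (fiber_vectors X Y R) \<le> card (fiber_vectors Y X (\<lambda>y x. R x y))"
proof -
  have "finite (insert None (Some ` X) \<times> insert None (Some ` Y))" using assms by auto
  then obtain idx :: "'a option \<times> 'b option \<Rightarrow> nat" and N where
    idx: "bij_betw idx (insert None (Some ` X) \<times> insert None (Some ` Y)) {0..<N}"
    using ex_bij_betw_finite_nat by blast
  interpret bipartite_weights X Y R idx N
    by unfold_locales (use assms idx in \<open>auto simp: bij_betw_def\<close>)
  define f where "f = (\<lambda>p. SOME q. \<exists>\<phi> \<psi> u v rk. tree \<phi> \<psi> u v rk \<and> feasible u v \<and> fiber_count Y \<phi> = p \<and> fiber_count X \<psi> = q)"
  have f: "\<exists>\<phi> \<psi> u v rk. tree \<phi> \<psi> u v rk \<and> feasible u v \<and> fiber_count Y \<phi> = p \<and> fiber_count X \<psi> = f p"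
    if "p \<in> fiber_vectors X Y R" for p
  proof -
    have "\<exists>q \<phi> \<psi> u v rk. tree \<phi> \<psi> u v rk \<and> feasible u v \<and> fiber_count Y \<phi> = p \<and> fiber_count X \<psi> = q"
      using tree_exists[OF that] by blast
    then show ?thesis unfolding f_def by (rule someI_ex)
  qed
  show ?thesis
  proof (rule card_inj_on_le)
    show "inj_on f (fiber_vectors X Y R)"
      using f tree_determined by (intro inj_onI) metis
    show "f ` fiber_vectors X Y R \<subseteq> fiber_vectors Y X (\<lambda>y x. R x y)"
    proof clarify
      fix p assume "p \<in> fiber_vectors X Y R"
      then obtain \<phi> \<psi> u v rk where "tree \<phi> \<psi> u v rk" "fiber_count X \<psi> = f p" using f by blast
      then show "f p \<in> fiber_vectors Y X (\<lambda>y x. R x y)" using treeD(2) by (force simp: fiber_vectors_def)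
    qed
    show "finite (fiber_vectors Y X (\<lambda>y x. R x y))" using assms by (simp add: finite_fiber_vectors)
  qed
qed

lemma card_fiber_vectors_swap:
  assumes "finite X" "finite Y"
  shows "card (fiber_vectors X Y R) = card (fiber_vectors Y X (\<lambda>y x. R x y))"
  using card_fiber_vectors_le[OF assms, of R] card_fiber_vectors_le[OF assms(2,1), of "\<lambda>y x. R x y"] by simp

section \<open>Transport feasibility and its generating function\<close>

text \<open>The induction of Halmos and Vaughan: if every proper nonempty subset has a surplus of
  neighbours, any choice for one element preserves the condition; otherwise a tight subset is
  matched first and the rest avoids its neighbourhood.\<close>

lemma hall_marriage:
  assumes "finite A" "\<And>a. a \<in> A \<Longrightarrow> finite (N a)"
    and "\<And>S. S \<subseteq> A \<Longrightarrow> card S \<le> card (\<Union> (N ` S))"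
  shows "\<exists>f. inj_on f A \<and> (\<forall>a\<in>A. f a \<in> N a)"
  using assms
proof (induction "card A" arbitrary: A N rule: less_induct)
  case less
  show ?case
  proof (cases "A = {}")
    case True then show ?thesis by auto
  next
    case ne: False
    show ?thesis
    proof (cases "\<forall>S. S \<noteq> {} \<longrightarrow> S \<subset> A \<longrightarrow> card S < card (\<Union> (N ` S))")
      case True
      obtain a where a: "a \<in> A" using ne by blast
      have "card {a} \<le> card (\<Union> (N ` {a}))" using less(4)[of "{a}"] a by blast
      then obtain b where b: "b \<in> N a" by (cases "N a = {}") auto
      have "\<exists>f. inj_on f (A - {a}) \<and> (\<forall>x\<in>A - {a}. f x \<in> N x - {b})"
      proof (rule less(1))
        show "card (A - {a}) < card A" using a less(2) by (simp add: card_gt_0_iff ne)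
        show "card S \<le> card (\<Union>x\<in>S. N x - {b})" if S: "S \<subseteq> A - {a}" for S
        proof (cases "S = {}")
          case False
          then have "card S < card (\<Union> (N ` S))" using True S a by blast
          moreover have "(\<Union>x\<in>S. N x - {b}) = \<Union> (N ` S) - {b}" by blast
          moreover have "finite (\<Union> (N ` S))" using S less(2,3) by (auto intro: finite_subset)
          ultimately show ?thesis by (auto simp: card_Diff_singleton_if)
        qed simp
      qed (use less in auto)
      then obtain f where f: "inj_on f (A - {a})" "\<forall>x\<in>A - {a}. f x \<in> N x - {b}" by blast
      have "inj_on (f(a := b)) A"
        using f a unfolding inj_on_def by auto
      then show ?thesis using f b by (intro exI[of _ "f(a := b)"]) auto
    next
      case False
      then obtain S where S: "S \<noteq> {}" "S \<subset> A" "card (\<Union> (N ` S)) = card S"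
        using less(4) by (meson le_antisym not_less psubset_imp_subset)
      have finS: "finite S" using S less(2) finite_subset by auto
      have finN: "finite (\<Union> (N ` T))" if "T \<subseteq> A" for T
        using that less(2,3) by (auto intro: finite_subset)
      have "\<exists>f. inj_on f S \<and> (\<forall>x\<in>S. f x \<in> N x)"
      proof (rule less(1))
        show "card S < card A" using S(2) less(2) by (rule psubset_card_mono[rotated])
        show "finite S" by (rule finS)
        show "finite (N a)" if "a \<in> S" for a using that S(2) less(3) by blast
        show "card T \<le> card (\<Union> (N ` T))" if "T \<subseteq> S" for T using that S(2) less(4)[of T] by blast
      qed
      then obtain f where f: "inj_on f S" "\<forall>x\<in>S. f x \<in> N x" by blast
      have "\<exists>g. inj_on g (A - S) \<and> (\<forall>x\<in>A - S. g x \<in> N x - \<Union> (N ` S))"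
      proof (rule less(1))
        show "card (A - S) < card A" using S(1,2) less(2) by (intro psubset_card_mono) auto
        show "card T \<le> card (\<Union>x\<in>T. N x - \<Union> (N ` S))" if T: "T \<subseteq> A - S" for T
        proof -
          have "finite T" using T less(2) finite_subset by auto
          then have "card S + card T = card (S \<union> T)"
            using T finS by (subst card_Un_disjoint) auto
          also have "\<dots> \<le> card (\<Union> (N ` (S \<union> T)))" using less(4)[of "S \<union> T"] S T by auto
          also have "\<Union> (N ` (S \<union> T)) = \<Union> (N ` S) \<union> (\<Union>x\<in>T. N x - \<Union> (N ` S))" by auto
          also have "card \<dots> \<le> card (\<Union> (N ` S)) + card (\<Union>x\<in>T. N x - \<Union> (N ` S))" by (rule card_Un_le)
          finally show ?thesis using S(3) by simp
        qed
      qed (use less S in auto)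
      then obtain g where g: "inj_on g (A - S)" "\<forall>x\<in>A - S. g x \<in> N x - \<Union> (N ` S)" by blast
      let ?h = "\<lambda>x. if x \<in> S then f x else g x"
      have "inj_on ?h A"
      proof (rule inj_onI)
        fix x y assume "x \<in> A" "y \<in> A" "?h x = ?h y"
        moreover have "f z \<in> \<Union> (N ` S)" if "z \<in> S" for z using f that by blast
        moreover have "g z \<notin> \<Union> (N ` S)" if "z \<in> A - S" for z using g that by blast
        ultimately show "x = y" using inj_onD[OF f(1), of x y] inj_onD[OF g(1), of x y]
          by (cases "x \<in> S"; cases "y \<in> S") force+
      qed
      then show ?thesis using f g by (intro exI[of _ ?h]) auto
    qed
  qed
qed

text \<open>The stable set inequalities. Think of \<open>m\<close> units, each carrying an edge, a
  single vertex or nothing: no unit serves two elements of a stable set. Hall's theorem shows that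
  nothing else restricts the weights.\<close>

definition transportable :: "'a set \<Rightarrow> 'b set \<Rightarrow> ('a \<Rightarrow> 'b \<Rightarrow> bool) \<Rightarrow> nat \<Rightarrow> ('a \<Rightarrow> nat) \<Rightarrow> ('b \<Rightarrow> nat) \<Rightarrow> bool" where
  "transportable X Y R m p q \<longleftrightarrow>
     (\<forall>A\<subseteq>X. \<forall>B\<subseteq>Y. (\<forall>x\<in>A. \<forall>y\<in>B. \<not> R x y) \<longrightarrow> sum p A + sum q B \<le> m)"

text \<open>The copies of \<open>None\<close> are the units without an element of \<open>Y\<close>;
  \<open>blow_up_rel\<close> below joins them to every \<open>x\<close>.\<close>

definition blow_up :: "'b set \<Rightarrow> ('b option \<Rightarrow> nat) \<Rightarrow> ('b option \<times> nat) set" where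
  "blow_up Y Q = (SIGMA j : insert None (Some ` Y). {..<Q j})"

definition blow_up_rel :: "('a \<Rightarrow> 'b \<Rightarrow> bool) \<Rightarrow> 'a \<Rightarrow> 'b option \<times> nat \<Rightarrow> bool" where
  "blow_up_rel R x j \<longleftrightarrow> (\<forall>y. fst j = Some y \<longrightarrow> R x y)"

lemma finite_blow_up: "finite Y \<Longrightarrow> finite (blow_up Y Q)"
  by (simp add: blow_up_def)

lemma card_blow_up: "finite Y \<Longrightarrow> card (blow_up Y Q) = Q None + (\<Sum>y\<in>Y. Q (Some y))"
  by (simp add: blow_up_def sum.reindex)

lemma transportable_swap: "transportable X Y R m p q \<longleftrightarrow> transportable Y X (\<lambda>y x. R x y) m q p"
  unfolding transportable_def by (metis add.commute)

text \<open>Hall's theorem for \<open>p x\<close> tokens of each \<open>x\<close>, to be placed on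
  \<open>m\<close> units: \<open>q y\<close> of them already carry \<open>y\<close>, the remaining
  \<open>m - sum q Y\<close> are free. The partial function tells which token, if any, a unit
  receives.\<close>

lemma transportable_iff:
  assumes X: "finite X" and Y: "finite Y" and p: "\<And>x. x \<notin> X \<Longrightarrow> p x = 0"
  shows "transportable X Y R m p q \<longleftrightarrow> sum q Y \<le> m \<and>
    p \<in> fiber_vectors X (blow_up Y (case_option (m - sum q Y) q)) (blow_up_rel R)"
    (is "_ \<longleftrightarrow> _ \<and> p \<in> fiber_vectors X ?B _")
proof (intro iffI conjI)
  assume f: "transportable X Y R m p q"
  show qm: "sum q Y \<le> m" using f[unfolded transportable_def, rule_format, of "{}" Y] by simp
  define N where "N = (\<lambda>(x, k::nat). {j \<in> ?B. blow_up_rel R x j})"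
  have "\<exists>f. inj_on f (SIGMA x : X. {..<p x}) \<and> (\<forall>a\<in>(SIGMA x : X. {..<p x}). f a \<in> N a)"
  proof (rule hall_marriage)
    fix S assume S: "S \<subseteq> (SIGMA x : X. {..<p x})"
    show "card S \<le> card (\<Union> (N ` S))"
    proof (cases "S = {}")
      case False
      define A where "A = fst ` S"
      \<comment> \<open>\<open>A\<close> and \<open>B\<close> form a stable set, while the copies of
        \<open>Y - B\<close> and, \<open>A\<close> being nonempty, all free units are neighbours of
        the tokens.\<close>
      define B where "B = {y \<in> Y. \<forall>x\<in>A. \<not> R x y}"
      have A: "A \<subseteq> X" "A \<noteq> {}" using S False by (auto simp: A_def)
      have "S \<subseteq> (SIGMA x : A. {..<p x})" using S by (force simp: A_def)
      then have "card S \<le> card (SIGMA x : A. {..<p x})"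
        using A X by (intro card_mono) (auto intro: finite_subset)
      also have "\<dots> = sum p A" using A X by (subst card_SigmaI) (auto intro: finite_subset)
      also have "\<dots> + sum q B \<le> m"
        using f A unfolding transportable_def by (auto simp: B_def)
      then have "sum p A \<le> m - sum q Y + sum q (Y - B)"
        using qm sum.subset_diff[of B Y q] Y by (auto simp: B_def)
      also have "\<dots> = card (blow_up (Y - B) (case_option (m - sum q Y) q))"
        using Y by (subst card_blow_up) auto
      also have "\<dots> \<le> card (\<Union> (N ` S))"
      proof (rule card_mono)
        show "finite (\<Union> (N ` S))"
          by (rule finite_subset[OF _ finite_blow_up[OF Y]]) (auto simp: N_def)
        show "blow_up (Y - B) (case_option (m - sum q Y) q) \<subseteq> \<Union> (N ` S)"
        proof
          fix j assume j: "j \<in> blow_up (Y - B) (case_option (m - sum q Y) q)"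
          have "\<exists>x\<in>A. blow_up_rel R x j"
            using j A(2) by (auto simp: blow_up_def blow_up_rel_def B_def)
          then obtain s where "s \<in> S" "blow_up_rel R (fst s) j" by (auto simp: A_def)
          moreover have "j \<in> ?B" using j by (auto simp: blow_up_def)
          ultimately show "j \<in> \<Union> (N ` S)" by (auto simp: N_def split_beta)
        qed
      qed
      finally show ?thesis .
    qed simp
  qed (use X Y finite_blow_up[OF Y] in \<open>auto simp: N_def\<close>)
  then obtain f where f: "inj_on f (SIGMA x : X. {..<p x})"
    and fN: "\<And>x k. x \<in> X \<Longrightarrow> k < p x \<Longrightarrow> f (x, k) \<in> ?B \<and> blow_up_rel R x (f (x, k))"
    by (force simp: N_def)
  define \<phi> where "\<phi> = (\<lambda>j. if \<exists>x\<in>X. \<exists>k<p x. j = f (x, k)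
      then Some (SOME x. x \<in> X \<and> (\<exists>k<p x. j = f (x, k))) else None)"
  have \<phi>1: "\<phi> (f (x, k)) = Some x" if "x \<in> X" "k < p x" for x k
  proof -
    have "(SOME z. z \<in> X \<and> (\<exists>l<p z. f (x, k) = f (z, l))) = x"
      by (rule some_equality) (use that f in \<open>auto dest: inj_onD\<close>)
    then show ?thesis using that unfolding \<phi>_def by auto
  qed
  have \<phi>2: "\<exists>x\<in>X. \<exists>k<p x. j = f (x, k)" if "\<phi> j = Some z" for j z
    using that by (auto simp: \<phi>_def split: if_splits)
  have pf: "pfun X ?B (blow_up_rel R) \<phi>"
    unfolding pfun_def using \<phi>1 \<phi>2 fN by (metis option.inject)
  moreover have "fiber_count ?B \<phi> = p"
  proof
    fix x
    show "fiber_count ?B \<phi> x = p x"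
    proof (cases "x \<in> X")
      case True
      have "bij_betw (\<lambda>k. f (x, k)) {..<p x} {j \<in> ?B. \<phi> j = Some x}"
        unfolding bij_betw_def
      proof
        show "inj_on (\<lambda>k. f (x, k)) {..<p x}"
          using f True by (auto simp: inj_on_def)
        show "(\<lambda>k. f (x, k)) ` {..<p x} = {j \<in> ?B. \<phi> j = Some x}"
        proof (intro equalityI subsetI)
          fix j assume "j \<in> (\<lambda>k. f (x, k)) ` {..<p x}"
          then obtain k where "k < p x" "j = f (x, k)" by blast
          then show "j \<in> {j \<in> ?B. \<phi> j = Some x}" using \<phi>1[OF True] fN[OF True] by simp
        next
          fix j assume j: "j \<in> {j \<in> ?B. \<phi> j = Some x}"
          then obtain z k where z: "z \<in> X" "k < p z" "j = f (z, k)" using \<phi>2 by blast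
          then have "z = x" using \<phi>1[of z k] j by simp
          then show "j \<in> (\<lambda>k. f (x, k)) ` {..<p x}" using z by blast
        qed
      qed
      from bij_betw_same_card[OF this] show ?thesis by (simp add: fiber_count_def)
    next
      case False
      show ?thesis by (rule trans[OF fiber_count_outside[OF pf False] p[OF False, symmetric]])
    qed
  qed
  ultimately show "p \<in> fiber_vectors X ?B (blow_up_rel R)" by (auto simp: fiber_vectors_def)
next
  assume a: "sum q Y \<le> m \<and> p \<in> fiber_vectors X ?B (blow_up_rel R)"
  then obtain \<phi> where \<phi>: "pfun X ?B (blow_up_rel R) \<phi>" "p = fiber_count ?B \<phi>" by (auto simp: fiber_vectors_def)
  show "transportable X Y R m p q"
    unfolding transportable_def
  proof (intro allI impI)
    fix A B assume A: "A \<subseteq> X" and B: "B \<subseteq> Y" and stable: "\<forall>x\<in>A. \<forall>y\<in>B. \<not> R x y"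
    have fin: "finite A" "finite B" "finite ?B" using A B X Y finite_subset finite_blow_up by auto
    \<comment> \<open>The units receiving a token of \<open>A\<close> and the units carrying an
      element of \<open>B\<close> are disjoint parts of the \<open>m\<close> units.\<close>
    have "sum p A = card (\<Union>x\<in>A. {j \<in> ?B. \<phi> j = Some x})"
      unfolding \<phi>(2) fiber_count_def using fin by (subst card_UN_disjoint) auto
    moreover have "sum q B = card (SIGMA j : Some ` B. {..<case_option (m - sum q Y) q j})"
      using fin by (simp add: sum.reindex)
    moreover have "card (\<Union>x\<in>A. {j \<in> ?B. \<phi> j = Some x}) + card (SIGMA j : Some ` B. {..<case_option (m - sum q Y) q j})
      = card ((\<Union>x\<in>A. {j \<in> ?B. \<phi> j = Some x}) \<union> (SIGMA j : Some ` B. {..<case_option (m - sum q Y) q j}))"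
      using fin \<phi>(1) stable unfolding pfun_def
      by (intro card_Un_disjoint[symmetric]) (fastforce simp: blow_up_rel_def)+
    moreover have "\<dots> \<le> card ?B"
      using fin B by (intro card_mono) (auto simp: blow_up_def)
    moreover have "card ?B = m" using a Y by (simp add: card_blow_up)
    ultimately show "sum p A + sum q B \<le> m" by simp
  qed
qed

section \<open>Generating functions weighted by support\<close>

definition compositions :: "'a set \<Rightarrow> nat \<Rightarrow> ('a \<Rightarrow> nat) set" where
  "compositions K n = {c. (\<forall>k. k \<notin> K \<longrightarrow> c k = 0) \<and> sum c K = n}"

lemma finite_compositions:
  assumes "finite K" shows "finite (compositions K n)"
proof (rule finite_subset)
  show "compositions K n \<subseteq> {f. \<forall>x. (x \<in> K \<longrightarrow> f x \<in> {..n}) \<and> (x \<notin> K \<longrightarrow> f x = 0)}"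
    using assms by (auto simp: compositions_def intro: member_le_sum)
  show "finite {f. \<forall>x. (x \<in> K \<longrightarrow> f x \<in> {..n}) \<and> (x \<notin> K \<longrightarrow> f x = (0::nat))}"
    by (rule finite_set_of_finite_funs) (use assms in auto)
qed

lemma fps_prod_nth_compositions:
  fixes F :: "'a \<Rightarrow> 'k::comm_ring_1 fps"
  assumes "finite K"
  shows "fps_nth (\<Prod>k\<in>K. F k) n = (\<Sum>c\<in>compositions K n. \<Prod>k\<in>K. fps_nth (F k) (c k))"
  using assms
proof (induction K arbitrary: n rule: finite_induct)
  case empty
  have "compositions ({} :: 'a set) n = (if n = 0 then {\<lambda>_. 0} else {})" by (auto simp: compositions_def)
  then show ?case by (cases "n = 0") auto
next
  case (insert a K)
  have upd: "(\<Sum>x\<in>K. if x = a then i else c x) = sum c K" for i :: nat and c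
    using insert.hyps by (intro sum.cong) auto
  have updp: "(\<Prod>x\<in>K. fps_nth (F x) (if x = a then i else c x)) = (\<Prod>x\<in>K. fps_nth (F x) (c x))"
    for i :: nat and c
    using insert.hyps by (intro prod.cong) auto
  have bij: "bij_betw (\<lambda>(i, c). c(a := i)) (SIGMA i : {0..n}. compositions K (n - i)) (compositions (insert a K) n)"
    by (rule bij_betw_byWitness[where f' = "\<lambda>c. (c a, c(a := 0))"])
       (use insert.hyps in \<open>auto simp: compositions_def fun_eq_iff upd\<close>)
  have "fps_nth (\<Prod>k\<in>insert a K. F k) n = (\<Sum>i=0..n. fps_nth (F a) i * fps_nth (\<Prod>k\<in>K. F k) (n - i))"
    using insert by (simp add: fps_mult_nth)
  also have "\<dots> = (\<Sum>i=0..n. \<Sum>c\<in>compositions K (n - i). fps_nth (F a) i * (\<Prod>k\<in>K. fps_nth (F k) (c k)))"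
    by (simp add: insert.IH sum_distrib_left)
  also have "\<dots> = (\<Sum>(i,c)\<in>(SIGMA i : {0..n}. compositions K (n - i)). fps_nth (F a) i * (\<Prod>k\<in>K. fps_nth (F k) (c k)))"
    using insert by (intro sum.Sigma) (auto simp: finite_compositions)
  also have "\<dots> = (\<Sum>c\<in>compositions (insert a K) n. \<Prod>k\<in>insert a K. fps_nth (F k) (c k))"
    by (subst sum.reindex_bij_betw[OF bij, symmetric], intro sum.cong)
       (use insert.hyps in \<open>auto simp: updp\<close>)
  finally show ?case .
qed

definition supp_wt :: "real \<Rightarrow> nat \<Rightarrow> real" where
  "supp_wt t n = (if n = 0 then 1 else t)"

definition fiber_sum :: "real \<Rightarrow> 'a set \<Rightarrow> 'b set \<Rightarrow> ('a \<Rightarrow> 'b \<Rightarrow> bool) \<Rightarrow> real" where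
  "fiber_sum t X Y R = (\<Sum>p\<in>fiber_vectors X Y R. \<Prod>x\<in>X. supp_wt t (p x))"

abbreviation supp_fps :: "real \<Rightarrow> real fps" where "supp_fps t \<equiv> Abs_fps (supp_wt t)"

lemma supp_fps_Suc: "fps_nth (supp_fps t ^ Suc k) (Suc n) = fps_nth (supp_fps t ^ k) (Suc n) + t * (\<Sum>i\<le>n. fps_nth (supp_fps t ^ k) i)"
proof -
  have "fps_nth (supp_fps t ^ Suc k) (Suc n) = (\<Sum>i\<le>Suc n. supp_wt t i * fps_nth (supp_fps t ^ k) (Suc n - i))"
    by (simp add: fps_mult_nth atLeast0AtMost)
  also have "\<dots> = fps_nth (supp_fps t ^ k) (Suc n) + (\<Sum>i\<le>n. t * fps_nth (supp_fps t ^ k) (n - i))"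
    by (subst sum.atMost_Suc_shift) (simp add: supp_wt_def)
  also have "(\<Sum>i\<le>n. t * fps_nth (supp_fps t ^ k) (n - i)) = t * (\<Sum>i\<le>n. fps_nth (supp_fps t ^ k) i)"
    using sum.nat_diff_reindex[of "\<lambda>i. fps_nth (supp_fps t ^ k) i" "Suc n"]
    by (simp add: sum_distrib_left[symmetric] lessThan_Suc_atMost)
  finally show ?thesis .
qed

lemma supp_fps_0: "fps_nth (supp_fps t ^ k) 0 = 1"
  by (simp add: fps_power_zeroth supp_wt_def)

text \<open>In a second variable \<open>z\<close>, \<open>supp_fps t\<close> is
  \<open>(1 + (t - 1) z) / (1 - z)\<close>, and partial sums add a factor
  \<open>1 / (1 - z)\<close>. Summing the geometric series over \<open>k\<close> gives
  \<open>1 / ((1 - x) - z (1 + (t - 1) x))\<close>; the claim is its coefficient at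
  \<open>z^n\<close>. The induction on \<open>n\<close> uses the corresponding recursion.\<close>

lemma gf_partial:
  "Abs_fps (\<lambda>k. \<Sum>i\<le>n. fps_nth (supp_fps t ^ k) i) * (1 - fps_X) ^ Suc n = (1 + fps_const (t - 1) * fps_X) ^ n"
proof (induction n)
  case 0
  have "Abs_fps (\<lambda>k. \<Sum>i\<le>0. fps_nth (supp_fps t ^ k) i) * (1 - fps_X) = 1"
    by (rule fps_ext) (simp add: supp_fps_0 algebra_simps fps_X_mult_right_nth fps_X_mult_nth)
  then show ?case by simp
next
  case (Suc n)
  let ?S = "\<lambda>n. Abs_fps (\<lambda>k. \<Sum>i\<le>n. fps_nth (supp_fps t ^ k) i)"
  have "?S (Suc n) * (1 - fps_X) = ?S n * (1 + fps_const (t - 1) * fps_X)"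
  proof (rule fps_ext)
    fix k
    show "fps_nth (?S (Suc n) * (1 - fps_X)) k = fps_nth (?S n * (1 + fps_const (t - 1) * fps_X)) k"
      by (cases k) (auto simp: algebra_simps fps_X_mult_right_nth fps_X_mult_nth supp_fps_Suc simp del: power_Suc)
  qed
  note step = this
  have "?S (Suc n) * (1 - fps_X) ^ Suc (Suc n) = (?S (Suc n) * (1 - fps_X)) * (1 - fps_X) ^ Suc n"
    by (simp only: power_Suc mult_ac)
  also have "\<dots> = ?S n * (1 + fps_const (t - 1) * fps_X) * (1 - fps_X) ^ Suc n"
    by (simp only: step)
  also have "\<dots> = (?S n * (1 - fps_X) ^ Suc n) * (1 + fps_const (t - 1) * fps_X)"
    by (simp only: mult_ac)
  finally show ?case unfolding Suc by (simp only: power_Suc2)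
qed

text \<open>The contribution of a single \<open>y\<close>: it has \<open>k = q y\<close> copies,
  weighted by \<open>supp_wt\<close>, over which \<open>h\<close> elements are distributed.\<close>

definition supp_gen :: "real \<Rightarrow> nat \<Rightarrow> real fps" where
  "supp_gen t h = Abs_fps (\<lambda>k. supp_wt t k * fps_nth (supp_fps t ^ k) h)"

text \<open>Multiplication by \<open>1 - x\<close> takes differences in \<open>k\<close>. For
  \<open>h > 0\<close> they are \<open>t^2\<close> times partial sums: one factor \<open>t\<close>
  is the weight of \<open>k\<close> itself, the other belongs to the additional copy, which must be
  used.\<close>

lemma gf_part:
  "supp_gen t h * (1 - fps_X) ^ Suc h =
    (if h = 0 then 1 + fps_const (t - 1) * fps_X
     else fps_const (t\<^sup>2) * fps_X * (1 + fps_const (t - 1) * fps_X) ^ (h - 1))"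
proof (cases h)
  case 0
  have "supp_gen t 0 * (1 - fps_X) = 1 + fps_const (t - 1) * fps_X"
  proof (rule fps_ext)
    fix k
    show "fps_nth (supp_gen t 0 * (1 - fps_X)) k = fps_nth (1 + fps_const (t - 1) * fps_X) k"
      by (cases k; cases "k - 1") (auto simp: supp_gen_def supp_fps_0 supp_wt_def algebra_simps)
  qed
  then show ?thesis using 0 by simp
next
  case (Suc n)
  let ?S = "Abs_fps (\<lambda>k. \<Sum>i\<le>n. fps_nth (supp_fps t ^ k) i)"
  have "supp_gen t (Suc n) * (1 - fps_X) = fps_const (t\<^sup>2) * fps_X * ?S"
  proof (rule fps_ext)
    fix k
    show "fps_nth (supp_gen t (Suc n) * (1 - fps_X)) k = fps_nth (fps_const (t\<^sup>2) * fps_X * ?S) k"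
    proof (cases k)
      case 0 then show ?thesis by (simp add: supp_gen_def)
    next
      case (Suc l)
      \<comment> \<open>At \<open>l = 0\<close> the two weights differ, but the power is 1 and has
        no coefficient in positive degree.\<close>
      have a: "supp_wt t l * fps_nth (supp_fps t ^ l) (Suc n) = t * fps_nth (supp_fps t ^ l) (Suc n)"
        by (cases l) (auto simp: supp_wt_def)
      have "fps_nth (supp_gen t (Suc n) * (1 - fps_X)) k = t * fps_nth (supp_fps t ^ Suc l) (Suc n) - t * fps_nth (supp_fps t ^ l) (Suc n)"
        unfolding Suc supp_gen_def using a by (simp add: right_diff_distrib supp_wt_def del: power_Suc)
      also have "\<dots> = t\<^sup>2 * (\<Sum>i\<le>n. fps_nth (supp_fps t ^ l) i)"
        unfolding supp_fps_Suc by (simp add: algebra_simps power2_eq_square)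
      finally show ?thesis by (simp add: Suc mult.assoc)
    qed
  qed
  moreover have "supp_gen t (Suc n) * (1 - fps_X) ^ Suc (Suc n) = (supp_gen t (Suc n) * (1 - fps_X)) * (1 - fps_X) ^ Suc n"
    by (simp only: power_Suc mult_ac)
  ultimately have "supp_gen t (Suc n) * (1 - fps_X) ^ Suc (Suc n) = fps_const (t\<^sup>2) * fps_X * (?S * (1 - fps_X) ^ Suc n)"
    by (simp only: mult_ac)
  then show ?thesis unfolding gf_partial using Suc by simp
qed

section \<open>Fiber vectors of blow-ups\<close>

lemma card_split_exists:
  fixes c :: "'k \<Rightarrow> nat"
  assumes "finite K" "finite A" "sum c K \<le> card A"
  shows "\<exists>g. (\<forall>a\<in>A. \<forall>k. g a = Some k \<longrightarrow> k \<in> K) \<and> (\<forall>k\<in>K. card {a \<in> A. g a = Some k} = c k)"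
  using assms
proof (induction K arbitrary: A rule: finite_induct)
  case empty
  then show ?case by (intro exI[of _ "\<lambda>_. None"]) auto
next
  case (insert k K)
  have "c k \<le> card A" using insert by simp
  then obtain B where B: "B \<subseteq> A" "card B = c k" by (meson obtain_subset_with_card_n)
  have "finite B" using B insert finite_subset by auto
  then have "sum c K \<le> card (A - B)" using insert B by (simp add: card_Diff_subset)
  then obtain g where g: "\<forall>a\<in>A - B. \<forall>k. g a = Some k \<longrightarrow> k \<in> K"
    "\<forall>k\<in>K. card {a \<in> A - B. g a = Some k} = c k"
    using insert.IH[of "A - B"] insert.prems by auto
  let ?g = "\<lambda>a. if a \<in> B then Some k else g a"
  have "{a \<in> A. ?g a = Some k} = B" using B g(1) insert.hyps by auto
  moreover have "{a \<in> A. ?g a = Some l} = {a \<in> A - B. g a = Some l}" if "l \<in> K" for l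
    using that insert.hyps by auto
  ultimately show ?case using g B by (intro exI[of _ ?g]) auto
qed

lemma sum_fiber_count_le:
  assumes "finite X" "finite Y" "h \<in> fiber_vectors Y X R"
  shows "sum h Y \<le> card X"
proof -
  obtain \<psi> where \<psi>: "pfun Y X R \<psi>" "h = fiber_count X \<psi>" using assms by (auto simp: fiber_vectors_def)
  have "sum h Y = card (\<Union>y\<in>Y. {x \<in> X. \<psi> x = Some y})"
    unfolding \<psi>(2) fiber_count_def using assms by (subst card_UN_disjoint) auto
  also have "\<dots> \<le> card X" using assms by (intro card_mono) auto
  finally show ?thesis .
qed

lemma sum_fiber_count_eq:
  assumes "finite X" "finite Y" "pfun Y X R \<psi>"
  shows "sum (fiber_count X \<psi>) Y + card {x \<in> X. \<psi> x = None} = card X"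
proof -
  have "sum (fiber_count X \<psi>) Y = card (\<Union>y\<in>Y. {x \<in> X. \<psi> x = Some y})"
    unfolding fiber_count_def using assms by (subst card_UN_disjoint) auto
  moreover have "card (\<Union>y\<in>Y. {x \<in> X. \<psi> x = Some y}) + card {x \<in> X. \<psi> x = None}
     = card ((\<Union>y\<in>Y. {x \<in> X. \<psi> x = Some y}) \<union> {x \<in> X. \<psi> x = None})"
    using assms by (intro card_Un_disjoint[symmetric]) auto
  moreover have "(\<Union>y\<in>Y. {x \<in> X. \<psi> x = Some y}) \<union> {x \<in> X. \<psi> x = None} = X"
    using assms(3) by (auto simp: pfun_def) (metis option.exhaust)
  ultimately show ?thesis by simp
qed

definition proj :: "'b set \<Rightarrow> ('b option \<Rightarrow> nat) \<Rightarrow> ('b option \<times> nat \<Rightarrow> nat) \<Rightarrow> 'b \<Rightarrow> nat" where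
  "proj Y Q h' y = (if y \<in> Y then \<Sum>k<Q (Some y). h' (Some y, k) else 0)"

text \<open>Copies of \<open>y\<close> have the same neighbours, so only their total is restricted.
  The copies of \<open>None\<close> accept every element of \<open>X\<close> and share those left
  over.\<close>

lemma fiber_vectors_blow_up:
  assumes X: "finite X" and Y: "finite Y"
  shows "h' \<in> fiber_vectors (blow_up Y Q) X (\<lambda>j x. blow_up_rel R x j) \<longleftrightarrow>
    (\<forall>j. j \<notin> blow_up Y Q \<longrightarrow> h' j = 0) \<and> proj Y Q h' \<in> fiber_vectors Y X (\<lambda>y x. R x y) \<and>
    (\<Sum>k<Q None. h' (None, k)) \<le> card X - sum (proj Y Q h') Y" (is "?l \<longleftrightarrow> ?r")
proof
  assume ?l
  then obtain \<psi>' where \<psi>': "pfun (blow_up Y Q) X (\<lambda>j x. blow_up_rel R x j) \<psi>'" "h' = fiber_count X \<psi>'"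
    by (auto simp: fiber_vectors_def)
  define \<psi> where "\<psi> = (\<lambda>x. case \<psi>' x of None \<Rightarrow> None | Some j \<Rightarrow> fst j)"
  have eq: "(\<Sum>k<Q j. h' (j, k)) = card {x \<in> X. \<exists>k. \<psi>' x = Some (j, k)}" if "j \<in> insert None (Some ` Y)" for j
  proof -
    have "(\<Sum>k<Q j. h' (j, k)) = card (\<Union>k<Q j. {x \<in> X. \<psi>' x = Some (j, k)})"
      unfolding \<psi>'(2) fiber_count_def using X by (subst card_UN_disjoint) auto
    also have "(\<Union>k<Q j. {x \<in> X. \<psi>' x = Some (j, k)}) = {x \<in> X. \<exists>k. \<psi>' x = Some (j, k)}"
      using \<psi>'(1) by (fastforce simp: pfun_def blow_up_def)
    finally show ?thesis .
  qed
  have pf: "pfun Y X (\<lambda>y x. R x y) \<psi>"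
    using \<psi>'(1) unfolding pfun_def \<psi>_def by (fastforce simp: blow_up_def blow_up_rel_def split: option.splits)
  have pr: "proj Y Q h' = fiber_count X \<psi>"
  proof
    fix y
    show "proj Y Q h' y = fiber_count X \<psi> y"
    proof (cases "y \<in> Y")
      case True
      have "{x \<in> X. \<exists>k. \<psi>' x = Some (Some y, k)} = {x \<in> X. \<psi> x = Some y}"
        unfolding \<psi>_def by (force split: option.splits)
      then show ?thesis using True eq[of "Some y"] by (simp add: proj_def fiber_count_def)
    next
      case False
      then show ?thesis using fiber_count_outside[OF pf] by (simp add: proj_def)
    qed
  qed
  have "(\<Sum>k<Q None. h' (None, k)) \<le> card {x \<in> X. \<psi> x = None}"
    unfolding eq[of None, simplified] using X by (intro card_mono) (auto simp: \<psi>_def)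
  also have "\<dots> = card X - sum (proj Y Q h') Y"
    using sum_fiber_count_eq[OF X Y pf] pr by simp
  finally show ?r using pr pf \<psi>' fiber_count_outside[OF \<psi>'(1)] by (auto simp: fiber_vectors_def)
next
  assume r: ?r
  then obtain \<psi> where \<psi>: "pfun Y X (\<lambda>y x. R x y) \<psi>" "proj Y Q h' = fiber_count X \<psi>" by (auto simp: fiber_vectors_def)
  have ex: "\<exists>g. (\<forall>a\<in>{x \<in> X. \<psi> x = j}. \<forall>k. g a = Some k \<longrightarrow> k \<in> {..<Q j}) \<and>
      (\<forall>k\<in>{..<Q j}. card {a \<in> {x \<in> X. \<psi> x = j}. g a = Some k} = h' (j, k))"
    if "j \<in> insert None (Some ` Y)" for j
  proof (rule card_split_exists)
    show "(\<Sum>k<Q j. h' (j, k)) \<le> card {x \<in> X. \<psi> x = j}"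
    proof (cases j)
      case None
      have "card {x \<in> X. \<psi> x = None} = card X - sum (proj Y Q h') Y"
        unfolding \<psi>(2) using sum_fiber_count_eq[OF X Y \<psi>(1)] by linarith
      then show ?thesis using r None by simp
    next
      case (Some y)
      then have "proj Y Q h' y = (\<Sum>k<Q j. h' (j, k))" using that by (auto simp: proj_def)
      then show ?thesis using \<psi>(2) Some by (simp add: fiber_count_def)
    qed
  qed (use X in auto)
  have "\<exists>g. \<forall>j\<in>insert None (Some ` Y).
      (\<forall>a\<in>{x \<in> X. \<psi> x = j}. \<forall>k. g j a = Some k \<longrightarrow> k \<in> {..<Q j}) \<and>
      (\<forall>k\<in>{..<Q j}. card {a \<in> {x \<in> X. \<psi> x = j}. g j a = Some k} = h' (j, k))"
    by (rule bchoice) (use ex in blast)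
  then obtain g where g0: "\<forall>j\<in>insert None (Some ` Y).
      (\<forall>a\<in>{x \<in> X. \<psi> x = j}. \<forall>k. g j a = Some k \<longrightarrow> k \<in> {..<Q j}) \<and>
      (\<forall>k\<in>{..<Q j}. card {a \<in> {x \<in> X. \<psi> x = j}. g j a = Some k} = h' (j, k))" by blast
  have g: "\<And>j x k. j \<in> insert None (Some ` Y) \<Longrightarrow> x \<in> X \<Longrightarrow> \<psi> x = j \<Longrightarrow> g j x = Some k \<Longrightarrow> k < Q j"
    "\<And>j k. j \<in> insert None (Some ` Y) \<Longrightarrow> k < Q j \<Longrightarrow> card {x \<in> X. \<psi> x = j \<and> g j x = Some k} = h' (j, k)"
    using g0[rule_format] by auto
  define \<psi>' where "\<psi>' = (\<lambda>x. case g (\<psi> x) x of None \<Rightarrow> None | Some k \<Rightarrow> Some (\<psi> x, k))"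
  have \<psi>Y: "\<psi> x \<in> insert None (Some ` Y)" if "x \<in> X" for x
    using \<psi>(1) that by (cases "\<psi> x") (auto simp: pfun_def)
  have pf: "pfun (blow_up Y Q) X (\<lambda>j x. blow_up_rel R x j) \<psi>'"
    using \<psi>(1) g(1) \<psi>Y unfolding pfun_def \<psi>'_def
    by (auto simp: blow_up_def blow_up_rel_def split: option.splits)
  have "fiber_count X \<psi>' = h'"
  proof
    fix j
    show "fiber_count X \<psi>' j = h' j"
    proof (cases "j \<in> blow_up Y Q")
      case True
      have "{x \<in> X. \<psi>' x = Some j} = {x \<in> X. \<psi> x = fst j \<and> g (fst j) x = Some (snd j)}"
        by (cases j) (auto simp: \<psi>'_def split: option.splits)
      then show ?thesis using g(2)[of "fst j" "snd j"] True by (auto simp: fiber_count_def blow_up_def)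
    next
      case False
      then show ?thesis using r[THEN conjunct1, rule_format, OF False] fiber_count_outside[OF pf False] by simp
    qed
  qed
  then show ?l using pf by (auto simp: fiber_vectors_def)
qed

lemma sum_prod_blocks:
  fixes g :: "nat \<Rightarrow> real" and Q :: "'j \<Rightarrow> nat"
  assumes J: "finite J" and C: "\<And>j. j \<in> J \<Longrightarrow> finite (C j)"
    and supp: "\<And>j c k. j \<in> J \<Longrightarrow> c \<in> C j \<Longrightarrow> k \<ge> Q j \<Longrightarrow> c k = 0"
  shows "(\<Sum>h | (\<forall>i. i \<notin> (SIGMA j : J. {..<Q j}) \<longrightarrow> h i = 0) \<and> (\<forall>j\<in>J. (\<lambda>k. h (j, k)) \<in> C j).
      \<Prod>i\<in>(SIGMA j : J. {..<Q j}). g (h i)) = (\<Prod>j\<in>J. \<Sum>c\<in>C j. \<Prod>k<Q j. g (c k))"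
proof -
  let ?H = "{h. (\<forall>i. i \<notin> (SIGMA j : J. {..<Q j}) \<longrightarrow> h i = 0) \<and> (\<forall>j\<in>J. (\<lambda>k. h (j, k)) \<in> C j)}"
  have bij: "bij_betw (\<lambda>h. \<lambda>j\<in>J. \<lambda>k. h (j, k)) ?H (PiE J C)"
  proof (rule bij_betw_byWitness[where f' = "\<lambda>c (j, k). if j \<in> J \<and> k < Q j then c j k else 0"])
    show "\<forall>h\<in>?H. (\<lambda>(j, k). if j \<in> J \<and> k < Q j then (\<lambda>j\<in>J. \<lambda>k. h (j, k)) j k else 0) = h"
      by (auto simp: fun_eq_iff)
    have eq: "(\<lambda>k. if j \<in> J \<and> k < Q j then c j k else 0) = c j" if "c \<in> PiE J C" "j \<in> J" for c j
      using supp[OF that(2), of "c j"] that by (auto simp: fun_eq_iff PiE_def Pi_def)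
    then show "\<forall>c\<in>PiE J C. (\<lambda>j\<in>J. \<lambda>k. (\<lambda>(j, k). if j \<in> J \<and> k < Q j then c j k else 0) (j, k)) = c"
      by (auto simp: fun_eq_iff restrict_def PiE_def extensional_def)
    show "(\<lambda>h. \<lambda>j\<in>J. \<lambda>k. h (j, k)) ` ?H \<subseteq> PiE J C" by auto
    show "(\<lambda>c (j, k). if j \<in> J \<and> k < Q j then c j k else 0) ` PiE J C \<subseteq> ?H"
      using eq by (auto simp: PiE_def Pi_def)
  qed
  have "(\<Prod>j\<in>J. \<Sum>c\<in>C j. \<Prod>k<Q j. g (c k)) = (\<Sum>c\<in>PiE J C. \<Prod>j\<in>J. \<Prod>k<Q j. g (c j k))"
    by (rule prod_sum_PiE[OF J C])
  also have "\<dots> = (\<Sum>h\<in>?H. \<Prod>j\<in>J. \<Prod>k<Q j. g (h (j, k)))"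
    by (subst sum.reindex_bij_betw[OF bij, symmetric]) simp
  also have "\<dots> = (\<Sum>h\<in>?H. \<Prod>i\<in>(SIGMA j : J. {..<Q j}). g (h i))"
    using J by (simp add: prod.Sigma split_beta)
  finally show ?thesis by simp
qed

lemma sum_compositions_supp_wt: "(\<Sum>c\<in>compositions {..<k} n. \<Prod>i<k. supp_wt t (c i)) = fps_nth (supp_fps t ^ k) n"
  using fps_prod_nth_compositions[of "{..<k}" "\<lambda>_. supp_fps t" n] by simp

text \<open>The gain of the dual side: \<open>h\<close> ranges over a set that does not depend on
  \<open>Q\<close>, and \<open>Q\<close> enters only through exponents, one for each element. This
  makes a later summation over \<open>Q\<close> possible.\<close>

lemma fiber_sum_blow_up:
  assumes X: "finite X" and Y: "finite Y"
  shows "fiber_sum t (blow_up Y Q) X (\<lambda>j x. blow_up_rel R x j) =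
    (\<Sum>h\<in>fiber_vectors Y X (\<lambda>y x. R x y). (\<Prod>y\<in>Y. fps_nth (supp_fps t ^ Q (Some y)) (h y)) *
      (\<Sum>i\<le>card X - sum h Y. fps_nth (supp_fps t ^ Q None) i))"
proof -
  let ?J = "insert None (Some ` Y)"
  let ?F = "fiber_vectors (blow_up Y Q) X (\<lambda>j x. blow_up_rel R x j)"
  define C where "C = (\<lambda>h j. case j of None \<Rightarrow> \<Union>i\<le>card X - sum h Y. compositions {..<Q None} i | Some y \<Rightarrow> compositions {..<Q (Some y)} (h y))"
  have finC: "finite (C h j)" for h j by (auto simp: C_def finite_compositions split: option.splits)
  have "fiber_sum t (blow_up Y Q) X (\<lambda>j x. blow_up_rel R x j) =
    (\<Sum>h\<in>fiber_vectors Y X (\<lambda>y x. R x y). \<Sum>h'\<in>{h' \<in> ?F. proj Y Q h' = h}. \<Prod>i\<in>blow_up Y Q. supp_wt t (h' i))"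
    unfolding fiber_sum_def
    by (rule sum.group[symmetric]) (use X Y fiber_vectors_blow_up[OF X Y] in \<open>auto simp: finite_fiber_vectors finite_blow_up\<close>)
  also have "\<dots> = (\<Sum>h\<in>fiber_vectors Y X (\<lambda>y x. R x y). \<Prod>j\<in>?J. \<Sum>c\<in>C h j. \<Prod>k<Q j. supp_wt t (c k))"
  proof (rule sum.cong[OF refl])
    fix h assume h: "h \<in> fiber_vectors Y X (\<lambda>y x. R x y)"
    have "{h' \<in> ?F. proj Y Q h' = h} = {h'. (\<forall>i. i \<notin> (SIGMA j : ?J. {..<Q j}) \<longrightarrow> h' i = 0) \<and> (\<forall>j\<in>?J. (\<lambda>k. h' (j, k)) \<in> C h j)}"
      (is "?A = ?B")
    proof (intro equalityI subsetI)
      fix h' assume "h' \<in> ?A"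
      then have 1: "\<forall>j. j \<notin> blow_up Y Q \<longrightarrow> h' j = 0" "proj Y Q h' = h"
        "(\<Sum>k<Q None. h' (None, k)) \<le> card X - sum h Y" using fiber_vectors_blow_up[OF X Y, of h' Q R] by auto
      have "(\<Sum>k<Q (Some y). h' (Some y, k)) = h y" if "y \<in> Y" for y
        using 1(2) that by (auto simp: proj_def)
      then show "h' \<in> ?B" using 1 by (auto simp: blow_up_def C_def compositions_def)
    next
      fix h' assume h': "h' \<in> ?B"
      then have 1: "(\<lambda>k. h' (j, k)) \<in> C h j" if "j \<in> ?J" for j using that by blast
      have "proj Y Q h' y = h y" for y
        using 1[of "Some y"] fiber_vectors_outside[OF h, of y] by (auto simp: proj_def C_def compositions_def)
      then have "proj Y Q h' = h" by auto
      moreover have "(\<Sum>k<Q None. h' (None, k)) \<le> card X - sum h Y"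
        using 1[of None] by (auto simp: C_def compositions_def)
      ultimately show "h' \<in> ?A" using h h' fiber_vectors_blow_up[OF X Y, of h' Q R] by (auto simp: blow_up_def)
    qed
    then show "(\<Sum>h'\<in>{h' \<in> ?F. proj Y Q h' = h}. \<Prod>i\<in>blow_up Y Q. supp_wt t (h' i)) = (\<Prod>j\<in>?J. \<Sum>c\<in>C h j. \<Prod>k<Q j. supp_wt t (c k))"
      unfolding blow_up_def
      by (simp only:, intro sum_prod_blocks)
        (use Y finC in \<open>auto simp: C_def compositions_def split: option.splits\<close>)
  qed
  also have "\<dots> = (\<Sum>h\<in>fiber_vectors Y X (\<lambda>y x. R x y). (\<Prod>y\<in>Y. fps_nth (supp_fps t ^ Q (Some y)) (h y)) *
      (\<Sum>i\<le>card X - sum h Y. fps_nth (supp_fps t ^ Q None) i))"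
  proof (rule sum.cong[OF refl])
    fix h
    have "(\<Sum>c\<in>C h None. \<Prod>k<Q None. supp_wt t (c k)) = (\<Sum>i\<le>card X - sum h Y. fps_nth (supp_fps t ^ Q None) i)"
      unfolding C_def sum_compositions_supp_wt[symmetric] option.case
      by (rule sum.UNION_disjoint) (simp_all add: finite_compositions, auto simp: compositions_def)
    moreover have "(\<Sum>c\<in>C h (Some y). \<Prod>k<Q (Some y). supp_wt t (c k)) = fps_nth (supp_fps t ^ Q (Some y)) (h y)" for y
      by (simp add: C_def sum_compositions_supp_wt)
    ultimately show "(\<Prod>j\<in>?J. \<Sum>c\<in>C h j. \<Prod>k<Q j. supp_wt t (c k)) = (\<Prod>y\<in>Y. fps_nth (supp_fps t ^ Q (Some y)) (h y)) *
      (\<Sum>i\<le>card X - sum h Y. fps_nth (supp_fps t ^ Q None) i)"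
      using Y by (simp add: prod.reindex mult.commute)
  qed
  finally show ?thesis .
qed


section \<open>The transport series and its symmetry\<close>

text \<open>At \<open>t = 1\<close> the coefficients count the lattice points in the dilates of the
  anti-blocking polytope of a bipartite graph, at \<open>t = 2\<close> those of its
  symmetrization.\<close>

definition transport_series :: "real \<Rightarrow> 'a set \<Rightarrow> 'b set \<Rightarrow> ('a \<Rightarrow> 'b \<Rightarrow> bool) \<Rightarrow> real fps" where
  "transport_series t X Y R = Abs_fps (\<lambda>m.
     \<Sum>(p, q)\<in>{(p, q). (\<forall>x. x \<notin> X \<longrightarrow> p x = 0) \<and> (\<forall>y. y \<notin> Y \<longrightarrow> q y = 0) \<and> transportable X Y R m p q}.
       (\<Prod>x\<in>X. supp_wt t (p x)) * (\<Prod>y\<in>Y. supp_wt t (q y)))"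

definition supp_card :: "'b set \<Rightarrow> ('b \<Rightarrow> nat) \<Rightarrow> nat" where
  "supp_card Y h = card {y \<in> Y. h y \<noteq> 0}"

lemma supp_card_le_sum: "finite Y \<Longrightarrow> supp_card Y h \<le> sum h Y"
proof -
  assume "finite Y"
  then have "supp_card Y h = (\<Sum>y\<in>Y. if h y \<noteq> 0 then 1 else 0)" by (simp add: supp_card_def sum.If_cases Int_def)
  also have "\<dots> \<le> sum h Y" by (intro sum_mono) auto
  finally show ?thesis .
qed

lemma supp_card_le_card: "finite Y \<Longrightarrow> supp_card Y h \<le> card Y"
  unfolding supp_card_def by (intro card_mono) auto

text \<open>The weights \<open>q\<close> are completed to a composition of \<open>m\<close> by the
  number of free units, stored at \<open>None\<close>.\<close>

lemma transport_series_nth: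
  assumes X: "finite X" and Y: "finite Y"
  shows "fps_nth (transport_series t X Y R) m = (\<Sum>Q\<in>compositions (insert None (Some ` Y)) m.
    (\<Prod>y\<in>Y. supp_wt t (Q (Some y))) * fiber_sum t X (blow_up Y Q) (blow_up_rel R))"
proof -
  let ?J = "insert None (Some ` Y)"
  let ?S = "{(p, q). (\<forall>x. x \<notin> X \<longrightarrow> p x = 0) \<and> (\<forall>y. y \<notin> Y \<longrightarrow> q y = 0) \<and> transportable X Y R m p q}"
  let ?T = "SIGMA Q : compositions ?J m. fiber_vectors X (blow_up Y Q) (blow_up_rel R)"
  have sumJ: "sum Q ?J = Q None + (\<Sum>y\<in>Y. Q (Some y))" for Q :: "'b option \<Rightarrow> nat"
    using Y by (simp add: sum.reindex)
  have bij: "bij_betw (\<lambda>(Q, p). (p, \<lambda>y. Q (Some y))) ?T ?S"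
  proof (rule bij_betw_byWitness[where f' = "\<lambda>(p, q). (case_option (m - sum q Y) q, p)"])
    have eq: "case_option (m - (\<Sum>y\<in>Y. Q (Some y))) (\<lambda>y. Q (Some y)) = Q" if "Q \<in> compositions ?J m" for Q
      using that by (auto simp: compositions_def fun_eq_iff sumJ simp del: sum.insert split: option.splits)
    then show "\<forall>a\<in>?T. (\<lambda>(p, q). (case_option (m - sum q Y) q, p)) ((\<lambda>(Q, p). (p, \<lambda>y. Q (Some y))) a) = a"
      by auto
    show "\<forall>a\<in>?S. (\<lambda>(Q, p). (p, \<lambda>y. Q (Some y))) ((\<lambda>(p, q). (case_option (m - sum q Y) q, p)) a) = a"
      by auto
    show "(\<lambda>(Q, p). (p, \<lambda>y. Q (Some y))) ` ?T \<subseteq> ?S"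
    proof clarify
      fix Q p assume Q: "Q \<in> compositions ?J m" and p: "p \<in> fiber_vectors X (blow_up Y Q) (blow_up_rel R)"
      have "sum (\<lambda>y. Q (Some y)) Y \<le> m" using Q by (auto simp: compositions_def sumJ simp del: sum.insert)
      moreover have "\<forall>y. y \<notin> Y \<longrightarrow> Q (Some y) = 0" using Q by (auto simp: compositions_def)
      ultimately show "(\<forall>x. x \<notin> X \<longrightarrow> p x = 0) \<and> (\<forall>y. y \<notin> Y \<longrightarrow> Q (Some y) = 0) \<and> transportable X Y R m p (\<lambda>y. Q (Some y))"
        using p transportable_iff[OF X Y, of p R m "\<lambda>y. Q (Some y)"] eq[OF Q] fiber_vectors_outside[OF p] by auto
    qed
    show "(\<lambda>(p, q). (case_option (m - sum q Y) q, p)) ` ?S \<subseteq> ?T"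
    proof clarify
      fix p q assume p: "\<forall>x. x \<notin> X \<longrightarrow> p x = 0" and q: "\<forall>y. y \<notin> Y \<longrightarrow> q y = 0" and f: "transportable X Y R m p q"
      have *: "sum q Y \<le> m" "p \<in> fiber_vectors X (blow_up Y (case_option (m - sum q Y) q)) (blow_up_rel R)"
        using transportable_iff[OF X Y, of p R m q] p f by auto
      have "case_option (m - sum q Y) q \<in> compositions ?J m"
        using *(1) q by (auto simp: compositions_def sumJ simp del: sum.insert split: option.splits)
      then show "case_option (m - sum q Y) q \<in> compositions ?J m \<and>
          p \<in> fiber_vectors X (blow_up Y (case_option (m - sum q Y) q)) (blow_up_rel R)" using * by blast
    qed
  qed
  have "fps_nth (transport_series t X Y R) m = (\<Sum>(Q, p)\<in>?T. (\<Prod>x\<in>X. supp_wt t (p x)) * (\<Prod>y\<in>Y. supp_wt t (Q (Some y))))"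
    unfolding transport_series_def fps_nth_Abs_fps
    by (subst sum.reindex_bij_betw[OF bij, symmetric]) (simp add: split_beta)
  also have "\<dots> = (\<Sum>Q\<in>compositions ?J m. \<Sum>p\<in>fiber_vectors X (blow_up Y Q) (blow_up_rel R). (\<Prod>x\<in>X. supp_wt t (p x)) * (\<Prod>y\<in>Y. supp_wt t (Q (Some y))))"
    by (rule sum.Sigma[symmetric]) (use X Y in \<open>auto simp: finite_compositions finite_fiber_vectors finite_blow_up\<close>)
  also have "\<dots> = (\<Sum>Q\<in>compositions ?J m. (\<Prod>y\<in>Y. supp_wt t (Q (Some y))) * fiber_sum t X (blow_up Y Q) (blow_up_rel R))"
    by (simp add: fiber_sum_def sum_distrib_left mult.commute)
  finally show ?thesis .
qed

text \<open>After the exchange of sides, for fixed \<open>h\<close> the sum over \<open>Q\<close> is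
  a Cauchy product of one-variable series: \<open>gf_partial\<close> for \<open>None\<close> and
  \<open>gf_part\<close> for each \<open>y\<close>. Their denominators have exponents
  \<open>card X - sum h Y + 1\<close> and \<open>h y + 1\<close>, which add up to
  \<open>card X + card Y + 1\<close>.\<close>

lemma transport_series_if_dual:
  assumes X: "finite X" and Y: "finite Y"
    and dual: "\<And>Q. fiber_sum t X (blow_up Y Q) (blow_up_rel R) = fiber_sum t (blow_up Y Q) X (\<lambda>j x. blow_up_rel R x j)"
  shows "transport_series t X Y R * (1 - fps_X) ^ Suc (card X + card Y) =
    (\<Sum>h\<in>fiber_vectors Y X (\<lambda>y x. R x y). (fps_const (t\<^sup>2) * fps_X) ^ supp_card Y h *
      (1 + fps_const (t - 1) * fps_X) ^ (card X + card Y - 2 * supp_card Y h))"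
proof -
  let ?J = "insert None (Some ` Y)"
  let ?FV = "fiber_vectors Y X (\<lambda>y x. R x y)"
  let ?\<rho> = "1 + fps_const (t - 1) * fps_X :: real fps"
  define \<Gamma> where "\<Gamma> = (\<lambda>h j. case j of None \<Rightarrow> Abs_fps (\<lambda>k. \<Sum>i\<le>card X - sum h Y. fps_nth (supp_fps t ^ k) i)
      | Some y \<Rightarrow> supp_gen t (h y))"
  have series: "transport_series t X Y R = (\<Sum>h\<in>?FV. \<Prod>j\<in>?J. \<Gamma> h j)"
  proof (rule fps_ext)
    fix m
    have "fps_nth (transport_series t X Y R) m = (\<Sum>Q\<in>compositions ?J m. \<Sum>h\<in>?FV. \<Prod>j\<in>?J. fps_nth (\<Gamma> h j) (Q j))"
      unfolding transport_series_nth[OF X Y] dual fiber_sum_blow_up[OF X Y]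
      using Y by (intro sum.cong refl, subst sum_distrib_left, intro sum.cong refl) (simp add: prod.reindex \<Gamma>_def supp_gen_def prod.distrib mult_ac)
    also have "\<dots> = (\<Sum>h\<in>?FV. \<Sum>Q\<in>compositions ?J m. \<Prod>j\<in>?J. fps_nth (\<Gamma> h j) (Q j))" by (rule sum.swap)
    also have "\<dots> = fps_nth (\<Sum>h\<in>?FV. \<Prod>j\<in>?J. \<Gamma> h j) m"
      unfolding fps_sum_nth using Y by (subst fps_prod_nth_compositions) auto
    finally show "fps_nth (transport_series t X Y R) m = fps_nth (\<Sum>h\<in>?FV. \<Prod>j\<in>?J. \<Gamma> h j) m" .
  qed
  have "(\<Prod>j\<in>?J. \<Gamma> h j) * (1 - fps_X) ^ Suc (card X + card Y) =
    (fps_const (t\<^sup>2) * fps_X) ^ supp_card Y h * ?\<rho> ^ (card X + card Y - 2 * supp_card Y h)" if h: "h \<in> ?FV" for h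
  proof -
    have hX: "sum h Y \<le> card X" by (rule sum_fiber_count_le[OF X Y h])
    define n where "n = card X - sum h Y"
    \<comment> \<open>The exponent of \<open>1 + (t - 1) x\<close> in \<open>gf_part\<close>; its
      sum loses 2 for each \<open>y\<close> in the support.\<close>
    define e where "e = (\<lambda>y. if h y = 0 then 1 else h y - 1)"
    have "Suc (card X + card Y) = Suc n + (\<Sum>y\<in>Y. Suc (h y))"
      using hX by (simp add: n_def sum.distrib sum_Suc)
    then have "(\<Prod>j\<in>?J. \<Gamma> h j) * (1 - fps_X) ^ Suc (card X + card Y)
       = (\<Gamma> h None * (1 - fps_X) ^ Suc n) * (\<Prod>y\<in>Y. \<Gamma> h (Some y) * (1 - fps_X) ^ Suc (h y))"
      using Y by (simp only: power_add power_sum prod.distrib) (simp add: prod.reindex mult_ac)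
    also have "\<Gamma> h None * (1 - fps_X) ^ Suc n = ?\<rho> ^ n"
      unfolding \<Gamma>_def option.case n_def by (rule gf_partial)
    also have "(\<Prod>y\<in>Y. \<Gamma> h (Some y) * (1 - fps_X) ^ Suc (h y)) =
        (\<Prod>y\<in>Y. (if h y \<noteq> 0 then fps_const (t\<^sup>2) * fps_X else 1) * ?\<rho> ^ e y)"
      unfolding \<Gamma>_def option.case gf_part by (intro prod.cong) (auto simp: e_def)
    also have "\<dots> = (fps_const (t\<^sup>2) * fps_X) ^ supp_card Y h * ?\<rho> ^ sum e Y"
      using Y by (simp add: prod.distrib power_sum[symmetric] prod.If_cases supp_card_def Int_def)
    finally have "(\<Prod>j\<in>?J. \<Gamma> h j) * (1 - fps_X) ^ Suc (card X + card Y) =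
      (fps_const (t\<^sup>2) * fps_X) ^ supp_card Y h * ?\<rho> ^ (n + sum e Y)" by (simp add: power_add mult_ac)
    moreover have "sum e Y + 2 * supp_card Y h = sum h Y + card Y"
    proof -
      have "supp_card Y h = (\<Sum>y\<in>Y. if h y \<noteq> 0 then 1 else 0)" using Y by (simp add: supp_card_def sum.If_cases Int_def)
      then have "sum e Y + 2 * supp_card Y h = (\<Sum>y\<in>Y. e y + 2 * (if h y \<noteq> 0 then 1 else 0))"
        by (simp add: sum.distrib sum_distrib_left)
      also have "\<dots> = (\<Sum>y\<in>Y. h y + 1)" by (intro sum.cong) (auto simp: e_def)
      finally show ?thesis by (simp add: sum_Suc)
    qed
    then have "n + sum e Y = card X + card Y - 2 * supp_card Y h" using hX by (simp add: n_def)
    ultimately show ?thesis by simp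
  qed
  then show ?thesis unfolding series sum_distrib_right by (intro sum.cong) auto
qed

lemma transport_series_swap: "transport_series t X Y R = transport_series t Y X (\<lambda>y x. R x y)"
proof (rule fps_ext)
  fix m
  let ?S = "{(p, q). (\<forall>x. x \<notin> X \<longrightarrow> p x = 0) \<and> (\<forall>y. y \<notin> Y \<longrightarrow> q y = 0) \<and> transportable X Y R m p q}"
  let ?T = "{(p, q). (\<forall>x. x \<notin> Y \<longrightarrow> p x = 0) \<and> (\<forall>y. y \<notin> X \<longrightarrow> q y = 0) \<and> transportable Y X (\<lambda>y x. R x y) m p q}"
  have "bij_betw prod.swap ?S ?T"
    by (rule bij_betw_byWitness[where f' = prod.swap]) (auto simp: transportable_swap[of X Y R])
  then show "fps_nth (transport_series t X Y R) m = fps_nth (transport_series t Y X (\<lambda>y x. R x y)) m"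
    unfolding transport_series_def fps_nth_Abs_fps
    by (subst sum.reindex_bij_betw[symmetric, of prod.swap ?S ?T]) (auto simp: mult.commute intro!: sum.cong)
qed

lemma fiber_sum_1: "fiber_sum 1 X Y R = real (card (fiber_vectors X Y R))"
proof -
  have "supp_wt 1 n = 1" for n by (simp add: supp_wt_def)
  then show ?thesis by (simp add: fiber_sum_def)
qed

lemma transport_series_1:
  assumes X: "finite X" and Y: "finite Y"
  shows "transport_series 1 X Y R * (1 - fps_X) ^ Suc (card X + card Y) =
     (\<Sum>h\<in>fiber_vectors Y X (\<lambda>y x. R x y). fps_X ^ supp_card Y h)"
  using transport_series_if_dual[OF X Y, of 1 R] card_fiber_vectors_swap[OF X finite_blow_up[OF Y], where R = "blow_up_rel R"]
  by (simp add: fiber_sum_1)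

text \<open>The case \<open>t = 1\<close> only needs the equality of cardinalities; since the series is symmetric in
  \<open>X\<close> and \<open>Y\<close>, it upgrades that equality to one of generating functions by size of the support.\<close>

lemma sum_supp_card_swap:
  assumes X: "finite X" and Y: "finite Y"
  shows "(\<Sum>p\<in>fiber_vectors X Y R. monom (1 :: real) (supp_card X p)) =
    (\<Sum>q\<in>fiber_vectors Y X (\<lambda>y x. R x y). monom 1 (supp_card Y q))"
proof -
  from transport_series_1[OF X Y, of R] transport_series_1[OF Y X, of "\<lambda>y x. R x y"]
  have "(\<Sum>h\<in>fiber_vectors Y X (\<lambda>y x. R x y). fps_X ^ supp_card Y h) =
    (\<Sum>h\<in>fiber_vectors X Y R. fps_X ^ supp_card X h :: real fps)"
    by (simp add: transport_series_swap[of 1 X Y R] add.commute)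
  then have "fps_of_poly (\<Sum>p\<in>fiber_vectors X Y R. monom (1 :: real) (supp_card X p)) =
    fps_of_poly (\<Sum>q\<in>fiber_vectors Y X (\<lambda>y x. R x y). monom 1 (supp_card Y q))"
    by (simp add: fps_of_poly_sum fps_of_poly_monom)
  then show ?thesis by simp
qed

lemma fiber_sum_eq_poly:
  assumes "finite X"
  shows "fiber_sum t X Y R = poly (\<Sum>p\<in>fiber_vectors X Y R. monom 1 (supp_card X p)) t"
  unfolding fiber_sum_def poly_sum supp_wt_def using assms
  by (intro sum.cong) (auto simp: poly_monom supp_card_def prod.If_cases Int_def)

text \<open>The duality of generating polynomials, applied to the blow-up and evaluated at
  \<open>t\<close>, supplies the hypothesis of the conditional formula.\<close>

theorem transport_series_eq:
  assumes X: "finite X" and Y: "finite Y"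
  shows "transport_series t X Y R * (1 - fps_X) ^ Suc (card X + card Y) =
    (\<Sum>h\<in>fiber_vectors Y X (\<lambda>y x. R x y). (fps_const (t\<^sup>2) * fps_X) ^ supp_card Y h *
      (1 + fps_const (t - 1) * fps_X) ^ (card X + card Y - 2 * supp_card Y h))"
proof (rule transport_series_if_dual[OF X Y])
  show "fiber_sum t X (blow_up Y Q) (blow_up_rel R) = fiber_sum t (blow_up Y Q) X (\<lambda>j x. blow_up_rel R x j)" for Q
    using sum_supp_card_swap[OF X finite_blow_up[OF Y], where R = "blow_up_rel R"] X finite_blow_up[OF Y]
    by (simp add: fiber_sum_eq_poly)
qed

section \<open>Hypertrees and activity\<close>

lemma rtrancl_distinct_path:
  assumes "(a, b) \<in> r\<^sup>*"
  shows "\<exists>xs. xs \<noteq> [] \<and> hd xs = a \<and> last xs = b \<and> distinct xs \<and>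
    (\<forall>i. Suc i < length xs \<longrightarrow> (xs ! i, xs ! Suc i) \<in> r)"
  using assms
proof (induction rule: rtrancl_induct)
  case base
  show ?case by (intro exI[of _ "[a]"]) auto
next
  case (step b c)
  then obtain xs where xs: "xs \<noteq> []" "hd xs = a" "last xs = b" "distinct xs"
    "\<forall>i. Suc i < length xs \<longrightarrow> (xs ! i, xs ! Suc i) \<in> r" by blast
  show ?case
  proof (cases "c \<in> set xs")
    case True
    then obtain k where k: "k < length xs" "xs ! k = c" by (auto simp: in_set_conv_nth)
    let ?ys = "take (Suc k) xs"
    have "last ?ys = c" using k xs(1) by (simp add: last_conv_nth)
    then show ?thesis using xs k by (intro exI[of _ ?ys]) (auto simp: hd_take)
  next
    case False
    have "((xs @ [c]) ! i, (xs @ [c]) ! Suc i) \<in> r" if "Suc i < length (xs @ [c])" for i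
    proof (cases "Suc i < length xs")
      case True then show ?thesis using xs(5) by (simp add: nth_append)
    next
      case False
      then have "i = length xs - 1" "Suc i = length xs" using that by auto
      then show ?thesis using xs(1,3) step(2) by (simp add: nth_append last_conv_nth)
    qed
    then show ?thesis using xs False by (intro exI[of _ "xs @ [c]"]) auto
  qed
qed

lemma connected_add_edge_cycle:
  assumes ab: "(a, b) \<in> {(a, b). {a, b} \<in> T'}\<^sup>*" "a \<noteq> b" and T: "T' \<subseteq> T" "{a, b} \<in> T" "{a, b} \<notin> T'"
  shows "\<exists>vs. is_cycle T vs"
proof -
  obtain xs where xs: "xs \<noteq> []" "hd xs = a" "last xs = b" "distinct xs"
    "\<forall>i. Suc i < length xs \<longrightarrow> (xs ! i, xs ! Suc i) \<in> {(a, b). {a, b} \<in> T'}"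
    using rtrancl_distinct_path[OF ab(1)] by blast
  have h: "xs ! 0 = a" "xs ! (length xs - 1) = b" using xs by (auto simp: hd_conv_nth last_conv_nth)
  have "length xs \<noteq> 1" using h ab(2) by auto
  moreover have "length xs \<noteq> 2"
  proof
    assume "length xs = 2"
    then have "{a, b} \<in> T'" using xs(5)[rule_format, of 0] h by auto
    then show False using T by blast
  qed
  ultimately have "3 \<le> length xs" using xs(1) by (cases xs; cases "tl xs"; cases "tl (tl xs)") auto
  moreover have "{xs ! i, xs ! (Suc i mod length xs)} \<in> T" if "i < length xs" for i
  proof (cases "Suc i = length xs")
    case True
    then have "i = length xs - 1" by simp
    then show ?thesis using h T(2) True by (simp add: insert_commute)
  next
    case False
    then show ?thesis using that xs(5) T(1) by auto
  qed
  ultimately show ?thesis using xs(4) by (auto simp: is_cycle_def)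
qed

text \<open>The parent is a neighbour one step closer to the root in graph distance.\<close>

lemma connected_parent:
  assumes conn: "graph_connected VV T" and rt: "rt \<in> VV" and TV: "\<And>a b. {a, b} \<in> T \<Longrightarrow> a \<in> VV"
  shows "\<exists>par d. (\<forall>x\<in>VV - {rt}. {x, par x} \<in> T \<and> par x \<in> VV \<and> (d (par x) :: nat) < d x)"
proof -
  let ?r = "{(a, b). {a, b} \<in> T}"
  define d where "d = (\<lambda>x. LEAST k. (x, rt) \<in> ?r ^^ k)"
  have "\<exists>y. {x, y} \<in> T \<and> y \<in> VV \<and> d y < d x" if x: "x \<in> VV - {rt}" for x
  proof -
    have "(x, rt) \<in> ?r\<^sup>*" using conn rt x by (auto simp: graph_connected_def)
    then have "\<exists>k. (x, rt) \<in> ?r ^^ k" by (simp add: rtrancl_power)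
    then have k: "(x, rt) \<in> ?r ^^ d x" unfolding d_def by (rule LeastI_ex)
    have "d x \<noteq> 0" using k x by (cases "d x") auto
    then obtain m where m: "d x = Suc m" by (cases "d x") auto
    then obtain y where y: "(x, y) \<in> ?r" "(y, rt) \<in> ?r ^^ m" using k relpow_Suc_D2 by metis
    have "d y \<le> m" unfolding d_def using y(2) by (rule Least_le)
    then show ?thesis using y m TV[of y x] by (auto simp: insert_commute intro!: exI[of _ y])
  qed
  then have "\<exists>par. \<forall>x\<in>VV - {rt}. {x, par x} \<in> T \<and> par x \<in> VV \<and> d (par x) < d x"
    by (intro bchoice) auto
  then show ?thesis by blast
qed

text \<open>A hyperedge lies on the edges to its children and on one parent edge; \<open>ne\<close>
  says that the parent edge is not among the former.\<close>

lemma degree_bipartite_tree: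
  fixes W :: "'v set" and \<phi> :: "'v \<Rightarrow> nat" and \<pi> :: "nat \<Rightarrow> 'v"
  assumes W: "finite W" and j: "j < n" and ne: "\<And>v. v \<in> W \<Longrightarrow> \<pi> (\<phi> v) \<noteq> v"
  shows "vertex_degree ({{Inl v, Inr (\<phi> v)} | v. v \<in> W} \<union> {{Inl (\<pi> j), Inr j} | j. j < n}) (Inr j)
    = card {v \<in> W. \<phi> v = j} + 1"
proof -
  let ?T = "{{Inl v, Inr (\<phi> v)} | v. v \<in> W} \<union> {{Inl (\<pi> j), Inr j} | j. j < n}"
  have "{e \<in> ?T. Inr j \<in> e} = insert {Inl (\<pi> j), Inr j} ((\<lambda>v. {Inl v, Inr j}) ` {v \<in> W. \<phi> v = j})"
    using j by auto
  moreover have "{Inl (\<pi> j), Inr j} \<notin> (\<lambda>v. {Inl v, Inr j}) ` {v \<in> W. \<phi> v = j}"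
    using ne by (auto simp: doubleton_eq_iff)
  moreover have "card ((\<lambda>v. {Inl v, Inr j} :: ('v + nat) set) ` {v \<in> W. \<phi> v = j}) = card {v \<in> W. \<phi> v = j}"
    by (rule card_image) (auto simp: inj_on_def doubleton_eq_iff)
  ultimately show ?thesis using W by (simp add: vertex_degree_def)
qed

section \<open>Hypertrees as fiber vectors of total functions\<close>

text \<open>The shape of the hypergraphs inducing the extended graph: \<open>v0\<close> and
  \<open>j0\<close> stand for the two additional vertices, one on either side.\<close>

locale pointed_hypergraph =
  fixes V :: "'v set" and es :: "'v set list" and v0 :: 'v and j0 :: nat
  assumes hyp: "hypergraph V es" and v0: "v0 \<in> V" and j0: "j0 < length es"
    and v0_in: "\<And>j. j < length es \<Longrightarrow> v0 \<in> es ! j" and es_j0: "es ! j0 = V"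
begin

abbreviation "n \<equiv> length es"
abbreviation "W \<equiv> V - {v0}"

lemma finW: "finite W" using hyp by (simp add: hypergraph_def)

lemma es_sub: "j < n \<Longrightarrow> es ! j \<subseteq> V" using hyp by (simp add: hypergraph_def)

text \<open>In the tree rooted at \<open>v0\<close> every hyperedge has one parent edge, so its
  degree minus 1 counts its children; \<open>\<phi>\<close> sends a vertex to its parent.\<close>

lemma hypertree_imp:
  assumes "hypertree V es f"
  shows "\<exists>\<phi>. (\<forall>v\<in>W. \<phi> v < n \<and> v \<in> es ! \<phi> v) \<and> (\<forall>j<n. f j = card {v \<in> W. \<phi> v = j})"
proof -
  let ?VV = "bip_vertices V es"
  obtain T where T: "spanning_tree ?VV (bip_edges es) T" and deg: "\<forall>j<n. vertex_degree T (Inr j) = f j + 1"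
    using assms by (auto simp: hypertree_def)
  have sub: "T \<subseteq> bip_edges es" and conn: "graph_connected ?VV T" and acyc: "\<nexists>vs. is_cycle T vs"
    using T by (auto simp: spanning_tree_def)
  have TE: "\<exists>v j. {a, b} = {Inl v, Inr j} \<and> j < n \<and> v \<in> es ! j" if "{a, b} \<in> T" for a b
    using sub that by (auto simp: bip_edges_def)
  have TV: "a \<in> ?VV" if "{a, b} \<in> T" for a b
    using TE[OF that] es_sub by (auto simp: bip_vertices_def doubleton_eq_iff)
  have root: "Inl v0 \<in> ?VV" using v0 by (auto simp: bip_vertices_def)
  have "\<exists>par d. (\<forall>x\<in>?VV - {Inl v0}. {x, par x} \<in> T \<and> par x \<in> ?VV \<and> (d (par x) :: nat) < d x)"
    by (rule connected_parent[OF conn root]) (rule TV)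
  then obtain par and d :: "_ \<Rightarrow> nat" where par: "\<And>x. x \<in> ?VV - {Inl v0} \<Longrightarrow> {x, par x} \<in> T \<and> par x \<in> ?VV \<and> d (par x) < d x"
    by blast
  define T' where "T' = {{x, par x} | x. x \<in> ?VV - {Inl v0}}"
  have T'T: "T' \<subseteq> T" using par by (auto simp: T'_def)
  let ?r = "{(a, b). {a, b} \<in> T'}"
  have reach: "(x, Inl v0) \<in> ?r\<^sup>*" if "x \<in> ?VV" for x
    using that
  proof (induction "d x" arbitrary: x rule: less_induct)
    case less
    show ?case
    proof (cases "x = Inl v0")
      case False
      then have "(x, par x) \<in> ?r" using less by (auto simp: T'_def)
      moreover have "(par x, Inl v0) \<in> ?r\<^sup>*" using less par[of x] False by blast
      ultimately show ?thesis by (rule converse_rtrancl_into_rtrancl)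
    qed simp
  qed
  have "sym ?r" by (auto simp: sym_def insert_commute)
  then have symr: "sym (?r\<^sup>*)" by (rule sym_rtrancl)
  \<comment> \<open>The parent edges already connect everything, so any further edge would close a
    cycle.\<close>
  have TT': "T = T'"
  proof (rule ccontr)
    assume "T \<noteq> T'"
    then obtain e where e: "e \<in> T" "e \<notin> T'" using T'T by blast
    then obtain v j where vj: "e = {Inl v, Inr j}" using sub by (auto simp: bip_edges_def)
    have "Inl v \<in> ?VV" "Inr j \<in> ?VV"
      using TV[of "Inl v" "Inr j"] TV[of "Inr j" "Inl v"] e vj by (auto simp: insert_commute)
    then have "(Inl v, Inr j) \<in> ?r\<^sup>*" using reach symr by (meson rtrancl_trans symD)
    then show False using connected_add_edge_cycle[of "Inl v" "Inr j" T' T] T'T e vj acyc by auto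
  qed
  have parv: "\<exists>j. par (Inl v) = Inr j \<and> j < n \<and> v \<in> es ! j" if "v \<in> W" for v
    using TE[of "Inl v" "par (Inl v)"] par[of "Inl v"] that by (auto simp: bip_vertices_def doubleton_eq_iff)
  have parj: "\<exists>v. par (Inr j) = Inl v" if "j < n" for j
    using TE[of "Inr j" "par (Inr j)"] par[of "Inr j"] that by (auto simp: bip_vertices_def doubleton_eq_iff)
  obtain \<phi> where \<phi>: "\<And>v. v \<in> W \<Longrightarrow> par (Inl v) = Inr (\<phi> v) \<and> \<phi> v < n \<and> v \<in> es ! \<phi> v"
    using parv by metis
  obtain \<pi> where \<pi>: "\<And>j. j < n \<Longrightarrow> par (Inr j) = Inl (\<pi> j)" using parj by metis
  have VV: "?VV - {Inl v0} = Inl ` W \<union> Inr ` {..<n}" by (auto simp: bip_vertices_def)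
  have "T = {{Inl v, Inr (\<phi> v)} | v. v \<in> W} \<union> {{Inl (\<pi> j), Inr j} | j. j < n}"
  proof -
    have "T = {{Inl v, par (Inl v)} | v. v \<in> W} \<union> {{Inr j, par (Inr j)} | j. j < n}"
      unfolding TT' T'_def VV by blast
    also have "{{Inl v, par (Inl v)} | v. v \<in> W} = {{Inl v, Inr (\<phi> v)} | v. v \<in> W}" using \<phi> by metis
    also have "{{Inr j, par (Inr j)} | j. j < n} = {{Inl (\<pi> j), Inr j} | j. j < n}" using \<pi> by (metis insert_commute)
    finally show ?thesis .
  qed
  \<comment> \<open>Distances strictly decrease towards the root, so two vertices are never parents
    of each other.\<close>
  moreover have "\<pi> (\<phi> v) \<noteq> v" if "v \<in> W" for v
  proof
    assume "\<pi> (\<phi> v) = v"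
    then show False
      using par[of "Inl v"] par[of "Inr (\<phi> v)"] \<phi>[OF that] \<pi>[of "\<phi> v"] that by (auto simp: bip_vertices_def)
  qed
  ultimately have "f j = card {v \<in> W. \<phi> v = j}" if "j < n" for j
    using degree_bipartite_tree[OF finW that, of \<pi> \<phi>] deg that by simp
  then show ?thesis using \<phi> by blast
qed

text \<open>All hyperedges hang from \<open>v0\<close> and each other vertex from its hyperedge.
  Vertices other than \<open>v0\<close> are then leaves, so a cycle through a hyperedge would visit
  \<open>v0\<close> twice.\<close>

lemma hypertreeI:
  assumes \<phi>: "\<And>v. v \<in> W \<Longrightarrow> \<phi> v < n \<and> v \<in> es ! \<phi> v" and f: "\<And>j. f j = (if j < n then card {v \<in> W. \<phi> v = j} else 0)"
  shows "hypertree V es f"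
proof -
  let ?VV = "bip_vertices V es"
  define T where "T = {{Inl v, Inr (\<phi> v)} | v. v \<in> W} \<union> {{Inl v0, Inr j} | j. j < n}"
  let ?r = "{(a, b). {a, b} \<in> T}"
  have sub: "T \<subseteq> bip_edges es" using \<phi> v0_in by (auto simp: T_def bip_edges_def)
  have r2: "(Inr j, Inl v0) \<in> ?r" if "j < n" for j
    using that by (auto simp: T_def insert_commute)
  have r1: "(Inl v, Inr (\<phi> v)) \<in> ?r" if "v \<in> W" for v using that by (auto simp: T_def)
  have reach: "(x, Inl v0) \<in> ?r\<^sup>*" if xV: "x \<in> ?VV" for x
  proof -
    consider "x = Inl v0" | v where "v \<in> W" "x = Inl v" | j where "j < n" "x = Inr j"
      using xV by (auto simp: bip_vertices_def)
    then show ?thesis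
    proof cases
      case (2 v)
      then show ?thesis using r1[OF 2(1)] r2[of "\<phi> v"] \<phi>[OF 2(1)] by (meson converse_rtrancl_into_rtrancl r_into_rtrancl)
    qed (use r2 in auto)
  qed
  have "sym ?r" by (auto simp: sym_def insert_commute)
  then have symr: "sym (?r\<^sup>*)" by (rule sym_rtrancl)
  have conn: "graph_connected ?VV T"
    unfolding graph_connected_def using reach symr by (meson rtrancl_trans symD)
  have acyc: False if cyc: "is_cycle T vs" for vs
  proof -
    let ?l = "length vs"
    have l: "3 \<le> ?l" and dist: "distinct vs" and ed: "\<And>i. i < ?l \<Longrightarrow> {vs ! i, vs ! (Suc i mod ?l)} \<in> T"
      using cyc by (auto simp: is_cycle_def)
    define nxt where "nxt = (\<lambda>i. if Suc i = ?l then 0 else Suc i)"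
    define prv where "prv = (\<lambda>i. if i = 0 then ?l - 1 else i - 1)"
    have nx: "{vs ! i, vs ! nxt i} \<in> T" if "i < ?l" for i
      using ed[OF that] that by (auto simp: nxt_def split: if_splits)
    have pv: "{vs ! i, vs ! prv i} \<in> T" if "i < ?l" for i
      using nx[of "prv i"] that l by (auto simp: nxt_def prv_def insert_commute split: if_splits)
    have np: "vs ! nxt i \<noteq> vs ! prv i" "nxt i < ?l" "prv i < ?l" if "i < ?l" for i
    proof -
      show n: "nxt i < ?l" and p: "prv i < ?l" using that l by (auto simp: nxt_def prv_def)
      have "nxt i \<noteq> prv i" using that l by (auto simp: nxt_def prv_def)
      then show "vs ! nxt i \<noteq> vs ! prv i" using nth_eq_iff_index_eq[OF dist n p] by blast
    qed
    have Inl0: "vs ! i = Inl v0" if "i < ?l" "vs ! i = Inl v" for i v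
    proof (rule ccontr)
      assume "vs ! i \<noteq> Inl v0"
      then have "b = Inr (\<phi> v)" if "{vs ! i, b} \<in> T" for b
        using that \<open>vs ! i = Inl v\<close> by (auto simp: T_def doubleton_eq_iff)
      then show False using nx[OF that(1)] pv[OF that(1)] np(1)[OF that(1)] by metis
    qed
    have Inr: "\<exists>v. b = Inl v" if "{Inr j, b} \<in> T" for j b using that by (auto simp: T_def doubleton_eq_iff)
    have noInr: "vs ! i \<noteq> Inr j" if il: "i < ?l" for i j
    proof
      assume i: "vs ! i = Inr j"
      then obtain a b where "vs ! nxt i = Inl a" "vs ! prv i = Inl b"
        using Inr nx[OF il] pv[OF il] by metis
      then show False using Inl0[of "nxt i"] Inl0[of "prv i"] np[OF il] by metis
    qed
    have "0 < ?l" "nxt 0 < ?l" using l by (auto simp: nxt_def)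
    then obtain a b where "vs ! 0 = Inl a" "vs ! nxt 0 = Inl b" using noInr by (metis sum.exhaust)
    then show False using nx[OF \<open>0 < ?l\<close>] by (auto simp: T_def doubleton_eq_iff)
  qed
  have "vertex_degree T (Inr j) = f j + 1" if "j < n" for j
    unfolding T_def f using degree_bipartite_tree[OF finW that, of "\<lambda>_. v0" \<phi>] that by auto
  then show ?thesis
    unfolding hypertree_def spanning_tree_def using sub conn acyc f by auto
qed

lemma hypertree_iff:
  "hypertree V es f \<longleftrightarrow> (\<exists>\<phi>. (\<forall>v\<in>W. \<phi> v < n \<and> v \<in> es ! \<phi> v) \<and>
     (\<forall>j. f j = (if j < n then card {v \<in> W. \<phi> v = j} else 0)))"
proof
  assume h: "hypertree V es f"
  then have z: "f j = 0" if "\<not> j < n" for j using that by (simp add: hypertree_def)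
  obtain \<phi> where "\<forall>v\<in>W. \<phi> v < n \<and> v \<in> es ! \<phi> v" "\<forall>j<n. f j = card {v \<in> W. \<phi> v = j}"
    using hypertree_imp[OF h] by blast
  then show "\<exists>\<phi>. (\<forall>v\<in>W. \<phi> v < n \<and> v \<in> es ! \<phi> v) \<and>
     (\<forall>j. f j = (if j < n then card {v \<in> W. \<phi> v = j} else 0))"
    using z by (intro exI[of _ \<phi>]) simp
next
  assume "\<exists>\<phi>. (\<forall>v\<in>W. \<phi> v < n \<and> v \<in> es ! \<phi> v) \<and>
     (\<forall>j. f j = (if j < n then card {v \<in> W. \<phi> v = j} else 0))"
  then obtain \<phi> where "\<forall>v\<in>W. \<phi> v < n \<and> v \<in> es ! \<phi> v" "\<forall>j. f j = (if j < n then card {v \<in> W. \<phi> v = j} else 0)"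
    by blast
  then show "hypertree V es f" by (intro hypertreeI) auto
qed

end

section \<open>Activity and the order of the hyperedges\<close>

text \<open>The rank \<open>\<sigma>\<close> carries the order, so the order can change while the
  indices stay fixed.\<close>

definition inactive_wrt :: "(nat \<Rightarrow> nat) set \<Rightarrow> nat \<Rightarrow> (nat \<Rightarrow> nat) \<Rightarrow> (nat \<Rightarrow> nat) \<Rightarrow> nat \<Rightarrow> bool" where
  "inactive_wrt H n \<sigma> f j \<longleftrightarrow> f j > 0 \<and> (\<exists>i<n. \<sigma> i < \<sigma> j \<and> f(j := f j - 1, i := f i + 1) \<in> H)"

text \<open>The exchange axiom for the integer bases of a polymatroid of rank \<open>r\<close> (an
  M-convex set).\<close>

locale exchange_set =
  fixes H :: "(nat \<Rightarrow> nat) set" and n r :: nat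
  assumes finH: "finite H" and supp: "\<And>f j. f \<in> H \<Longrightarrow> j \<ge> n \<Longrightarrow> f j = 0"
    and total: "\<And>f. f \<in> H \<Longrightarrow> sum f {..<n} = r"
    and exchange: "\<And>f f' i. f \<in> H \<Longrightarrow> f' \<in> H \<Longrightarrow> f i < f' i \<Longrightarrow>
      \<exists>j<n. f' j < f j \<and> f(j := f j - 1, i := f i + 1) \<in> H"
begin

definition act :: "(nat \<Rightarrow> nat) \<Rightarrow> (nat \<Rightarrow> nat) \<Rightarrow> nat set" where
  "act \<sigma> f = {j. j < n \<and> \<not> inactive_wrt H n \<sigma> f j}"

definition below :: "nat \<Rightarrow> (nat \<Rightarrow> int) set" where
  "below t = {g. (\<forall>j\<ge>n. g j = 0) \<and> (\<exists>f\<in>H. \<forall>j. g j \<le> int (f j)) \<and> sum g {..<n} = int r - int t}"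

text \<open>Every point below a hypertree lies below a unique lexicographically largest one, which exceeds
  it only at active hyperedges. This makes the count of points below independent of the order.\<close>

lemma bij_below:
  assumes \<sigma>: "inj_on \<sigma> {..<n}"
  shows "bij_betw (\<lambda>(f, d) j. int (f j) - int (d j)) (SIGMA f : H. compositions (act \<sigma> f) t) (below t)"
  unfolding bij_betw_def
proof
  show "inj_on (\<lambda>(f, d) j. int (f j) - int (d j)) (SIGMA f : H. compositions (act \<sigma> f) t)"
  proof (rule inj_onI, clarify)
    fix f d f' d' assume f: "f \<in> H" "d \<in> compositions (act \<sigma> f) t" and f': "f' \<in> H" "d' \<in> compositions (act \<sigma> f') t"
      and eq: "(\<lambda>j. int (f j) - int (d j)) = (\<lambda>j. int (f' j) - int (d' j))"
    have eqj: "int (f j) - int (d j) = int (f' j) - int (d' j)" for j using fun_cong[OF eq] .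
    \<comment> \<open>At the first position \<open>i\<close> where the two differ, the exchange
      takes a unit from some \<open>j\<close>, which comes later. So \<open>j\<close> is inactive
      for \<open>f\<close>, although \<open>d j > 0\<close>.\<close>
    have False if ne: "f i < f' i" and first: "\<And>j. j < n \<Longrightarrow> f j \<noteq> f' j \<Longrightarrow> \<sigma> i \<le> \<sigma> j" and i: "i < n"
      and f: "f \<in> H" "d \<in> compositions (act \<sigma> f) t" and f': "f' \<in> H"
      and eqj: "\<And>j. int (f j) - int (d j) = int (f' j) - int (d' j)" for f d f' d' i
    proof -
      obtain j where j: "j < n" "f' j < f j" "f(j := f j - 1, i := f i + 1) \<in> H"
        using exchange[OF f(1) f' ne] by blast
      have "\<sigma> i \<noteq> \<sigma> j" using \<sigma> i j ne by (metis inj_onD lessThan_iff less_asym)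
      then have "\<sigma> i < \<sigma> j" using first[of j] j by simp
      then have "inactive_wrt H n \<sigma> f j" using j i by (auto simp: inactive_wrt_def)
      moreover have "d j > 0" using eqj[of j] j by linarith
      ultimately show False using f(2) by (auto simp: compositions_def act_def)
    qed
    note wlog = this
    have "f = f'"
    proof (rule ccontr)
      assume "f \<noteq> f'"
      then obtain k where "f k \<noteq> f' k" by blast
      then have k: "f k \<noteq> f' k" "k < n" using supp f f' by (auto, metis not_le)
      then obtain i where i: "i < n" "f i \<noteq> f' i" "\<And>j. j < n \<Longrightarrow> f j \<noteq> f' j \<Longrightarrow> \<sigma> i \<le> \<sigma> j"
        using ex_has_least_nat[of "\<lambda>i. i < n \<and> f i \<noteq> f' i" k \<sigma>] by blast
      consider "f i < f' i" | "f' i < f i" using i(2) by linarith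
      then show False
      proof cases
        case 1 then show False using wlog[of f i f' d d'] i f f' eqj by blast
      next
        case 2 then show False using wlog[of f' i f d' d] i f f' eqj[symmetric] by metis
      qed
    qed
    moreover from this have "d = d'" using eqj by (auto simp: fun_eq_iff)
    ultimately show "f = f' \<and> d = d'" by blast
  qed
  show "(\<lambda>(f, d) j. int (f j) - int (d j)) ` (SIGMA f : H. compositions (act \<sigma> f) t) = below t"
  proof (intro equalityI subsetI)
    fix g assume "g \<in> (\<lambda>(f, d) j. int (f j) - int (d j)) ` (SIGMA f : H. compositions (act \<sigma> f) t)"
    then obtain f d where fd: "f \<in> H" "d \<in> compositions (act \<sigma> f) t" "g = (\<lambda>j. int (f j) - int (d j))" by auto
    have "sum d {..<n} = sum d (act \<sigma> f)"
      using fd(2) by (intro sum.mono_neutral_right) (auto simp: act_def compositions_def)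
    then have "sum d {..<n} = t" using fd(2) by (auto simp: compositions_def)
    then have "sum g {..<n} = int r - int t"
      using total[OF fd(1)] unfolding fd(3) by (simp add: sum_subtractf flip: of_nat_sum)
    moreover have "g j = 0" if "j \<ge> n" for j
      using supp[OF fd(1) that] fd(2,3) that by (auto simp: compositions_def act_def)
    ultimately show "g \<in> below t"
      using fd by (auto simp: below_def intro!: bexI[of _ f])
  next
    fix g assume g: "g \<in> below t"
    \<comment> \<open>Moving a unit from an inactive \<open>j\<close> to an earlier \<open>i\<close>
      lowers this sum by \<open>\<sigma> j - \<sigma> i\<close>; a minimiser above \<open>g\<close>
      therefore exceeds it at active positions only.\<close>
    define pot where "pot = (\<lambda>f. \<Sum>j<n. \<sigma> j * f j)"
    obtain f0 where "f0 \<in> H \<and> (\<forall>j. g j \<le> int (f0 j))" using g by (auto simp: below_def)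
    then obtain f where f: "f \<in> H" "\<And>j. g j \<le> int (f j)"
      and fmin: "\<And>f'. f' \<in> H \<Longrightarrow> (\<And>j. g j \<le> int (f' j)) \<Longrightarrow> pot f \<le> pot f'"
      using ex_has_least_nat[of "\<lambda>f. f \<in> H \<and> (\<forall>j. g j \<le> int (f j))" f0 pot] by blast
    define d where "d = (\<lambda>j. nat (int (f j) - g j))"
    have d: "int (d j) = int (f j) - g j" for j using f(2)[of j] by (simp add: d_def)
    have d0: "d j = 0" if "j \<notin> act \<sigma> f" for j
    proof (rule ccontr)
      assume dj: "d j \<noteq> 0"
      show False
      proof (cases "j < n")
        case False
        then show False using dj d[of j] supp[OF f(1), of j] g by (auto simp: below_def)
      next
        case True
        then have "inactive_wrt H n \<sigma> f j" using that by (auto simp: act_def)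
        then obtain i where i: "f j > 0" "i < n" "\<sigma> i < \<sigma> j" "f(j := f j - 1, i := f i + 1) \<in> H"
          by (auto simp: inactive_wrt_def)
        let ?f = "f(j := f j - 1, i := f i + 1)"
        have ij: "i \<noteq> j" using i by auto
        have "g k \<le> int (?f k)" for k
          using f(2)[of k] dj d[of j] i(1) ij by (auto simp: of_nat_diff)
        then have "pot f \<le> pot ?f" using fmin i(4) by blast
        moreover have "pot ?f + \<sigma> j = pot f + \<sigma> i"
        proof -
          have split: "(\<Sum>k<n. c k) = c i + (c j + sum c ({..<n} - {i} - {j}))" for c :: "nat \<Rightarrow> nat"
            using i(2) True ij by (subst sum.remove[of _ i], simp_all, subst sum.remove[of _ j]) auto
          have rest: "(\<Sum>k\<in>{..<n} - {i} - {j}. \<sigma> k * ?f k) = (\<Sum>k\<in>{..<n} - {i} - {j}. \<sigma> k * f k)"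
            by (intro sum.cong) auto
          obtain m where m: "f j = Suc m" using i(1) by (cases "f j") auto
          show ?thesis unfolding pot_def split rest using ij m by simp
        qed
        ultimately show False using i(3) by linarith
      qed
    qed
    have "sum d (act \<sigma> f) = sum d {..<n}"
      using d0 by (intro sum.mono_neutral_left) (auto simp: act_def)
    moreover have "int (sum d {..<n}) = int t"
    proof -
      have "int (sum d {..<n}) = (\<Sum>j<n. int (f j) - g j)" by (simp add: d)
      also have "\<dots> = int (sum f {..<n}) - sum g {..<n}" by (simp add: sum_subtractf)
      also have "\<dots> = int t" using total[OF f(1)] g by (simp add: below_def)
      finally show ?thesis .
    qed
    then have "sum d {..<n} = t" by (simp only: of_nat_eq_iff)
    ultimately have "d \<in> compositions (act \<sigma> f) t" using d0 by (simp add: compositions_def)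
    moreover have "g = (\<lambda>j. int (f j) - int (d j))" by (simp add: d)
    ultimately show "g \<in> (\<lambda>(f, d) j. int (f j) - int (d j)) ` (SIGMA f : H. compositions (act \<sigma> f) t)"
      using f(1) by force
  qed
qed

text \<open>Each \<open>f\<close> contributes \<open>(1 - x)\<close> to the power minus the number
  of its active positions; the factor \<open>(1 - x)^n\<close> leaves the inactive ones as exponent.
  The right hand side does not mention \<open>\<sigma>\<close>.\<close>

lemma below_series:
  assumes "inj_on \<sigma> {..<n}"
  shows "(\<Sum>f\<in>H. (1 - fps_X) ^ card {j. j < n \<and> inactive_wrt H n \<sigma> f j}) =
    Abs_fps (\<lambda>t. real (card (below t))) * (1 - fps_X) ^ n"
proof -
  define E where "E = (Abs_fps (\<lambda>_. 1) :: real fps)"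
  have E: "E * (1 - fps_X) = 1"
    by (rule fps_ext) (simp add: E_def right_diff_distrib)
  have fin: "finite (act \<sigma> f)" for f by (simp add: act_def)
  have "Abs_fps (\<lambda>t. real (card (below t))) = (\<Sum>f\<in>H. E ^ card (act \<sigma> f))"
  proof (rule fps_ext)
    fix t
    have "real (card (below t)) = real (card (SIGMA f : H. compositions (act \<sigma> f) t))"
      using bij_betw_same_card[OF bij_below[OF assms]] by simp
    also have "\<dots> = (\<Sum>f\<in>H. real (card (compositions (act \<sigma> f) t)))"
      using finH fin by (subst card_SigmaI) (auto simp: finite_compositions)
    also have "\<dots> = (\<Sum>f\<in>H. fps_nth (E ^ card (act \<sigma> f)) t)"
      using fps_prod_nth_compositions[OF fin, of "\<lambda>_. E"] by (simp add: E_def)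
    finally show "fps_nth (Abs_fps (\<lambda>t. real (card (below t)))) t = fps_nth (\<Sum>f\<in>H. E ^ card (act \<sigma> f)) t"
      by (simp add: fps_sum_nth)
  qed
  moreover have "E ^ card (act \<sigma> f) * (1 - fps_X) ^ n = (1 - fps_X) ^ card {j. j < n \<and> inactive_wrt H n \<sigma> f j}" for f
  proof -
    have "card {..<n} = card (act \<sigma> f \<union> {j. j < n \<and> inactive_wrt H n \<sigma> f j})"
      by (rule arg_cong[where f = card]) (auto simp: act_def)
    also have "\<dots> = card (act \<sigma> f) + card {j. j < n \<and> inactive_wrt H n \<sigma> f j}"
      using fin by (subst card_Un_disjoint) (auto simp: act_def)
    finally have n: "n = card (act \<sigma> f) + card {j. j < n \<and> inactive_wrt H n \<sigma> f j}" by simp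
    have "E ^ card (act \<sigma> f) * (1 - fps_X) ^ n =
      (E * (1 - fps_X)) ^ card (act \<sigma> f) * (1 - fps_X) ^ card {j. j < n \<and> inactive_wrt H n \<sigma> f j}"
      by (subst n) (simp only: power_add power_mult_distrib mult_ac)
    then show ?thesis by (simp add: E)
  qed
  ultimately show ?thesis by (simp add: sum_distrib_right)
qed

lemma inactive_order_independent:
  assumes "inj_on \<sigma> {..<n}" "inj_on \<tau> {..<n}"
  shows "(\<Sum>f\<in>H. monom (1 :: real) (card {j. j < n \<and> inactive_wrt H n \<sigma> f j})) =
    (\<Sum>f\<in>H. monom 1 (card {j. j < n \<and> inactive_wrt H n \<tau> f j}))"
proof -
  have p: "fps_of_poly [:1, - 1 :: real:] = 1 - fps_X"
    by (simp add: fps_of_poly_pCons)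
  have "fps_of_poly (\<Sum>f\<in>H. [:1, - 1 :: real:] ^ card {j. j < n \<and> inactive_wrt H n \<sigma> f j}) =
    fps_of_poly (\<Sum>f\<in>H. [:1, - 1 :: real:] ^ card {j. j < n \<and> inactive_wrt H n \<tau> f j})"
    using below_series[OF assms(1)] below_series[OF assms(2)]
    by (simp add: fps_of_poly_sum fps_of_poly_power p)
  then have eq: "(\<Sum>f\<in>H. [:1, - 1 :: real:] ^ card {j. j < n \<and> inactive_wrt H n \<sigma> f j}) =
    (\<Sum>f\<in>H. [:1, - 1 :: real:] ^ card {j. j < n \<and> inactive_wrt H n \<tau> f j})" by simp
  \<comment> \<open>The series compare the polynomials at \<open>1 - x\<close>; substituting
    \<open>1 - x\<close> once more returns to \<open>x\<close>.\<close>
  have "poly (\<Sum>f\<in>H. monom (1 :: real) (card {j. j < n \<and> inactive_wrt H n \<sigma> f j})) x =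
    poly (\<Sum>f\<in>H. monom 1 (card {j. j < n \<and> inactive_wrt H n \<tau> f j})) x" for x
    using arg_cong[OF eq, of "\<lambda>p. poly p (1 - x)"] by (simp add: poly_sum poly_monom)
  then show ?thesis by (simp add: poly_eq_poly_eq_iff[symmetric] fun_eq_iff)
qed

end


section \<open>Exchange for hypertrees and the interior polynomial\<close>

text \<open>Some \<open>v\<close> is sent to \<open>i\<close> by \<open>\<phi>'\<close> but not by
  \<open>\<phi>\<close>; changing its value moves a unit from \<open>j1\<close> to \<open>i\<close>.
  If \<open>j1\<close> had no surplus it is now short, and the argument continues with
  \<open>j1\<close> in place of \<open>i\<close> and a function that agrees with
  \<open>\<phi>'\<close> more often.\<close>

lemma fiber_exchange:
  fixes \<phi> \<phi>' :: "'v \<Rightarrow> 'c"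
  assumes W: "finite W" and less: "card {v \<in> W. \<phi> v = i} < card {v \<in> W. \<phi>' v = i}"
  shows "\<exists>j \<phi>''. card {v \<in> W. \<phi>' v = j} < card {v \<in> W. \<phi> v = j} \<and>
    (\<forall>v\<in>W. \<phi>'' v = \<phi> v \<or> \<phi>'' v = \<phi>' v) \<and>
    (\<lambda>k. card {v \<in> W. \<phi>'' v = k}) =
      (\<lambda>k. card {v \<in> W. \<phi> v = k})(j := card {v \<in> W. \<phi> v = j} - 1, i := card {v \<in> W. \<phi> v = i} + 1)"
  using less
proof (induction "card {v \<in> W. \<phi> v \<noteq> \<phi>' v}" arbitrary: \<phi> i rule: less_induct)
  case less
  let ?c = "\<lambda>\<phi> k. card {v \<in> W. \<phi> v = k}"
  have "\<not> {v \<in> W. \<phi>' v = i} \<subseteq> {v \<in> W. \<phi> v = i}"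
    using less(2) W card_mono[of "{v \<in> W. \<phi> v = i}" "{v \<in> W. \<phi>' v = i}"] by auto
  then obtain v where v: "v \<in> W" "\<phi>' v = i" "\<phi> v \<noteq> i" by blast
  define j1 where "j1 = \<phi> v"
  define \<phi>1 where "\<phi>1 = \<phi>(v := i)"
  have j1i: "j1 \<noteq> i" using v by (simp add: j1_def)
  have c1: "?c \<phi>1 = (?c \<phi>)(j1 := ?c \<phi> j1 - 1, i := ?c \<phi> i + 1)"
  proof
    fix k
    have "{u \<in> W. \<phi>1 u = i} = insert v {u \<in> W. \<phi> u = i}" using v by (auto simp: \<phi>1_def)
    then have "?c \<phi>1 i = ?c \<phi> i + 1" using v W by simp
    moreover have "{u \<in> W. \<phi>1 u = j1} = {u \<in> W. \<phi> u = j1} - {v}" using v by (auto simp: \<phi>1_def j1_def)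
    then have "?c \<phi>1 j1 = ?c \<phi> j1 - 1" using v W by (simp add: j1_def card_Diff_singleton_if)
    moreover have "{u \<in> W. \<phi>1 u = k} = {u \<in> W. \<phi> u = k}" if "k \<noteq> i" "k \<noteq> j1"
      using that by (auto simp: \<phi>1_def j1_def)
    ultimately show "?c \<phi>1 k = ((?c \<phi>)(j1 := ?c \<phi> j1 - 1, i := ?c \<phi> i + 1)) k"
      using j1i by auto
  qed
  have pos: "0 < ?c \<phi> j1" using v W by (auto simp: card_gt_0_iff j1_def)
  show ?case
  proof (cases "?c \<phi>' j1 < ?c \<phi> j1")
    case True
    then show ?thesis using c1 v by (intro exI[of _ j1] exI[of _ \<phi>1]) (auto simp: \<phi>1_def)
  next
    case False
    have c1j: "?c \<phi>1 j1 = ?c \<phi> j1 - 1" and c1i: "?c \<phi>1 i = ?c \<phi> i + 1"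
      using fun_cong[OF c1, of j1] fun_cong[OF c1, of i] j1i by auto
    have l1: "?c \<phi>1 j1 < ?c \<phi>' j1" using c1j False pos by linarith
    have "{u \<in> W. \<phi>1 u \<noteq> \<phi>' u} \<subset> {u \<in> W. \<phi> u \<noteq> \<phi>' u}" using v by (auto simp: \<phi>1_def)
    then have "card {u \<in> W. \<phi>1 u \<noteq> \<phi>' u} < card {u \<in> W. \<phi> u \<noteq> \<phi>' u}"
      using W by (intro psubset_card_mono) auto
    from less(1)[OF this l1] obtain j \<phi>'' where j: "?c \<phi>' j < ?c \<phi>1 j"
      "\<And>v. v \<in> W \<Longrightarrow> \<phi>'' v = \<phi>1 v \<or> \<phi>'' v = \<phi>' v"
      "?c \<phi>'' = (?c \<phi>1)(j := ?c \<phi>1 j - 1, j1 := ?c \<phi>1 j1 + 1)" by blast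
    \<comment> \<open>Neither \<open>i\<close> nor \<open>j1\<close> has a surplus after the move.
      So the unit taken from \<open>j1\<close> and the one returned to it cancel, leaving a transfer
      from \<open>j\<close> to \<open>i\<close>.\<close>
    have jj: "j \<noteq> j1" "j \<noteq> i" using j(1) l1 c1i less(2) by auto
    then have cj: "?c \<phi>1 j = ?c \<phi> j" using fun_cong[OF c1, of j] by simp
    have "?c \<phi>'' = (?c \<phi>)(j := ?c \<phi> j - 1, i := ?c \<phi> i + 1)"
    proof
      fix k
      have 1: "?c \<phi>'' k = ((?c \<phi>1)(j := ?c \<phi>1 j - 1, j1 := ?c \<phi>1 j1 + 1)) k" by (rule fun_cong[OF j(3)])
      have 2: "?c \<phi>1 k = ((?c \<phi>)(j1 := ?c \<phi> j1 - 1, i := ?c \<phi> i + 1)) k" by (rule fun_cong[OF c1])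
      show "?c \<phi>'' k = ((?c \<phi>)(j := ?c \<phi> j - 1, i := ?c \<phi> i + 1)) k"
        using 1 2 jj cj c1j pos j1i by (cases "k = j"; cases "k = i"; cases "k = j1") simp_all
    qed
    moreover have "\<phi>'' u = \<phi> u \<or> \<phi>'' u = \<phi>' u" if "u \<in> W" for u
      using j(2)[OF that] v by (auto simp: \<phi>1_def split: if_splits)
    ultimately show ?thesis using j(1) cj by (intro exI[of _ j] exI[of _ \<phi>'']) auto
  qed
qed

context pointed_hypergraph
begin

lemma hypertrees_exchange: "exchange_set {f. hypertree V es f} n (card W)"
proof
  show "finite {f. hypertree V es f}"
  proof (rule finite_subset)
    show "{f. hypertree V es f} \<subseteq> {f. \<forall>j. (j \<in> {..<n} \<longrightarrow> f j \<in> {..card W}) \<and> (j \<notin> {..<n} \<longrightarrow> f j = 0)}"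
      using finW by (auto simp: hypertree_iff intro!: card_mono)
    show "finite {f. \<forall>j. (j \<in> {..<n} \<longrightarrow> f j \<in> {..card W}) \<and> (j \<notin> {..<n} \<longrightarrow> f j = (0::nat))}"
      by (rule finite_set_of_finite_funs) auto
  qed
next
  fix f j assume "f \<in> {f. hypertree V es f}" "n \<le> j"
  then show "f j = 0" by (simp add: hypertree_def)
next
  fix f assume "f \<in> {f. hypertree V es f}"
  then obtain \<phi> where \<phi>: "\<forall>v\<in>W. \<phi> v < n \<and> v \<in> es ! \<phi> v" "\<forall>j. f j = (if j < n then card {v \<in> W. \<phi> v = j} else 0)"
    by (auto simp: hypertree_iff)
  have "sum f {..<n} = (\<Sum>j<n. card {v \<in> W. \<phi> v = j})" using \<phi>(2) by simp
  also have "\<dots> = card (\<Union>j<n. {v \<in> W. \<phi> v = j})" using finW by (subst card_UN_disjoint) auto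
  also have "(\<Union>j<n. {v \<in> W. \<phi> v = j}) = W" using \<phi>(1) by auto
  finally show "sum f {..<n} = card W" .
next
  fix f f' i assume f: "f \<in> {f. hypertree V es f}" and f': "f' \<in> {f. hypertree V es f}" and less: "f i < f' i"
  obtain \<phi> where \<phi>: "\<forall>v\<in>W. \<phi> v < n \<and> v \<in> es ! \<phi> v" "\<forall>j. f j = (if j < n then card {v \<in> W. \<phi> v = j} else 0)"
    using f by (auto simp: hypertree_iff)
  obtain \<phi>' where \<phi>': "\<forall>v\<in>W. \<phi>' v < n \<and> v \<in> es ! \<phi>' v" "\<forall>j. f' j = (if j < n then card {v \<in> W. \<phi>' v = j} else 0)"
    using f' by (auto simp: hypertree_iff)
  have i: "i < n" using less \<phi>'(2) by (metis not_less0)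
  then have "card {v \<in> W. \<phi> v = i} < card {v \<in> W. \<phi>' v = i}" using less \<phi>(2) \<phi>'(2) by simp
  from fiber_exchange[OF finW this] obtain j \<phi>'' where j: "card {v \<in> W. \<phi>' v = j} < card {v \<in> W. \<phi> v = j}"
    "\<And>v. v \<in> W \<Longrightarrow> \<phi>'' v = \<phi> v \<or> \<phi>'' v = \<phi>' v"
    "(\<lambda>k. card {v \<in> W. \<phi>'' v = k}) =
      (\<lambda>k. card {v \<in> W. \<phi> v = k})(j := card {v \<in> W. \<phi> v = j} - 1, i := card {v \<in> W. \<phi> v = i} + 1)" by blast
  have "{v \<in> W. \<phi> v = j} \<noteq> {}" using j(1) by (metis card.empty not_less0)
  then have jn: "j < n" using \<phi>(1) by auto
  have "hypertree V es (f(j := f j - 1, i := f i + 1))"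
    unfolding hypertree_iff
  proof (intro exI[of _ \<phi>''] conjI ballI allI)
    fix v assume v: "v \<in> W"
    show "\<phi>'' v < n" "v \<in> es ! \<phi>'' v" using j(2)[OF v] \<phi>(1) \<phi>'(1) v by metis+
  next
    fix k
    show "(f(j := f j - 1, i := f i + 1)) k = (if k < n then card {v \<in> W. \<phi>'' v = k} else 0)"
      using fun_cong[OF j(3), of k] \<phi>(2) i jn by simp
  qed
  then show "\<exists>j<n. f' j < f j \<and> f(j := f j - 1, i := f i + 1) \<in> {f. hypertree V es f}"
    using jn j(1) \<phi>(2) \<phi>'(2) by (intro exI[of _ j]) simp
qed

text \<open>With \<open>j0\<close> placed first, weight can always be moved to \<open>j0\<close>, so a hyperedge is inactive
  exactly if it carries weight.\<close>

lemma inactive_first: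
  assumes f: "hypertree V es f" and j: "j < n"
  shows "inactive_wrt {f. hypertree V es f} n (\<lambda>j. if j = j0 then 0 else Suc j) f j \<longleftrightarrow> j \<noteq> j0 \<and> f j > 0"
proof -
  have "hypertree V es (f(j := f j - 1, j0 := f j0 + 1))" if "j \<noteq> j0" "f j > 0"
  proof -
    obtain \<phi> where \<phi>: "\<forall>v\<in>W. \<phi> v < n \<and> v \<in> es ! \<phi> v" "\<forall>j. f j = (if j < n then card {v \<in> W. \<phi> v = j} else 0)"
      using f by (auto simp: hypertree_iff)
    have "card {v \<in> W. \<phi> v = j} \<noteq> 0" using \<phi>(2) that(2) j by simp
    then have "{v \<in> W. \<phi> v = j} \<noteq> {}" by (metis card.empty)
    then obtain v where v: "v \<in> W" "\<phi> v = j" by blast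
    have c0: "{u \<in> W. (\<phi>(v := j0)) u = j0} = insert v {u \<in> W. \<phi> u = j0}"
      and cj: "{u \<in> W. (\<phi>(v := j0)) u = j} = {u \<in> W. \<phi> u = j} - {v}"
      and ck: "\<And>k. k \<noteq> j \<Longrightarrow> k \<noteq> j0 \<Longrightarrow> {u \<in> W. (\<phi>(v := j0)) u = k} = {u \<in> W. \<phi> u = k}"
      using v that by auto
    show ?thesis
      unfolding hypertree_iff
    proof (intro exI[of _ "\<phi>(v := j0)"] conjI ballI allI)
      fix u assume "u \<in> W"
      then show "(\<phi>(v := j0)) u < n" "u \<in> es ! ((\<phi>(v := j0)) u)" using \<phi>(1) j0 es_j0 by auto
    next
      fix k
      show "(f(j := f j - 1, j0 := f j0 + 1)) k = (if k < n then card {u \<in> W. (\<phi>(v := j0)) u = k} else 0)"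
      proof (cases "k = j0")
        case True
        have "card (insert v {u \<in> W. \<phi> u = j0}) = card {u \<in> W. \<phi> u = j0} + 1"
          using finW v that by simp
        then show ?thesis unfolding True c0 using \<phi>(2) j0 by simp
      next
        case k0: False
        show ?thesis
        proof (cases "k = j")
          case True
          have "card ({u \<in> W. \<phi> u = j} - {v}) = card {u \<in> W. \<phi> u = j} - 1"
            using v finW by (simp add: card_Diff_singleton_if)
          then show ?thesis unfolding True cj using \<phi>(2) j that by simp
        next
          case False
          then show ?thesis unfolding ck[OF False k0] using \<phi>(2) k0 by simp
        qed
      qed
    qed
  qed
  then show ?thesis using j0 by (auto simp: inactive_wrt_def)
qed

text \<open>A total function becomes partial by reading the value \<open>j0\<close> as
  \<open>None\<close>; the forgotten coordinate at \<open>j0\<close> is recovered from the constant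
  total \<open>card W\<close>.\<close>

theorem interior_polynomial_eq:
  "interior_polynomial V es =
    (\<Sum>p\<in>fiber_vectors ({..<n} - {j0}) W (\<lambda>j v. v \<in> es ! j). monom 1 (supp_card ({..<n} - {j0}) p))"
proof -
  interpret exchange_set "{f. hypertree V es f}" n "card W" by (rule hypertrees_exchange)
  let ?H = "{f. hypertree V es f}"
  let ?X = "{..<n} - {j0}"
  let ?\<sigma> = "\<lambda>j. if j = j0 then 0 else Suc j"
  \<comment> \<open>The order by index is the one of \<open>internally_inactive\<close>, where
    \<open>j' < j < n\<close> holds automatically.\<close>
  have "interior_polynomial V es = (\<Sum>f\<in>?H. monom 1 (card {j. j < n \<and> inactive_wrt ?H n (\<lambda>j. j) f j}))"
    unfolding interior_polynomial_def
    by (intro sum.cong refl arg_cong[where f = "monom 1"] arg_cong[where f = card])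
       (auto simp: inactive_wrt_def internally_inactive_def intro: less_trans)
  also have "\<dots> = (\<Sum>f\<in>?H. monom 1 (card {j. j < n \<and> inactive_wrt ?H n ?\<sigma> f j}))"
    by (rule inactive_order_independent) (auto simp: inj_on_def)
  also have "\<dots> = (\<Sum>f\<in>?H. monom 1 (card {j. j < n \<and> j \<noteq> j0 \<and> f j > 0}))"
    using inactive_first by (intro sum.cong refl arg_cong[where f = "monom 1"] arg_cong[where f = card]) auto
  also have "\<dots> = (\<Sum>p\<in>fiber_vectors ?X W (\<lambda>j v. v \<in> es ! j). monom 1 (supp_card ?X p))"
  proof (rule sum.reindex_bij_witness[where i = "\<lambda>p. p(j0 := card W - sum p ?X)" and j = "\<lambda>f. f(j0 := 0)"])
    fix f assume f: "f \<in> ?H"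
    have "sum f {..<n} = f j0 + sum f ?X" using j0 by (subst sum.remove[of _ j0]) auto
    moreover have "sum (f(j0 := 0)) ?X = sum f ?X" by (intro sum.cong) auto
    ultimately show "(f(j0 := 0))(j0 := card W - sum (f(j0 := 0)) ?X) = f"
      using total[OF f] by (auto simp: fun_eq_iff)
    obtain \<phi> where \<phi>: "\<forall>v\<in>W. \<phi> v < n \<and> v \<in> es ! \<phi> v" "\<forall>j. f j = (if j < n then card {v \<in> W. \<phi> v = j} else 0)"
      using f by (auto simp: hypertree_iff)
    define \<psi> where "\<psi> = (\<lambda>v. if \<phi> v = j0 then None else Some (\<phi> v))"
    have pf: "pfun ?X W (\<lambda>j v. v \<in> es ! j) \<psi>" using \<phi>(1) by (auto simp: pfun_def \<psi>_def split: if_splits)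
    moreover have "f(j0 := 0) = fiber_count W \<psi>"
    proof
      fix k
      show "(f(j0 := 0)) k = fiber_count W \<psi> k"
      proof (cases "k \<in> ?X")
        case True
        then have "{v \<in> W. \<psi> v = Some k} = {v \<in> W. \<phi> v = k}" by (auto simp: \<psi>_def)
        then show ?thesis using True \<phi>(2) by (simp add: fiber_count_def)
      next
        case False
        then show ?thesis using fiber_count_outside[OF pf False] \<phi>(2) by auto
      qed
    qed
    ultimately show "f(j0 := 0) \<in> fiber_vectors ?X W (\<lambda>j v. v \<in> es ! j)" by (auto simp: fiber_vectors_def)
    show "monom 1 (supp_card ?X (f(j0 := 0))) = monom (1 :: real) (card {j. j < n \<and> j \<noteq> j0 \<and> f j > 0})"
      unfolding supp_card_def by (intro arg_cong[where f = "monom 1"] arg_cong[where f = card]) auto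
  next
    fix p assume p: "p \<in> fiber_vectors ?X W (\<lambda>j v. v \<in> es ! j)"
    show "(p(j0 := card W - sum p ?X))(j0 := 0) = p"
      using fiber_vectors_outside[OF p, of j0] by auto
    obtain \<psi> where \<psi>: "pfun ?X W (\<lambda>j v. v \<in> es ! j) \<psi>" "p = fiber_count W \<psi>" using p by (auto simp: fiber_vectors_def)
    define \<phi> where "\<phi> = (\<lambda>v. case \<psi> v of None \<Rightarrow> j0 | Some j \<Rightarrow> j)"
    have ok: "\<phi> v < n \<and> v \<in> es ! \<phi> v" if "v \<in> W" for v
      using \<psi>(1) that j0 es_j0 by (cases "\<psi> v") (auto simp: pfun_def \<phi>_def)
    have cX: "card {v \<in> W. \<phi> v = k} = p k" if "k \<in> ?X" for k
      using that \<psi>(2) unfolding fiber_count_def \<phi>_def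
      by (auto intro!: arg_cong[where f = card] split: option.splits)
    have "{v \<in> W. \<phi> v = j0} = {v \<in> W. \<psi> v = None}"
      using \<psi>(1) by (auto simp: \<phi>_def pfun_def split: option.splits)
    then have c0: "card {v \<in> W. \<phi> v = j0} = card W - sum p ?X"
      using sum_fiber_count_eq[OF finW _ \<psi>(1)] \<psi>(2) by simp
    have "(p(j0 := card W - sum p ?X)) k = (if k < n then card {v \<in> W. \<phi> v = k} else 0)" for k
      using cX[of k] c0 j0 fiber_vectors_outside[OF p, of k] by auto
    then show "p(j0 := card W - sum p ?X) \<in> ?H" using ok by (auto simp: hypertree_iff)
  qed
  finally show ?thesis .
qed

end

section \<open>The polytopes of bipartite graphs\<close>

no_notation fps_nth (infixl "$" 75)

section \<open>Convex hulls closed under deleting coordinates\<close>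

definition zero_coord :: "'n \<Rightarrow> real ^ 'n \<Rightarrow> real ^ 'n" where
  "zero_coord i x = (\<chi> k. if k = i then 0 else x $ k)"

lemma zero_coord_nth [simp]: "zero_coord i x $ k = (if k = i then 0 else x $ k)"
  by (simp add: zero_coord_def)

lemma linear_zero_coord: "linear (zero_coord i)"
  by (rule linearI) (auto simp: vec_eq_iff)

lemma zero_coord_convex_hull:
  assumes "\<And>g. g \<in> G \<Longrightarrow> zero_coord i g \<in> G" "x \<in> convex hull G"
  shows "zero_coord i x \<in> convex hull G"
proof -
  have "zero_coord i x \<in> convex hull (zero_coord i ` G)"
    using assms(2) convex_hull_linear_image[OF linear_zero_coord, of i G] by blast
  moreover have "convex hull (zero_coord i ` G) \<subseteq> convex hull G"
    by (rule hull_mono) (use assms(1) in blast)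
  ultimately show ?thesis by blast
qed

lemma convex_mem_between:
  assumes K: "convex K" and a: "a \<in> K" "zero_coord i a \<in> K"
    and z: "\<And>k. k \<noteq> i \<Longrightarrow> z $ k = a $ k"
    and s: "0 \<le> s * z $ i" "s * z $ i \<le> s * a $ i" "s \<noteq> 0"
  shows "z \<in> K"
proof (cases "a $ i = 0")
  case True
  then have "s * z $ i = 0" using s by simp
  then have "z = a" using z True s(3) by (auto simp: vec_eq_iff) (metis)
  then show ?thesis using a by simp
next
  case False
  define \<theta> where "\<theta> = z $ i / a $ i"
  have pos: "0 < s * a $ i" using s False by (simp add: order_less_le)
  have \<theta>_eq: "\<theta> = (s * z $ i) / (s * a $ i)" using s(3) by (simp add: \<theta>_def)
  have \<theta>: "0 \<le> \<theta>" "\<theta> \<le> 1"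
    unfolding \<theta>_eq using s(1,2) pos by (auto simp only: divide_le_eq_1_pos divide_nonneg_pos)
  have "z = (1 - \<theta>) *\<^sub>R zero_coord i a + \<theta> *\<^sub>R a"
    using z False by (auto simp: vec_eq_iff \<theta>_def algebra_simps)
  then show ?thesis using convexD_alt[OF K a(2,1) \<theta>] by simp
qed

text \<open>Cutting by a coordinate hyperplane could create new vertices where segments cross it; a
  generating set closed under zeroing the coordinate already accounts for them.\<close>

lemma convex_hull_half:
  assumes G: "\<And>g. g \<in> G \<Longrightarrow> zero_coord i g \<in> G" and x: "x \<in> convex hull G" "0 \<le> s * x $ i" and s: "s \<noteq> (0::real)"
  shows "x \<in> convex hull {g \<in> G. 0 \<le> s * g $ i}"
proof -
  let ?K = "convex hull {g \<in> G. 0 \<le> s * g $ i}"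
  have K0: "zero_coord i y \<in> ?K" if "y \<in> ?K" for y
    by (rule zero_coord_convex_hull[OF _ that]) (use G in auto)
  \<comment> \<open>Carrying the zeroed point along makes the property convex. Points outside the
    half space are replaced by their zeroed versions; the combination wanted then lies between the
    new combination and its own zeroed version.\<close>
  define C where "C = {y. (0 \<le> s * y $ i \<longrightarrow> y \<in> ?K) \<and> zero_coord i y \<in> ?K}"
  have "G \<subseteq> C"
    using G by (auto simp: C_def intro: hull_inc)
  moreover have "convex C"
  proof (rule convexI)
    fix y z and u v :: real
    assume y: "y \<in> C" and z: "z \<in> C" and uv: "0 \<le> u" "0 \<le> v" "u + v = 1"
    have K: "u *\<^sub>R a + v *\<^sub>R b \<in> ?K" if "a \<in> ?K" "b \<in> ?K" for a b
      using that uv convex_convex_hull convexD by blast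
    have zc: "zero_coord i (u *\<^sub>R y + v *\<^sub>R z) = u *\<^sub>R zero_coord i y + v *\<^sub>R zero_coord i z"
      by (auto simp: vec_eq_iff)
    have zK: "zero_coord i (u *\<^sub>R y + v *\<^sub>R z) \<in> ?K"
      unfolding zc by (rule K) (use y z in \<open>auto simp: C_def\<close>)
    have "u *\<^sub>R y + v *\<^sub>R z \<in> ?K" if nn: "0 \<le> s * (u *\<^sub>R y + v *\<^sub>R z) $ i"
    proof -
      have nn': "0 \<le> u * (s * y $ i) + v * (s * z $ i)" using nn by (simp add: algebra_simps)
      let ?y = "if 0 \<le> s * y $ i then y else zero_coord i y"
      let ?z = "if 0 \<le> s * z $ i then z else zero_coord i z"
      let ?a = "u *\<^sub>R ?y + v *\<^sub>R ?z"
      have a: "?a \<in> ?K" by (rule K) (use y z in \<open>auto simp: C_def\<close>)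
      have "0 \<le> u * (s * y $ i)" if "0 \<le> s * y $ i" using that uv by simp
      moreover have "0 \<le> v * (s * z $ i)" if "0 \<le> s * z $ i" using that uv by simp
      moreover have "u * (s * y $ i) \<le> 0" if "\<not> 0 \<le> s * y $ i" using that uv by (simp add: mult_nonneg_nonpos)
      moreover have "v * (s * z $ i) \<le> 0" if "\<not> 0 \<le> s * z $ i" using that uv by (simp add: mult_nonneg_nonpos)
      ultimately have "s * (u *\<^sub>R y + v *\<^sub>R z) $ i \<le> s * ?a $ i"
        using nn' by (auto simp: algebra_simps)
      then show ?thesis
        by (intro convex_mem_between[OF convex_convex_hull a K0[OF a] _ nn _ s]) auto
    qed
    then show "u *\<^sub>R y + v *\<^sub>R z \<in> C" using zK by (simp add: C_def)
  qed
  ultimately have "convex hull G \<subseteq> C" by (rule hull_minimal)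
  then show ?thesis using x by (auto simp: C_def)
qed

lemma convex_hull_orthant:
  fixes s :: "'n::finite \<Rightarrow> real"
  assumes G: "\<And>g i. g \<in> G \<Longrightarrow> zero_coord i g \<in> G" and x: "x \<in> convex hull G"
    and s: "\<And>i. 0 \<le> s i * x $ i" "\<And>i. s i \<noteq> 0"
  shows "x \<in> convex hull {g \<in> G. \<forall>i. 0 \<le> s i * g $ i}"
proof -
  have "x \<in> convex hull {g \<in> G. \<forall>i\<in>I. 0 \<le> s i * g $ i}" if "finite I" for I
    using that
  proof (induction I rule: finite_induct)
    case empty then show ?case using x by simp
  next
    case (insert i I)
    have "x \<in> convex hull {g \<in> {g \<in> G. \<forall>i\<in>I. 0 \<le> s i * g $ i}. 0 \<le> s i * g $ i}"
      by (rule convex_hull_half[OF _ insert.IH s]) (use G in auto)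
    then show ?case by (rule rev_subsetD) (auto intro!: hull_mono)
  qed
  from this[of UNIV] show ?thesis by simp
qed

lemma convex_down_closed:
  fixes P :: "(real ^ 'n::finite) set"
  assumes P: "convex P" "\<And>g i. g \<in> P \<Longrightarrow> zero_coord i g \<in> P"
    and y: "y \<in> P" and x: "\<And>i. 0 \<le> x $ i \<and> x $ i \<le> y $ i"
  shows "x \<in> P"
proof -
  have "(\<chi> k. if k \<in> I then x $ k else y $ k) \<in> P" if "finite I" for I
    using that
  proof (induction I rule: finite_induct)
    case empty then show ?case using y by simp
  next
    case (insert i I)
    show ?case
      by (rule convex_mem_between[OF P(1) insert.IH P(2)[OF insert.IH], of i _ 1]) (use insert.hyps x in auto)
  qed
  from this[of UNIV] show ?thesis by simp
qed

section \<open>The anti-blocking polytope of a graph\<close>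

definition B_gens :: "'n set set \<Rightarrow> (real ^ 'n::finite) set" where
  "B_gens F = {0} \<union> {axis i 1 | i. True} \<union> {axis i 1 + axis j 1 | i j. {i, j} \<in> F}"

definition P_polytope :: "'n set set \<Rightarrow> (real ^ 'n::finite) set" where
  "P_polytope F = convex hull (B_gens F)"

lemma B_polytope_eq: "B_polytope F = symmetrization (P_polytope F)"
  by (simp add: B_polytope_def P_polytope_def B_gens_def)

lemma zero_axis: "zero_coord i (axis k a) = (if i = k then 0 else axis k a)"
  by (auto simp: vec_eq_iff axis_def)

lemma zero_coord_add: "zero_coord i (x + y) = zero_coord i x + zero_coord i y"
  by (auto simp: vec_eq_iff)

lemma zero_coord_0 [simp]: "zero_coord i 0 = 0" by (auto simp: vec_eq_iff)

lemma B_gensI: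
  "0 \<in> B_gens F" "axis i 1 \<in> B_gens F" "{i, j} \<in> F \<Longrightarrow> axis i 1 + axis j 1 \<in> B_gens F"
  unfolding B_gens_def by blast+

lemma B_gens_cases:
  assumes "g \<in> B_gens F"
  obtains "g = 0" | i where "g = axis i 1" | i j where "g = axis i 1 + axis j 1" "{i, j} \<in> F"
  using assms unfolding B_gens_def by blast

lemma B_gens_zero:
  assumes "g \<in> B_gens F"
  shows "zero_coord i g \<in> B_gens F"
  using assms
proof (cases rule: B_gens_cases)
  case (3 k l)
  have "zero_coord i g = (if i = k then 0 else axis k 1) + (if i = l then 0 else axis l 1)"
    unfolding 3 zero_coord_add zero_axis ..
  then show ?thesis by (cases "i = k"; cases "i = l") (simp_all add: B_gensI(1,2) B_gensI(3)[OF 3(2)])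
qed (auto simp: zero_axis intro: B_gensI)

lemma finite_B_gens:
  fixes F :: "'n::finite set set"
  shows "finite (B_gens F)"
proof -
  have "B_gens F \<subseteq> {0} \<union> range (\<lambda>i. axis i 1) \<union> (\<lambda>(i, j). axis i 1 + axis j 1) ` UNIV"
    by (auto simp: B_gens_def)
  then show ?thesis by (rule finite_subset) auto
qed

lemma B_gens_nonneg: "g \<in> B_gens F \<Longrightarrow> 0 \<le> g $ i"
  by (auto simp: B_gens_def axis_def)

lemma P_polytope_nonneg: "x \<in> P_polytope F \<Longrightarrow> 0 \<le> x $ i"
proof -
  have "P_polytope F \<subseteq> {x. 0 \<le> axis i 1 \<bullet> x}"
    unfolding P_polytope_def
  proof (rule hull_minimal)
    show "B_gens F \<subseteq> {x. 0 \<le> axis i 1 \<bullet> x}" by (auto simp: inner_axis' B_gens_nonneg)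
    show "convex {x. 0 \<le> axis i (1::real) \<bullet> x}" by (rule convex_halfspace_ge)
  qed
  then show "x \<in> P_polytope F \<Longrightarrow> 0 \<le> x $ i" by (auto simp: inner_axis')
qed

lemma P_polytope_down_closed:
  assumes "y \<in> P_polytope F" "\<And>i. 0 \<le> x $ i \<and> x $ i \<le> y $ i"
  shows "x \<in> P_polytope F"
  by (rule convex_down_closed[OF _ _ assms])
     (auto simp: P_polytope_def intro: zero_coord_convex_hull B_gens_zero)

lemma aff_dim_full:
  fixes S :: "(real ^ 'n::finite) set"
  assumes "0 \<in> S" "\<And>i. axis i 1 \<in> S"
  shows "aff_dim S = int CARD('n)"
proof -
  have "span S = UNIV"
  proof -
    have "Basis \<subseteq> S" using assms(2) by (auto simp: Basis_vec_def)
    then have "span Basis \<subseteq> span S" by (rule span_mono)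
    then show ?thesis by (metis span_Basis top.extremum_uniqueI)
  qed
  moreover have "affine hull S = span S" using assms(1) by (intro affine_hull_span_0 hull_inc)
  ultimately have "aff_dim S = int DIM(real ^ 'n)" unfolding aff_dim_eq_full by simp
  then show ?thesis by simp
qed

lemma B_gens_int: "B_gens F \<subseteq> int_lattice"
  by (auto simp: B_gens_def int_lattice_def axis_def)

lemma anti_blocking_P_polytope: "anti_blocking (P_polytope F)"
proof -
  have "aff_dim (P_polytope F) = int CARD('a)"
    by (rule aff_dim_full) (auto simp: P_polytope_def B_gens_def intro!: hull_inc)
  moreover have "lattice_polytope (P_polytope F)"
    unfolding lattice_polytope_def P_polytope_def using finite_B_gens B_gens_int by blast
  ultimately show ?thesis
    unfolding anti_blocking_def using P_polytope_nonneg P_polytope_down_closed by blast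
qed

definition absv :: "real ^ 'n \<Rightarrow> real ^ 'n" where
  "absv z = (\<chi> i. \<bar>z $ i\<bar>)"

lemma absv_nth [simp]: "absv z $ i = \<bar>z $ i\<bar>" by (simp add: absv_def)

lemma sign_abs: "\<epsilon> \<in> sign_vectors \<Longrightarrow> \<bar>\<epsilon> $ i\<bar> = 1"
  unfolding sign_vectors_def by (metis (mono_tags, lifting) abs_1 abs_minus_cancel mem_Collect_eq)

lemma mem_symmetrization:
  assumes "\<And>x i. x \<in> P \<Longrightarrow> 0 \<le> x $ i"
  shows "z \<in> symmetrization P \<longleftrightarrow> absv z \<in> P"
proof
  assume "z \<in> symmetrization P"
  then obtain \<epsilon> x where z: "z = (\<chi> i. \<epsilon> $ i * x $ i)" "\<epsilon> \<in> sign_vectors" "x \<in> P"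
    by (auto simp: symmetrization_def)
  have "absv z = x" using z assms by (auto simp: vec_eq_iff abs_mult sign_abs)
  then show "absv z \<in> P" using z by simp
next
  assume a: "absv z \<in> P"
  let ?e = "\<chi> i. if z $ i < 0 then - 1 else (1 :: real)"
  have "z = (\<chi> i. ?e $ i * absv z $ i)" by (auto simp: vec_eq_iff)
  moreover have "?e \<in> sign_vectors" by (auto simp: sign_vectors_def)
  ultimately show "z \<in> symmetrization P" using a unfolding symmetrization_def by blast
qed

lemma mem_B_polytope: "z \<in> B_polytope F \<longleftrightarrow> absv z \<in> P_polytope F"
  unfolding B_polytope_eq by (rule mem_symmetrization) (rule P_polytope_nonneg)

section \<open>Lattice points of dilates as transportable weights\<close>

definition vec_of :: "('n \<Rightarrow> nat) \<Rightarrow> real ^ 'n" where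
  "vec_of w = (\<chi> i. real (w i))"

lemma P_polytope_stable:
  assumes x: "x \<in> P_polytope F" and bip: "\<And>i j. {i, j} \<in> F \<Longrightarrow> \<not> (i \<in> A \<and> j \<in> A)"
  shows "(\<Sum>i\<in>A. x $ i) \<le> 1"
proof -
  have "P_polytope F \<subseteq> {x. (\<Sum>i\<in>A. axis i 1) \<bullet> x \<le> 1}"
    unfolding P_polytope_def
  proof (rule hull_minimal)
    show "B_gens F \<subseteq> {x. (\<Sum>i\<in>A. axis i 1) \<bullet> x \<le> 1}"
    proof
      fix g assume g: "g \<in> B_gens F"
      have e: "(\<Sum>i\<in>A. axis i 1) \<bullet> g = (\<Sum>i\<in>A. g $ i)" by (simp add: inner_sum_left inner_axis')
      have ax: "(\<Sum>k\<in>A. axis i (1::real) $ k) = (if i \<in> A then 1 else 0)" for i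
        by (simp add: axis_def)
      show "g \<in> {x. (\<Sum>i\<in>A. axis i 1) \<bullet> x \<le> 1}"
        unfolding mem_Collect_eq e using g bip by (cases rule: B_gens_cases) (auto simp: ax sum.distrib)
    qed
  qed (rule convex_halfspace_le)
  then show ?thesis using x by (auto simp: inner_sum_left inner_axis')
qed

text \<open>Stable set inequalities are valid for the polytope. Conversely, each of the
  \<open>m\<close> units given by Hall's theorem is a generator (an edge, a unit vector or 0), and
  \<open>w / m\<close> is their average.\<close>

lemma vec_of_mem_iff_transportable:
  fixes F :: "'n::finite set set"
  assumes bip: "\<And>i j. {i, j} \<in> F \<Longrightarrow> (i \<in> S) \<noteq> (j \<in> S)" and m: "m > 0"
  shows "vec_of w \<in> (\<lambda>x. real m *\<^sub>R x) ` P_polytope F \<longleftrightarrow>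
    transportable S (- S) (\<lambda>i j. {i, j} \<in> F) m (\<lambda>i. if i \<in> S then w i else 0) (\<lambda>i. if i \<in> S then 0 else w i)"
    (is "_ \<longleftrightarrow> transportable S _ ?R m ?p ?q")
proof
  assume "vec_of w \<in> (\<lambda>x. real m *\<^sub>R x) ` P_polytope F"
  then obtain u where u: "u \<in> P_polytope F" "vec_of w = real m *\<^sub>R u" by blast
  show "transportable S (- S) ?R m ?p ?q"
    unfolding transportable_def
  proof (intro allI impI)
    fix A B assume AB: "A \<subseteq> S" "B \<subseteq> - S" "\<forall>x\<in>A. \<forall>y\<in>B. {x, y} \<notin> F"
    have "(\<Sum>i\<in>A \<union> B. u $ i) \<le> 1"
    proof (rule P_polytope_stable[OF u(1)])
      fix i j assume ij: "{i, j} \<in> F"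
      show "\<not> (i \<in> A \<union> B \<and> j \<in> A \<union> B)" using bip[OF ij] AB ij by (auto simp: insert_commute)
    qed
    then have "real m * (\<Sum>i\<in>A \<union> B. u $ i) \<le> real m * 1" by (intro mult_left_mono) auto
    moreover have "real m * (\<Sum>i\<in>A \<union> B. u $ i) = (\<Sum>i\<in>A \<union> B. real (w i))"
    proof -
      have "real (w i) = real m * u $ i" for i using arg_cong[OF u(2), of "\<lambda>v. v $ i"] by (simp add: vec_of_def)
      then show ?thesis by (simp add: sum_distrib_left)
    qed
    moreover have "(\<Sum>i\<in>A \<union> B. w i) = sum ?p A + sum ?q B"
    proof -
      have "(\<Sum>i\<in>A \<union> B. w i) = sum w A + sum w B" using AB by (intro sum.union_disjoint) auto
      moreover have "sum ?p A = sum w A" "sum ?q B = sum w B" using AB by (auto intro!: sum.cong)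
      ultimately show ?thesis by simp
    qed
    then have "real (sum ?p A + sum ?q B) = (\<Sum>i\<in>A \<union> B. real (w i))" by (metis of_nat_sum)
    ultimately have "real (sum ?p A + sum ?q B) \<le> real m" by simp
    then show "sum ?p A + sum ?q B \<le> m" by (simp only: of_nat_le_iff)
  qed
next
  assume f: "transportable S (- S) ?R m ?p ?q"
  have p: "\<And>x. x \<notin> S \<Longrightarrow> ?p x = 0" by simp
  let ?B = "blow_up (- S) (case_option (m - sum ?q (- S)) ?q)"
  have qm: "sum ?q (- S) \<le> m" and pB: "?p \<in> fiber_vectors S ?B (blow_up_rel ?R)"
    using transportable_iff[of S "- S" ?p ?R m ?q, OF _ _ p] f by auto
  obtain \<phi> where \<phi>: "pfun S ?B (blow_up_rel ?R) \<phi>" "fiber_count ?B \<phi> = ?p" using pB by (auto simp: fiber_vectors_def)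
  define ax where "ax = (\<lambda>i. (case i of None \<Rightarrow> 0 | Some y \<Rightarrow> axis y (1::real)) :: real ^ 'n)"
  have cardB: "card ?B = m" using qm by (simp add: card_blow_up)
  have gen: "ax (fst j) + ax (\<phi> j) \<in> P_polytope F" if j: "j \<in> ?B" for j
  proof -
    have "ax (fst j) + ax (\<phi> j) \<in> B_gens F"
    proof (cases "fst j")
      case None
      then show ?thesis by (cases "\<phi> j") (auto simp: ax_def intro: B_gensI)
    next
      case (Some y)
      have "{y, x} \<in> F" if "\<phi> j = Some x" for x
      proof -
        have "blow_up_rel ?R x j" using \<phi>(1)[unfolded pfun_def, rule_format, OF j that] by blast
        then have "{x, y} \<in> F" using Some by (simp add: blow_up_rel_def)
        then show ?thesis by (simp only: insert_commute)
      qed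
      then show ?thesis using Some by (cases "\<phi> j") (simp_all add: ax_def B_gensI)
    qed
    then show ?thesis unfolding P_polytope_def by (rule hull_inc)
  qed
  have "(\<Sum>j\<in>?B. (1 / real m) *\<^sub>R (ax (fst j) + ax (\<phi> j))) \<in> P_polytope F"
    by (rule convex_sum) (use gen m cardB in \<open>auto simp: P_polytope_def finite_blow_up\<close>)
  moreover have "vec_of w = real m *\<^sub>R (\<Sum>j\<in>?B. (1 / real m) *\<^sub>R (ax (fst j) + ax (\<phi> j)))"
  proof (rule vec_eq_iff[THEN iffD2], rule allI)
    fix i
    have axi: "ax l $ i = (if l = Some i then 1 else 0)" for l
      by (auto simp: ax_def axis_def split: option.splits)
    have fin: "finite ?B" by (simp add: finite_blow_up)
    have c1: "(\<Sum>j\<in>?B. ax (fst j) $ i) = real (?q i)"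
    proof -
      have "(\<Sum>j\<in>?B. ax (fst j) $ i) = real (card {j \<in> ?B. fst j = Some i})"
        unfolding axi using fin by (simp add: sum.If_cases Int_def)
      also have "{j \<in> ?B. fst j = Some i} = (if i \<in> S then {} else Pair (Some i) ` {..<w i})"
        by (auto simp: blow_up_def)
      also have "card \<dots> = ?q i" by (auto simp: card_image inj_on_def)
      finally show ?thesis .
    qed
    have c2: "(\<Sum>j\<in>?B. ax (\<phi> j) $ i) = real (?p i)"
    proof -
      have "(\<Sum>j\<in>?B. ax (\<phi> j) $ i) = real (card {j \<in> ?B. \<phi> j = Some i})"
        unfolding axi using fin by (simp add: sum.If_cases Int_def)
      also have "\<dots> = real (?p i)" using fun_cong[OF \<phi>(2), of i] by (simp add: fiber_count_def)
      finally show ?thesis .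
    qed
    have "(real m *\<^sub>R (\<Sum>j\<in>?B. (1 / real m) *\<^sub>R (ax (fst j) + ax (\<phi> j)))) $ i
       = (\<Sum>j\<in>?B. ax (fst j) $ i) + (\<Sum>j\<in>?B. ax (\<phi> j) $ i)"
      using m by (simp add: sum_distrib_left sum.distrib add_divide_distrib distrib_left)
    then show "vec_of w $ i = (real m *\<^sub>R (\<Sum>j\<in>?B. (1 / real m) *\<^sub>R (ax (fst j) + ax (\<phi> j)))) $ i"
      unfolding c1 c2 by (simp add: vec_of_def)
  qed
  ultimately show "vec_of w \<in> (\<lambda>x. real m *\<^sub>R x) ` P_polytope F" by blast
qed


text \<open>The parameter is 2 because each nonzero coordinate of a lattice point can take two
  signs.\<close>

lemma ehrhart_B_polytope:
  fixes F :: "'n::finite set set"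
  assumes bip: "\<And>i j. {i, j} \<in> F \<Longrightarrow> (i \<in> S) \<noteq> (j \<in> S)"
  shows "ehrhart_series (B_polytope F) = transport_series 2 S (- S) (\<lambda>i j. {i, j} \<in> F)"
proof (rule fps_ext)
  fix m
  let ?R = "\<lambda>i j. {i, j} \<in> F"
  let ?P = "{(p, q). (\<forall>x. x \<notin> S \<longrightarrow> p x = 0) \<and> (\<forall>y. y \<notin> - S \<longrightarrow> q y = 0) \<and> transportable S (- S) ?R m p q}"
  let ?s = "\<lambda>w i. if i \<in> S then w i else (0::nat)" and ?t = "\<lambda>w i. if i \<in> S then 0 else w i :: nat"
  show "fps_nth (ehrhart_series (B_polytope F)) m = fps_nth (transport_series 2 S (- S) ?R) m"
  proof (cases "m = 0")
    case True
    have "?P = {(\<lambda>_. 0, \<lambda>_. 0)}"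
    proof (intro equalityI subsetI)
      fix a assume "a \<in> ?P"
      then obtain p q where a: "a = (p, q)" "\<And>x. x \<notin> S \<Longrightarrow> p x = 0" "\<And>x. x \<in> S \<Longrightarrow> q x = 0"
        and f: "transportable S (- S) ?R 0 p q" using True by auto
      have "p x = 0" for x using a(2)[of x] f[unfolded transportable_def, rule_format, of "{x}" "{}"] by auto
      moreover have "q x = 0" for x using a(3)[of x] f[unfolded transportable_def, rule_format, of "{}" "{x}"] by auto
      ultimately show "a \<in> {(\<lambda>_. 0, \<lambda>_. 0)}" using a(1) by auto
    qed (auto simp: transportable_def)
    then show ?thesis using True by (simp add: transport_series_def ehrhart_series_def supp_wt_def)
  next
    case False
    then have m: "m > 0" by simp
    let ?N = "{w. transportable S (- S) ?R m (?s w) (?t w)}"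
    have bij: "bij_betw (\<lambda>w. (?s w, ?t w)) ?N ?P"
    proof (rule bij_betw_byWitness[where f' = "\<lambda>(p, q) i. p i + q i"])
      have inv: "?s (\<lambda>i. p i + q i) = p" "?t (\<lambda>i. p i + q i) = q" if "(p, q) \<in> ?P" for p q
        using that by (auto simp: fun_eq_iff)
      show "\<forall>w\<in>?N. (\<lambda>(p, q) i. p i + q i) (?s w, ?t w) = w" by (auto simp: fun_eq_iff)
      show "\<forall>a\<in>?P. (\<lambda>w. (?s w, ?t w)) ((\<lambda>(p, q) i. p i + q i) a) = a"
      proof
        fix a assume a: "a \<in> ?P"
        obtain p q where ap: "a = (p, q)" by (cases a)
        show "(\<lambda>w. (?s w, ?t w)) ((\<lambda>(p, q) i. p i + q i) a) = a"
          unfolding ap prod.case using inv[of p q] a ap by simp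
      qed
      show "(\<lambda>w. (?s w, ?t w)) ` ?N \<subseteq> ?P" by auto
      show "(\<lambda>(p, q) i. p i + q i) ` ?P \<subseteq> ?N"
      proof
        fix w assume "w \<in> (\<lambda>(p, q) i. p i + q i) ` ?P"
        then obtain a where a: "a \<in> ?P" "w = (\<lambda>(p, q) i. p i + q i) a" by (elim imageE)
        obtain p q where ap: "a = (p, q)" by (cases a)
        have pq: "(p, q) \<in> ?P" "w = (\<lambda>i. p i + q i)" using a unfolding ap by simp_all
        have "transportable S (- S) ?R m p q" using pq(1) by simp
        then show "w \<in> ?N" unfolding mem_Collect_eq pq(2) inv[OF pq(1)] .
      qed
    qed
    have "w i \<le> m" if "w \<in> ?N" for w i
    proof -
      have f: "transportable S (- S) ?R m (?s w) (?t w)" using that by simp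
      show ?thesis
        using f[unfolded transportable_def, rule_format, of "{i}" "{}"] f[unfolded transportable_def, rule_format, of "{}" "{i}"]
        by (cases "i \<in> S") auto
    qed
    then have "?N \<subseteq> {w. \<forall>i. (i \<in> UNIV \<longrightarrow> w i \<in> {..m}) \<and> (i \<notin> UNIV \<longrightarrow> w i = 0)}" by auto
    then have finN: "finite ?N" by (rule finite_subset) (rule finite_set_of_finite_funs, auto)
    let ?L = "(\<lambda>x. real m *\<^sub>R x) ` B_polytope F \<inter> int_lattice"
    have mem: "z \<in> ?L \<longleftrightarrow> (\<exists>w\<in>?N. absv z = vec_of w)" for z
    proof -
      have h1: "z \<in> (\<lambda>x. real m *\<^sub>R x) ` B_polytope F \<longleftrightarrow> absv z \<in> (\<lambda>x. real m *\<^sub>R x) ` P_polytope F"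
      proof -
        have "z \<in> (\<lambda>x. real m *\<^sub>R x) ` K \<longleftrightarrow> (1 / real m) *\<^sub>R z \<in> K" for K :: "(real ^ 'n) set" and z
          using m by (force simp: image_iff intro!: bexI[of _ "(1 / real m) *\<^sub>R z"])
        moreover have "absv ((1 / real m) *\<^sub>R z) = (1 / real m) *\<^sub>R absv z"
          by (auto simp: vec_eq_iff abs_mult)
        ultimately show ?thesis by (simp only: mem_B_polytope)
      qed
      have h2: "z \<in> int_lattice \<longleftrightarrow> (\<exists>w. absv z = vec_of w)"
      proof
        assume z: "z \<in> int_lattice"
        have "\<exists>k. \<bar>z $ i\<bar> = real k" for i
        proof -
          have "z $ i \<in> \<int>" using z by (simp add: int_lattice_def)
          then obtain a where a: "z $ i = real_of_int a" by (auto elim: Ints_cases)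
          then show ?thesis by (intro exI[of _ "nat \<bar>a\<bar>"]) simp
        qed
        then obtain w where "\<And>i. \<bar>z $ i\<bar> = real (w i)" by metis
        then show "\<exists>w. absv z = vec_of w" by (auto simp: vec_eq_iff vec_of_def)
      next
        assume "\<exists>w. absv z = vec_of w"
        then obtain w where w: "\<And>i. \<bar>z $ i\<bar> = real (w i)" by (auto simp: vec_eq_iff vec_of_def)
        have "z $ i \<in> \<int>" for i
        proof -
          have "z $ i = real (w i) \<or> z $ i = - real (w i)" using w[of i] by linarith
          then show ?thesis by (metis Ints_minus Ints_of_nat)
        qed
        then show "z \<in> int_lattice" by (simp add: int_lattice_def)
      qed
      have h3: "vec_of w \<in> (\<lambda>x. real m *\<^sub>R x) ` P_polytope F \<longleftrightarrow> w \<in> ?N" for w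
        unfolding mem_Collect_eq by (rule vec_of_mem_iff_transportable[OF _ m]) (rule bip)
      have *: "(u \<in> M \<and> (\<exists>w. u = vec_of w)) \<longleftrightarrow> (\<exists>w\<in>N. u = vec_of w)"
        if "\<And>w. vec_of w \<in> M \<longleftrightarrow> w \<in> N" for M N and u :: "real ^ 'n"
        using that by auto
      show ?thesis unfolding Int_iff h1 h2 by (rule *) (rule h3)
    qed
    have fiber: "card {z :: real ^ 'n. absv z = vec_of w} = (\<Prod>i\<in>UNIV. card {real (w i), - real (w i)})" for w :: "'n \<Rightarrow> nat"
    proof -
      have ai: "\<bar>a\<bar> = real n \<longleftrightarrow> a = real n \<or> a = - real n" for a :: real and n by linarith
      have "bij_betw (\<lambda>z. \<lambda>i\<in>UNIV. z $ i) {z :: real ^ 'n. absv z = vec_of w} (PiE UNIV (\<lambda>i. {real (w i), - real (w i)}))"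
        by (rule bij_betw_byWitness[where f' = "\<lambda>f. \<chi> i. f i"])
           (auto simp: vec_eq_iff vec_of_def PiE_iff ai)
      from bij_betw_same_card[OF this] show ?thesis by (simp add: card_PiE)
    qed
    have "finite {z :: real ^ 'n. absv z = vec_of w}" for w :: "'n \<Rightarrow> nat"
    proof (rule card_ge_0_finite)
      show "card {z :: real ^ 'n. absv z = vec_of w} > 0" unfolding fiber by (intro prod_pos) (auto simp: card_gt_0_iff)
    qed
    moreover have "?L = (\<Union>w\<in>?N. {z. absv z = vec_of w})" using mem by blast
    moreover have "{z. absv z = vec_of w} \<inter> {z. absv z = vec_of w'} = {}" if "w \<noteq> w'" for w w' :: "'n \<Rightarrow> nat"
      using that by (auto simp: vec_of_def vec_eq_iff fun_eq_iff)
    ultimately have "card ?L = (\<Sum>w\<in>?N. card {z :: real ^ 'n. absv z = vec_of w})"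
      using finN by (simp add: card_UN_disjoint)
    also have "real \<dots> = (\<Sum>w\<in>?N. \<Prod>i\<in>UNIV. supp_wt 2 (w i))"
      unfolding fiber of_nat_sum of_nat_prod
      by (intro sum.cong prod.cong refl) (auto simp: supp_wt_def card_insert_if)
    also have "\<dots> = (\<Sum>w\<in>?N. (\<Prod>x\<in>S. supp_wt 2 (?s w x)) * (\<Prod>y\<in>- S. supp_wt 2 (?t w y)))"
    proof (rule sum.cong[OF refl])
      fix w
      have "(\<Prod>i\<in>UNIV. supp_wt 2 (w i)) = (\<Prod>i\<in>S \<union> - S. supp_wt 2 (w i))" by simp
      also have "\<dots> = (\<Prod>i\<in>S. supp_wt 2 (w i)) * (\<Prod>i\<in>- S. supp_wt 2 (w i))"
        by (rule prod.union_disjoint) auto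
      also have "(\<Prod>i\<in>S. supp_wt 2 (w i)) = (\<Prod>x\<in>S. supp_wt 2 (?s w x))" by (intro prod.cong) auto
      also have "(\<Prod>i\<in>- S. supp_wt 2 (w i)) = (\<Prod>y\<in>- S. supp_wt 2 (?t w y))" by (intro prod.cong) auto
      finally show "(\<Prod>i\<in>UNIV. supp_wt 2 (w i)) = (\<Prod>x\<in>S. supp_wt 2 (?s w x)) * (\<Prod>y\<in>- S. supp_wt 2 (?t w y))" .
    qed
    also have "\<dots> = fps_nth (transport_series 2 S (- S) ?R) m"
      unfolding transport_series_def fps_nth_Abs_fps
      by (subst sum.reindex_bij_betw[OF bij, symmetric]) simp
    finally show ?thesis using m by (simp add: ehrhart_series_def)
  qed
qed

section \<open>From the Ehrhart series to its numerator\<close>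

lemma h_star_eqI:
  assumes "ehrhart_series Q * (1 - fps_X) ^ Suc d = fps_of_poly h" "aff_dim Q = int d"
  shows "h_star Q = h"
proof -
  have unit: "fps_nth ((1 - fps_X :: real fps) ^ Suc d) 0 \<noteq> 0" by (simp add: fps_power_zeroth)
  have eq: "ehrhart_series Q = fps_of_poly g / (1 - fps_X) ^ Suc d \<longleftrightarrow> g = h" for g
  proof
    assume "ehrhart_series Q = fps_of_poly g / (1 - fps_X) ^ Suc d"
    then have "ehrhart_series Q * (1 - fps_X) ^ Suc d = fps_of_poly g"
      using unit by (simp add: fps_divide_unit mult.assoc inverse_mult_eq_1 del: power_Suc)
    then show "g = h" using assms(1) by simp
  next
    assume g: "g = h"
    have "fps_of_poly h / (1 - fps_X) ^ Suc d = ehrhart_series Q * ((1 - fps_X) ^ Suc d * inverse ((1 - fps_X) ^ Suc d))"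
      unfolding assms(1)[symmetric] fps_divide_unit[OF unit] by (simp only: mult.assoc)
    then show "ehrhart_series Q = fps_of_poly g / (1 - fps_X) ^ Suc d"
      using inverse_mult_eq_1'[OF unit] g by (simp del: power_Suc)
  qed
  have "nat (aff_dim Q) + 1 = Suc d" using assms(2) by simp
  then show ?thesis unfolding h_star_def using eq by (simp del: power_Suc)
qed

text \<open>For \<open>f\<close> of degree at most \<open>d / 2\<close> this is
  \<open>(x + 1)^d f(4 x / (x + 1)^2)\<close> with the denominators cleared.\<close>

definition gamma_poly :: "nat \<Rightarrow> real poly \<Rightarrow> real poly" where
  "gamma_poly d f = (\<Sum>k\<le>d div 2. smult (coeff f k) ([:0, 4:] ^ k * [:1, 1:] ^ (d - 2 * k)))"

lemma gamma_poly_add: "gamma_poly d (f + g) = gamma_poly d f + gamma_poly d g"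
  by (simp add: gamma_poly_def smult_add_left sum.distrib)

lemma smult_sum_right: "smult c (sum f A) = (\<Sum>a\<in>A. smult c (f a))"
  by (induction A rule: infinite_finite_induct) (auto simp: smult_add_right)

lemma gamma_poly_smult: "gamma_poly d (smult c f) = smult c (gamma_poly d f)"
  by (simp add: gamma_poly_def smult_sum_right) 

lemma gamma_poly_0: "gamma_poly d 0 = 0"
  by (simp add: gamma_poly_def)

lemma gamma_poly_sum: "gamma_poly d (sum f A) = (\<Sum>a\<in>A. gamma_poly d (f a))"
  by (induction A rule: infinite_finite_induct) (auto simp: gamma_poly_0 gamma_poly_add)

lemma gamma_poly_monom:
  assumes "2 * k \<le> d"
  shows "gamma_poly d (monom 1 k) = [:0, 4:] ^ k * [:1, 1:] ^ (d - 2 * k)"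
proof -
  have "gamma_poly d (monom 1 k) = (\<Sum>i\<le>d div 2. if i = k then [:0, 4:] ^ k * [:1, 1:] ^ (d - 2 * k) else 0)"
    unfolding gamma_poly_def by (intro sum.cong) auto
  then show ?thesis using assms by simp
qed

lemma supp_card_bound:
  assumes "finite X" "finite Y" "h \<in> fiber_vectors Y X R"
  shows "2 * supp_card Y h \<le> card X + card Y"
  using supp_card_le_card[OF assms(2), of h] supp_card_le_sum[OF assms(2), of h] sum_fiber_count_le[OF assms] by linarith

definition fiber_poly :: "'a set \<Rightarrow> 'b set \<Rightarrow> ('a \<Rightarrow> 'b \<Rightarrow> bool) \<Rightarrow> real poly" where
  "fiber_poly X Y R = (\<Sum>p\<in>fiber_vectors X Y R. monom 1 (supp_card X p))"

lemma fiber_poly_swap: "finite X \<Longrightarrow> finite Y \<Longrightarrow> fiber_poly X Y R = fiber_poly Y X (\<lambda>y x. R x y)"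
  unfolding fiber_poly_def by (rule sum_supp_card_swap)

lemma B_polytope_series:
  fixes F :: "'n::finite set set"
  assumes bip: "\<And>i j. {i, j} \<in> F \<Longrightarrow> (i \<in> S) \<noteq> (j \<in> S)"
  shows "ehrhart_series (B_polytope F) * (1 - fps_X) ^ Suc CARD('n) =
    fps_of_poly (gamma_poly CARD('n) (fiber_poly S (- S) (\<lambda>i j. {i, j} \<in> F)))"
proof -
  have e: "ehrhart_series (B_polytope F) = transport_series 2 S (- S) (\<lambda>i j. {i, j} \<in> F)"
    by (rule ehrhart_B_polytope) (rule bip)
  \<comment> \<open>The closed form of the series lives on the side \<open>- S\<close>; duality
    brings it back to \<open>S\<close>.\<close>
  have sw: "fiber_poly S (- S) (\<lambda>i j. {i, j} \<in> F) = fiber_poly (- S) S (\<lambda>j i. {i, j} \<in> F)"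
    by (rule fiber_poly_swap) auto
  have c: "card S + card (- S) = CARD('n)"
    by (simp add: card_Un_disjoint[symmetric])
  have g: "fps_of_poly (gamma_poly CARD('n) (monom 1 (supp_card (- S) h))) =
     (fps_const (2\<^sup>2) * fps_X) ^ supp_card (- S) h * (1 + fps_const (2 - 1) * fps_X) ^ (CARD('n) - 2 * supp_card (- S) h)"
    if "h \<in> fiber_vectors (- S) S (\<lambda>y x. {x, y} \<in> F)" for h
  proof -
    have "2 * supp_card (- S) h \<le> CARD('n)" using supp_card_bound[OF _ _ that] c by simp
    moreover have "fps_of_poly [:0, 4 :: real:] = fps_const (2\<^sup>2) * fps_X"
      and "fps_of_poly [:1, 1 :: real:] = 1 + fps_const (2 - 1) * fps_X"
      by (simp_all add: fps_of_poly_pCons mult.commute)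
    ultimately show ?thesis by (simp add: gamma_poly_monom fps_of_poly_mult fps_of_poly_power)
  qed
  have "ehrhart_series (B_polytope F) * (1 - fps_X) ^ Suc CARD('n) =
    (\<Sum>h\<in>fiber_vectors (- S) S (\<lambda>y x. {x, y} \<in> F). (fps_const (2\<^sup>2) * fps_X) ^ supp_card (- S) h *
      (1 + fps_const (2 - 1) * fps_X) ^ (CARD('n) - 2 * supp_card (- S) h))"
    unfolding e c[symmetric] by (rule transport_series_eq) auto
  also have "\<dots> = (\<Sum>h\<in>fiber_vectors (- S) S (\<lambda>y x. {x, y} \<in> F). fps_of_poly (gamma_poly CARD('n) (monom 1 (supp_card (- S) h))))"
    by (rule sum.cong[OF refl]) (rule g[symmetric])
  also have "\<dots> = fps_of_poly (gamma_poly CARD('n) (fiber_poly (- S) S (\<lambda>j i. {i, j} \<in> F)))"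
    unfolding fiber_poly_def gamma_poly_sum fps_of_poly_sum ..
  finally show ?thesis unfolding sw .
qed

lemma aff_dim_B_polytope: "aff_dim (B_polytope F) = int CARD('n)" for F :: "'n::finite set set"
proof (rule aff_dim_full)
  have a: "absv (axis i 1) = axis i 1" "absv 0 = 0" for i :: 'n by (auto simp: vec_eq_iff axis_def)
  show "0 \<in> B_polytope F" "\<And>i. axis i 1 \<in> B_polytope F"
    unfolding mem_B_polytope a P_polytope_def by (auto intro!: hull_inc B_gensI)
qed

lemma h_star_B_polytope:
  fixes F :: "'n::finite set set"
  assumes bip: "\<And>i j. {i, j} \<in> F \<Longrightarrow> (i \<in> S) \<noteq> (j \<in> S)"
  shows "h_star (B_polytope F) = gamma_poly CARD('n) (fiber_poly S (- S) (\<lambda>i j. {i, j} \<in> F))"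
  by (rule h_star_eqI[OF B_polytope_series aff_dim_B_polytope]) (rule bip)

section \<open>The polytope of the suspension\<close>

text \<open>The generators after forgetting the apex, whose edges give the signed unit vectors. The
  origin is included to make the set closed under zeroing a coordinate.\<close>

definition Q_gens :: "'n set set \<Rightarrow> (real ^ 'n::finite) set" where
  "Q_gens E = {0} \<union> {axis i 1 | i. True} \<union> {- axis i 1 | i. True} \<union> {axis i 1 - axis j 1 | i j. {i, j} \<in> E}"

definition Q_polytope :: "'n set set \<Rightarrow> (real ^ 'n::finite) set" where
  "Q_polytope E = convex hull (Q_gens E)"

lemma Q_gensI:
  "0 \<in> Q_gens E" "axis i 1 \<in> Q_gens E" "- axis i 1 \<in> Q_gens E" "{i, j} \<in> E \<Longrightarrow> axis i 1 - axis j 1 \<in> Q_gens E"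
  unfolding Q_gens_def by blast+

lemma Q_gens_cases:
  assumes "g \<in> Q_gens E"
  obtains "g = 0" | i where "g = axis i 1" | i where "g = - axis i 1"
    | i j where "g = axis i 1 - axis j 1" "{i, j} \<in> E"
  using assms unfolding Q_gens_def by blast

lemma finite_Q_gens:
  fixes E :: "'n::finite set set"
  shows "finite (Q_gens E)"
proof -
  have "Q_gens E \<subseteq> {0} \<union> range (\<lambda>i. axis i 1) \<union> range (\<lambda>i. - axis i 1) \<union> (\<lambda>(i, j). axis i 1 - axis j 1) ` UNIV"
    by (auto simp: Q_gens_def)
  then show ?thesis by (rule finite_subset) auto
qed

lemma Q_gens_int: "Q_gens E \<subseteq> int_lattice"
  by (auto simp: Q_gens_def int_lattice_def axis_def)

lemma Q_gens_zero:
  assumes "g \<in> Q_gens E"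
  shows "zero_coord i g \<in> Q_gens E"
proof -
  have neg: "zero_coord i (- x) = - zero_coord i x" for x :: "real ^ 'a" by (auto simp: vec_eq_iff)
  have diff: "zero_coord i (x - y) = zero_coord i x - zero_coord i y" for x y :: "real ^ 'a"
    by (auto simp: vec_eq_iff)
  from assms show ?thesis
  proof (cases rule: Q_gens_cases)
    case (4 k l)
    have "zero_coord i g = (if i = k then 0 else axis k 1) - (if i = l then 0 else axis l 1)"
      unfolding 4 diff zero_axis ..
    then show ?thesis by (cases "i = k"; cases "i = l") (simp_all add: Q_gensI(1,2,3) Q_gensI(4)[OF 4(2)])
  qed (auto simp: zero_axis neg intro: Q_gensI)
qed

definition flip :: "real ^ 'n \<Rightarrow> real ^ 'n \<Rightarrow> real ^ 'n" where
  "flip \<epsilon> x = (\<chi> i. \<epsilon> $ i * x $ i)"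

lemma flip_nth [simp]: "flip \<epsilon> x $ i = \<epsilon> $ i * x $ i" by (simp add: flip_def)

lemma linear_flip: "linear (flip \<epsilon>)"
  by (rule linearI) (auto simp: vec_eq_iff algebra_simps)

lemma sign_cases: "\<epsilon> \<in> sign_vectors \<Longrightarrow> \<epsilon> $ i = 1 \<or> \<epsilon> $ i = - 1"
  by (auto simp: sign_vectors_def)

lemma flip_flip: "\<epsilon> \<in> sign_vectors \<Longrightarrow> flip \<epsilon> (flip \<epsilon> x) = x"
  using sign_cases[of \<epsilon>] by (auto simp: vec_eq_iff) (metis mult_1 mult_minus1 minus_minus)

definition pos_set :: "real ^ 'n \<Rightarrow> 'n set" where
  "pos_set \<epsilon> = {i. \<epsilon> $ i = 1}"

lemma flip_axis: "flip \<epsilon> (axis i a) = (\<epsilon> $ i) *\<^sub>R axis i a"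
  by (auto simp: vec_eq_iff axis_def)

lemma flip_add: "flip \<epsilon> (x + y) = flip \<epsilon> x + flip \<epsilon> y" "flip \<epsilon> (x - y) = flip \<epsilon> x - flip \<epsilon> y"
  "flip \<epsilon> (- x) = - flip \<epsilon> x" "flip \<epsilon> 0 = 0"
  by (auto simp: vec_eq_iff algebra_simps)

lemma mem_cut_graph:
  assumes "{i} \<notin> E"
  shows "{i, j} \<in> cut_graph E S \<longleftrightarrow> {i, j} \<in> E \<and> (i \<in> S) \<noteq> (j \<in> S)"
proof (cases "i = j")
  case True
  then show ?thesis using assms by (simp add: cut_graph_def)
next
  case False
  have "{i, j} \<inter> S = (if i \<in> S then {i} else {}) \<union> (if j \<in> S then {j} else {})" by auto
  then have "card ({i, j} \<inter> S) = 1 \<longleftrightarrow> (i \<in> S) \<noteq> (j \<in> S)" using False by auto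
  then show ?thesis unfolding cut_graph_def by blast
qed

lemma flip_nonneg: "x \<in> orthant \<epsilon> \<longleftrightarrow> (\<forall>i. 0 \<le> flip \<epsilon> x $ i)"
  by (simp add: orthant_def)

lemma flip_eq_absv:
  assumes "\<epsilon> \<in> sign_vectors" "x \<in> orthant \<epsilon>"
  shows "flip \<epsilon> x = absv x"
proof -
  have "\<epsilon> $ i * x $ i = \<bar>x $ i\<bar>" for i
    using sign_cases[OF assms(1), of i] assms(2) unfolding orthant_def by (auto dest: spec[of _ i])
  then show ?thesis by (simp add: vec_eq_iff)
qed

text \<open>A generator \<open>axis i 1 - axis j 1\<close> lies in the orthant of
  \<open>\<epsilon>\<close> exactly if \<open>i\<close> is positive and \<open>j\<close> negative,
  so the edges that remain are those of the cut; \<open>convex_hull_orthant\<close> ensures that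
  these generators suffice.\<close>

lemma Q_polytope_flip:
  fixes E :: "'n::finite set set"
  assumes E: "\<And>i. {i} \<notin> E" and \<epsilon>: "\<epsilon> \<in> sign_vectors" and u: "\<And>i. 0 \<le> u $ i"
  shows "flip \<epsilon> u \<in> Q_polytope E \<longleftrightarrow> u \<in> P_polytope (cut_graph E (pos_set \<epsilon>))"
proof
  let ?S = "pos_set \<epsilon>"
  have sgn: "\<epsilon> $ i = (if i \<in> ?S then 1 else - 1)" for i
    using sign_cases[OF \<epsilon>, of i] by (auto simp: pos_set_def)
  assume Q: "flip \<epsilon> u \<in> Q_polytope E"
  have ee: "\<epsilon> $ i * (\<epsilon> $ i * a) = a" for i a by (simp add: sgn)
  have "flip \<epsilon> u \<in> convex hull {g \<in> Q_gens E. \<forall>i. 0 \<le> \<epsilon> $ i * g $ i}"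
    by (rule convex_hull_orthant) (use Q u Q_gens_zero in \<open>auto simp: Q_polytope_def ee sgn\<close>)
  then have "flip \<epsilon> (flip \<epsilon> u) \<in> flip \<epsilon> ` (convex hull {g \<in> Q_gens E. \<forall>i. 0 \<le> \<epsilon> $ i * g $ i})" by blast
  also have "\<dots> = convex hull (flip \<epsilon> ` {g \<in> Q_gens E. \<forall>i. 0 \<le> \<epsilon> $ i * g $ i})"
    by (rule convex_hull_linear_image[OF linear_flip])
  also have "\<dots> \<subseteq> P_polytope (cut_graph E ?S)"
    unfolding P_polytope_def
  proof (rule hull_mono, rule image_subsetI)
    fix g assume "g \<in> {g \<in> Q_gens E. \<forall>i. 0 \<le> \<epsilon> $ i * g $ i}"
    then have g: "g \<in> Q_gens E" and pos: "\<And>i. 0 \<le> \<epsilon> $ i * g $ i" by auto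
    from g show "flip \<epsilon> g \<in> B_gens (cut_graph E ?S)"
    proof (cases rule: Q_gens_cases)
      case 1 then show ?thesis by (simp add: flip_add B_gensI)
    next
      case (2 i)
      then have "\<epsilon> $ i = 1" using pos[of i] sgn[of i] by (auto simp: axis_def split: if_splits)
      then show ?thesis unfolding 2 flip_axis by (simp add: B_gensI)
    next
      case (3 i)
      then have "\<epsilon> $ i = - 1" using pos[of i] sgn[of i] by (auto simp: axis_def split: if_splits)
      then show ?thesis unfolding 3 flip_add flip_axis by (simp add: B_gensI)
    next
      case (4 i j)
      have ij: "i \<noteq> j" using E 4(2) by auto
      then have s: "\<epsilon> $ i = 1" "\<epsilon> $ j = - 1"
        using pos[of i] pos[of j] sgn[of i] sgn[of j] 4(1) by (auto simp: axis_def split: if_splits)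
      then have "{i, j} \<in> cut_graph E ?S" using mem_cut_graph[of i E j ?S] E 4(2) by (auto simp: pos_set_def)
      then show ?thesis unfolding 4 flip_add flip_axis s by (simp add: B_gensI)
    qed
  qed
  finally show "u \<in> P_polytope (cut_graph E ?S)" using flip_flip[OF \<epsilon>] by simp
next
  let ?S = "pos_set \<epsilon>"
  have sgn: "\<epsilon> $ i = (if i \<in> ?S then 1 else - 1)" for i
    using sign_cases[OF \<epsilon>, of i] by (auto simp: pos_set_def)
  assume "u \<in> P_polytope (cut_graph E ?S)"
  then have "flip \<epsilon> u \<in> flip \<epsilon> ` (convex hull (B_gens (cut_graph E ?S)))" by (auto simp: P_polytope_def)
  also have "\<dots> = convex hull (flip \<epsilon> ` B_gens (cut_graph E ?S))"
    by (rule convex_hull_linear_image[OF linear_flip])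
  also have "\<dots> \<subseteq> Q_polytope E"
    unfolding Q_polytope_def
  proof (rule hull_mono, rule image_subsetI)
    fix g assume "g \<in> B_gens (cut_graph E ?S)"
    then show "flip \<epsilon> g \<in> Q_gens E"
    proof (cases rule: B_gens_cases)
      case 1 then show ?thesis by (simp add: flip_add Q_gensI)
    next
      case (2 i) then show ?thesis unfolding 2 flip_axis by (simp add: Q_gensI sgn)
    next
      case (3 i j)
      then have ij: "{i, j} \<in> E" "(i \<in> ?S) \<noteq> (j \<in> ?S)" using mem_cut_graph[of i E j ?S] E by auto
      then have ji: "{j, i} \<in> E" by (simp add: insert_commute)
      show ?thesis
      proof (cases "i \<in> ?S")
        case True
        then have "flip \<epsilon> g = axis i 1 - axis j 1" unfolding 3 flip_add flip_axis using ij by (simp add: sgn)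
        then show ?thesis using Q_gensI(4)[OF ij(1)] by simp
      next
        case False
        then have "flip \<epsilon> g = axis j 1 - axis i 1" unfolding 3 flip_add flip_axis using ij by (simp add: sgn)
        then show ?thesis using Q_gensI(4)[OF ji] by simp
      qed
    qed
  qed
  finally show "flip \<epsilon> u \<in> Q_polytope E" .
qed

lemma lattice_polytope_Q: "lattice_polytope (Q_polytope E)"
  unfolding lattice_polytope_def Q_polytope_def using finite_Q_gens Q_gens_int by blast

lemma aff_dim_Q: "aff_dim (Q_polytope E) = int CARD('n)" for E :: "'n::finite set set"
  by (rule aff_dim_full) (auto simp: Q_polytope_def intro!: hull_inc Q_gensI)

lemma locally_anti_blocking_Q:
  fixes E :: "'n::finite set set"
  assumes E: "\<And>i. {i} \<notin> E"
  shows "locally_anti_blocking (Q_polytope E)"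
  unfolding locally_anti_blocking_def
proof (intro conjI ballI lattice_polytope_Q aff_dim_Q)
  fix \<epsilon> :: "real ^ 'n" assume \<epsilon>: "\<epsilon> \<in> sign_vectors"
  let ?P = "P_polytope (cut_graph E (pos_set \<epsilon>))"
  have "x \<in> Q_polytope E \<longleftrightarrow> x \<in> symmetrization ?P" if "x \<in> orthant \<epsilon>" for x
  proof -
    have "x \<in> Q_polytope E \<longleftrightarrow> flip \<epsilon> (flip \<epsilon> x) \<in> Q_polytope E" by (simp add: flip_flip[OF \<epsilon>])
    also have "\<dots> \<longleftrightarrow> flip \<epsilon> x \<in> ?P" by (rule Q_polytope_flip[OF E \<epsilon>]) (use that flip_nonneg in blast)
    also have "\<dots> \<longleftrightarrow> x \<in> symmetrization ?P"
      unfolding flip_eq_absv[OF \<epsilon> that] by (rule mem_symmetrization[symmetric]) (rule P_polytope_nonneg)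
    finally show ?thesis .
  qed
  then show "\<exists>P. anti_blocking P \<and> Q_polytope E \<inter> orthant \<epsilon> = symmetrization P \<inter> orthant \<epsilon>"
    using anti_blocking_P_polytope by blast
qed

section \<open>Reflexivity\<close>

lemma Q_polytope_bound:
  assumes "x \<in> Q_polytope E"
  shows "\<bar>x $ i\<bar> \<le> 1"
proof -
  have g: "\<bar>g $ i\<bar> \<le> 1" if "g \<in> Q_gens E" for g
    using that by (cases rule: Q_gens_cases) (auto simp: axis_def)
  have "Q_polytope E \<subseteq> {x. axis i 1 \<bullet> x \<le> 1} \<inter> {x. axis i 1 \<bullet> x \<ge> - 1}"
    unfolding Q_polytope_def
  proof (rule hull_minimal)
    show "Q_gens E \<subseteq> {x. axis i 1 \<bullet> x \<le> 1} \<inter> {x. axis i 1 \<bullet> x \<ge> - 1}"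
      using g by (force simp: inner_axis' abs_le_iff)
  qed (intro convex_Int convex_halfspace_le convex_halfspace_ge)
  then show ?thesis using assms by (auto simp: inner_axis' abs_le_iff)
qed

lemma finite_bounded_int: "finite {z \<in> int_lattice. \<forall>i. \<bar>z $ i\<bar> \<le> c}" for c :: real
proof -
  have "{z :: real ^ 'n. z \<in> int_lattice \<and> (\<forall>i. \<bar>z $ i\<bar> \<le> c)} \<subseteq> (\<lambda>f. \<chi> i. f i) ` (PiE UNIV (\<lambda>_. {a \<in> \<int>. \<bar>a\<bar> \<le> c}))"
  proof
    fix z :: "real ^ 'n" assume "z \<in> {z. z \<in> int_lattice \<and> (\<forall>i. \<bar>z $ i\<bar> \<le> c)}"
    then have "(\<lambda>i. z $ i) \<in> PiE UNIV (\<lambda>_. {a \<in> \<int>. \<bar>a\<bar> \<le> c})" by (auto simp: int_lattice_def)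
    moreover have "z = (\<chi> i. z $ i)" by simp
    ultimately show "z \<in> (\<lambda>f. \<chi> i. f i) ` (PiE UNIV (\<lambda>_. {a \<in> \<int>. \<bar>a\<bar> \<le> c}))" by blast
  qed
  then show ?thesis
    by (rule finite_subset) (intro finite_imageI finite_PiE finite finite_abs_int_segment)
qed

lemma interior_Q_int:
  fixes E :: "'n::finite set set"
  assumes E: "\<And>i. {i} \<notin> E"
  shows "interior (Q_polytope E) \<inter> int_lattice = {0}"
proof (intro equalityI subsetI)
  fix x assume x: "x \<in> interior (Q_polytope E) \<inter> int_lattice"
  then obtain e where e: "e > 0" "ball x e \<subseteq> Q_polytope E" by (auto simp: mem_interior)
  have "x $ i = 0" for i
  proof (rule ccontr)
    assume nz: "x $ i \<noteq> 0"
    have "x $ i \<in> \<int>" using x by (auto simp: int_lattice_def)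
    then have "\<bar>x $ i\<bar> \<ge> 1" using nz by (rule Ints_nonzero_abs_ge1)
    \<comment> \<open>A nonzero integer coordinate is at least 1 in absolute value; pushing it
      outwards leaves the cube that contains the polytope.\<close>
    let ?y = "x + (e / 2 * sgn (x $ i)) *\<^sub>R axis i 1"
    have "norm ((e / 2 * sgn (x $ i)) *\<^sub>R axis i 1 :: real ^ 'n) < e"
      using e(1) nz by (simp add: norm_axis_1 abs_mult abs_sgn_eq)
    then have "?y \<in> ball x e" by (simp add: dist_norm)
    then have "\<bar>?y $ i\<bar> \<le> 1" using e(2) Q_polytope_bound by blast
    moreover have "\<bar>?y $ i\<bar> = \<bar>x $ i\<bar> + e / 2"
      using e(1) nz by (cases "x $ i > 0") (auto simp: axis_def)
    ultimately show False using \<open>\<bar>x $ i\<bar> \<ge> 1\<close> e(1) by linarith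
  qed
  then show "x \<in> {0}" by (simp add: vec_eq_iff)
next
  fix x :: "real ^ 'n" assume "x \<in> {0}"
  then have x: "x = 0" by simp
  \<comment> \<open>The average of the unit vectors has all coordinates equal to this number, and
    everything below it lies in the anti-blocking pieces.\<close>
  let ?d = "1 / real CARD('n)"
  have "ball 0 ?d \<subseteq> Q_polytope E"
  proof
    fix y :: "real ^ 'n" assume "y \<in> ball 0 ?d"
    then have y: "\<bar>y $ i\<bar> \<le> ?d" for i using component_le_norm_cart[of y i] by (simp add: dist_norm)
    let ?e = "\<chi> i. if y $ i < 0 then - 1 else (1 :: real)"
    have \<epsilon>: "?e \<in> sign_vectors" by (auto simp: sign_vectors_def)
    have "(\<Sum>i\<in>UNIV. ?d *\<^sub>R axis i 1) \<in> P_polytope (cut_graph E (pos_set ?e))"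
      by (rule convex_sum) (auto simp: P_polytope_def intro!: hull_inc B_gensI)
    then have "absv y \<in> P_polytope (cut_graph E (pos_set ?e))"
      by (rule P_polytope_down_closed) (use y in \<open>auto simp: axis_def if_distrib cong: if_cong\<close>)
    then have "flip ?e (absv y) \<in> Q_polytope E" by (subst Q_polytope_flip[OF E \<epsilon>]) auto
    moreover have "flip ?e (absv y) = y" by (auto simp: vec_eq_iff)
    ultimately show "y \<in> Q_polytope E" by simp
  qed
  then have "0 \<in> interior (Q_polytope E)" unfolding mem_interior by (intro exI[of _ ?d]) auto
  then show "x \<in> interior (Q_polytope E) \<inter> int_lattice" using x by (auto simp: int_lattice_def)
qed

lemma dual_Q:
  fixes E :: "'n::finite set set"
  shows "dual_polytope (Q_polytope E) = {y :: real ^ 'n. (\<forall>i. \<bar>y $ i\<bar> \<le> 1) \<and> (\<forall>i j. {i, j} \<in> E \<longrightarrow> y $ i - y $ j \<le> 1)}"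
proof -
  have "dual_polytope (Q_polytope E) = {y. \<forall>g\<in>Q_gens E. g \<bullet> y \<le> 1}"
  proof (intro equalityI subsetI)
    fix y :: "real ^ 'n" assume "y \<in> {y. \<forall>g\<in>Q_gens E. g \<bullet> y \<le> 1}"
    then have "Q_gens E \<subseteq> {x. y \<bullet> x \<le> 1}" by (auto simp: inner_commute)
    then have "Q_polytope E \<subseteq> {x. y \<bullet> x \<le> 1}"
      unfolding Q_polytope_def by (rule hull_minimal) (rule convex_halfspace_le)
    then show "y \<in> dual_polytope (Q_polytope E)" by (auto simp: dual_polytope_def inner_commute)
  next
    fix y :: "real ^ 'n" assume "y \<in> dual_polytope (Q_polytope E)"
    then show "y \<in> {y. \<forall>g\<in>Q_gens E. g \<bullet> y \<le> 1}"
      by (auto simp: dual_polytope_def Q_polytope_def intro: hull_inc)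
  qed
  also have "\<dots> = {y. (\<forall>i. \<bar>y $ i\<bar> \<le> 1) \<and> (\<forall>i j. {i, j} \<in> E \<longrightarrow> y $ i - y $ j \<le> 1)}"
  proof (intro equalityI subsetI)
    fix y :: "real ^ 'n" assume "y \<in> {y. \<forall>g\<in>Q_gens E. g \<bullet> y \<le> 1}"
    then have y: "g \<in> Q_gens E \<Longrightarrow> g \<bullet> y \<le> 1" for g by blast
    have "\<bar>y $ i\<bar> \<le> 1" for i
      using y[OF Q_gensI(2), of i] y[OF Q_gensI(3), of i] by (simp add: inner_axis' abs_le_iff)
    moreover have "y $ i - y $ j \<le> 1" if "{i, j} \<in> E" for i j
      using y[OF Q_gensI(4)[OF that]] by (simp add: inner_axis' inner_diff_left)
    ultimately show "y \<in> {y. (\<forall>i. \<bar>y $ i\<bar> \<le> 1) \<and> (\<forall>i j. {i, j} \<in> E \<longrightarrow> y $ i - y $ j \<le> 1)}" by blast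
  next
    fix y :: "real ^ 'n" assume y: "y \<in> {y. (\<forall>i. \<bar>y $ i\<bar> \<le> 1) \<and> (\<forall>i j. {i, j} \<in> E \<longrightarrow> y $ i - y $ j \<le> 1)}"
    have "g \<bullet> y \<le> 1" if "g \<in> Q_gens E" for g
      using that y by (cases rule: Q_gens_cases) (auto simp: inner_axis' inner_diff_left abs_le_iff)
    then show "y \<in> {y. \<forall>g\<in>Q_gens E. g \<bullet> y \<le> 1}" by blast
  qed
  finally show ?thesis .
qed

text \<open>If some coordinate of \<open>y\<close> is not an integer, then all coordinates with the same fractional part
  can be moved simultaneously in both directions: no inequality between a moved and an unmoved
  coordinate is tight. Hence extreme points are integral.\<close>

lemma extreme_dual_Q_int:
  fixes E :: "'n::finite set set"
  assumes y: "y extreme_point_of dual_polytope (Q_polytope E)"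
  shows "y \<in> int_lattice"
proof (rule ccontr)
  assume "y \<notin> int_lattice"
  then obtain i0 where i0: "y $ i0 \<notin> \<int>" by (auto simp: int_lattice_def)
  have yD: "\<And>i. \<bar>y $ i\<bar> \<le> 1" "\<And>i j. {i, j} \<in> E \<Longrightarrow> y $ i - y $ j \<le> 1"
    using y by (auto simp: extreme_point_of_def dual_Q)
  define C where "C = {i. y $ i - y $ i0 \<in> \<int>}"
  define v where "v = (\<chi> i. if i \<in> C then 1 else (0 :: real))"
  have s1: "\<bar>y $ i\<bar> < 1" if "i \<in> C" for i
  proof -
    have "y $ i \<notin> \<int>"
    proof
      assume "y $ i \<in> \<int>"
      then have "y $ i - (y $ i - y $ i0) \<in> \<int>" using that by (intro Ints_diff) (auto simp: C_def)
      then show False using i0 by simp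
    qed
    then have "\<bar>y $ i\<bar> \<noteq> 1" by (auto simp: abs_if split: if_splits)
    then show ?thesis using yD(1)[of i] by linarith
  qed
  have s2: "y $ i - y $ j < 1" if "{i, j} \<in> E" "(i \<in> C) \<noteq> (j \<in> C)" for i j
  proof -
    have "y $ i - y $ j \<noteq> 1"
    proof
      assume eq: "y $ i - y $ j = 1"
      have "y $ i - y $ i0 = (y $ j - y $ i0) + 1" "y $ j - y $ i0 = (y $ i - y $ i0) - 1" using eq by auto
      then show False using that(2) unfolding C_def mem_Collect_eq by (metis Ints_1 Ints_add Ints_diff)
    qed
    then show ?thesis using yD(2)[OF that(1)] by linarith
  qed
  \<comment> \<open>The slacks of all constraints affected by the move; the element 1 keeps the set
    nonempty.\<close>
  define V where "V = insert 1 ((\<lambda>i. 1 - \<bar>y $ i\<bar>) ` C \<union> (\<lambda>(i, j). 1 - (y $ i - y $ j)) ` {(i, j). {i, j} \<in> E \<and> (i \<in> C) \<noteq> (j \<in> C)})"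
  have finV: "finite V" by (simp add: V_def)
  define \<delta> where "\<delta> = Min V"
  have "\<delta> \<in> V" unfolding \<delta>_def by (rule Min_in) (auto simp: finV V_def)
  then have pos: "\<delta> > 0" using s1 s2 by (auto simp: V_def)
  have d1: "\<delta> \<le> 1 - \<bar>y $ i\<bar>" if "i \<in> C" for i
    unfolding \<delta>_def by (rule Min_le[OF finV]) (use that in \<open>auto simp: V_def\<close>)
  have d2: "\<delta> \<le> 1 - (y $ i - y $ j)" if "{i, j} \<in> E" "(i \<in> C) \<noteq> (j \<in> C)" for i j
    unfolding \<delta>_def by (rule Min_le[OF finV]) (use that in \<open>force simp: V_def\<close>)
  have mem: "y + s *\<^sub>R v \<in> dual_polytope (Q_polytope E)" if s: "\<bar>s\<bar> \<le> \<delta>" for s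
    unfolding dual_Q mem_Collect_eq
  proof (intro conjI allI impI)
    fix i show "\<bar>(y + s *\<^sub>R v) $ i\<bar> \<le> 1"
      using d1[of i] yD(1)[of i] s by (auto simp: v_def)
  next
    fix i j assume ij: "{i, j} \<in> E"
    show "(y + s *\<^sub>R v) $ i - (y + s *\<^sub>R v) $ j \<le> 1"
      using d2[OF ij] yD(2)[OF ij] s by (auto simp: v_def)
  qed
  have "v $ i0 = 1" by (simp add: v_def C_def)
  then have "y + \<delta> *\<^sub>R v \<noteq> y + (- \<delta>) *\<^sub>R v" using pos by (auto simp: vec_eq_iff intro!: exI[of _ i0])
  then have "midpoint (y + \<delta> *\<^sub>R v) (y + (- \<delta>) *\<^sub>R v) \<in> open_segment (y + \<delta> *\<^sub>R v) (y + (- \<delta>) *\<^sub>R v)" by simp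
  moreover have "midpoint (y + \<delta> *\<^sub>R v) (y + (- \<delta>) *\<^sub>R v) = y"
    by (simp add: midpoint_def vec_eq_iff)
  ultimately have "y \<in> open_segment (y + \<delta> *\<^sub>R v) (y + (- \<delta>) *\<^sub>R v)" by (simp only:)
  moreover have "y + \<delta> *\<^sub>R v \<in> dual_polytope (Q_polytope E)" "y + (- \<delta>) *\<^sub>R v \<in> dual_polytope (Q_polytope E)"
    using mem[of \<delta>] mem[of "- \<delta>"] pos by simp_all
  ultimately show False using y unfolding extreme_point_of_def by blast
qed

text \<open>By Minkowski's theorem the compact dual is the hull of its extreme points, which are
  integral and bounded, hence finite in number.\<close>

lemma reflexive_Q:
  fixes E :: "'n::finite set set"
  assumes E: "\<And>i. {i} \<notin> E"
  shows "reflexive_polytope (Q_polytope E)"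
proof -
  let ?D = "dual_polytope (Q_polytope E)"
  have eq: "?D = (\<Inter>x\<in>Q_polytope E. {y. x \<bullet> y \<le> 1})" by (auto simp: dual_polytope_def)
  have "convex ?D" unfolding eq by (intro convex_INT convex_halfspace_le)
  moreover have "closed ?D" unfolding eq by (intro closed_INT ballI closed_halfspace_le)
  moreover have "bounded ?D"
  proof (rule boundedI)
    fix y assume "y \<in> ?D"
    then have "\<bar>y $ i\<bar> \<le> 1" for i by (simp add: dual_Q)
    then have "(\<Sum>i\<in>UNIV. \<bar>y $ i\<bar>) \<le> (\<Sum>i\<in>(UNIV :: 'n set). 1)" by (intro sum_mono) auto
    then show "norm y \<le> real CARD('n)" using norm_le_l1_cart[of y] by simp
  qed
  ultimately have "?D = convex hull {y. y extreme_point_of ?D}"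
    by (intro Krein_Milman_Minkowski) (auto simp: compact_eq_bounded_closed)
  moreover have "{y. y extreme_point_of ?D} \<subseteq> int_lattice" using extreme_dual_Q_int by blast
  moreover have "{y. y extreme_point_of ?D} \<subseteq> {z \<in> int_lattice. \<forall>i. \<bar>z $ i\<bar> \<le> 1}"
    using extreme_dual_Q_int by (auto simp: extreme_point_of_def dual_Q)
  then have "finite {y. y extreme_point_of ?D}" by (rule finite_subset) (rule finite_bounded_int)
  ultimately have "lattice_polytope ?D" unfolding lattice_polytope_def by blast
  then show ?thesis
    unfolding reflexive_polytope_def using lattice_polytope_Q interior_Q_int[OF E] by blast
qed


section \<open>Unimodular equivalence with the projection\<close>

text \<open>The inverse of forgetting the apex on the hyperplane of coordinate sum 0, which contains
  all differences of unit vectors.\<close>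

definition lift :: "real ^ 'n \<Rightarrow> real ^ ('n::finite option)" where
  "lift x = (\<chi> k. case k of None \<Rightarrow> - (\<Sum>i\<in>UNIV. x $ i) | Some i \<Rightarrow> x $ i)"

definition unlift :: "real ^ ('n::finite option) \<Rightarrow> real ^ 'n" where
  "unlift y = (\<chi> i. y $ Some i)"

lemma lift_nth: "lift x $ Some i = x $ i" "lift x $ None = - (\<Sum>i\<in>UNIV. x $ i)"
  by (simp_all add: lift_def)

lemma unlift_lift [simp]: "unlift (lift x) = x"
  by (simp add: unlift_def lift_def vec_eq_iff)

lemma linear_lift: "linear lift"
  by (rule linearI)
     (auto simp: lift_def vec_eq_iff sum.distrib sum_distrib_left algebra_simps split: option.splits)

lemma linear_unlift: "linear unlift"
  by (rule linearI) (auto simp: unlift_def vec_eq_iff)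

lemma inj_lift: "inj lift"
  by (rule inj_on_inverseI[where g = unlift]) simp

lemma lift_int: "lift x \<in> int_lattice \<longleftrightarrow> x \<in> int_lattice"
proof
  assume "lift x \<in> int_lattice"
  then have "lift x $ Some i \<in> \<int>" for i unfolding int_lattice_def by blast
  then show "x \<in> int_lattice" by (simp add: lift_nth int_lattice_def)
next
  assume x: "x \<in> int_lattice"
  have "lift x $ k \<in> \<int>" for k
    using x by (cases k) (auto simp: lift_nth int_lattice_def intro!: Ints_minus Ints_sum)
  then show "lift x \<in> int_lattice" by (simp add: int_lattice_def)
qed

lemma lift_axis: "lift (axis i 1) = axis (Some i) 1 - axis None 1"
proof -
  have "(\<Sum>j\<in>UNIV. axis i (1::real) $ j) = 1" by (simp add: axis_def)
  then have "lift (axis i 1) $ k = (axis (Some i) 1 - axis None 1) $ k" for k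
    by (cases k) (auto simp: lift_nth axis_def)
  then show ?thesis by (simp add: vec_eq_iff)
qed

lemma A_polytope_lift:
  fixes E :: "'n::finite set set"
  shows "A_polytope (suspension E) = lift ` Q_polytope E"
proof -
  let ?A = "{x. \<exists>i j. {i, j} \<in> suspension E \<and> (x = axis i 1 - axis j 1 \<or> x = - (axis i 1 - axis j 1))} :: (real ^ 'n option) set"
  have lm: "lift (- x) = - lift x" "lift (x - y) = lift x - lift y" "lift 0 = 0" for x y :: "real ^ 'n"
    by (simp_all add: linear_neg[OF linear_lift] linear_diff[OF linear_lift] linear_0[OF linear_lift])
  have 1: "?A \<subseteq> lift ` Q_gens E"
  proof clarify
    fix x :: "real ^ 'n option" and i j
    assume ij: "{i, j} \<in> suspension E" and x: "x = axis i 1 - axis j 1 \<or> x = - (axis i 1 - axis j 1)"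
    have ex: "x \<in> lift ` Q_gens E" if "g \<in> Q_gens E" "- g \<in> Q_gens E" "x = lift g \<or> x = - lift g" for g
      using that lm by (metis imageI)
    from ij consider a b where "{a, b} \<in> E" "{i, j} = {Some a, Some b}" | a where "{i, j} = {Some a, None}"
    proof -
      from ij have "(\<exists>e\<in>E. {i, j} = Some ` e) \<or> (\<exists>a. {i, j} = {Some a, None})" by (auto simp: suspension_def)
      then show ?thesis
      proof
        assume "\<exists>e\<in>E. {i, j} = Some ` e"
        then obtain e where e: "e \<in> E" "{i, j} = Some ` e" by blast
        then obtain a b where ab: "i = Some a" "j = Some b" by blast
        then have "Some ` {a, b} = Some ` e" using e by simp
        then have "e = {a, b}" by (metis inj_Some inj_image_eq_iff)
        then show ?thesis using that(1)[of a b] e by simp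
      qed (use that(2) in blast)
    qed
    then show "x \<in> lift ` Q_gens E"
    proof cases
      case (1 a b)
      have "- (axis a 1 - axis b 1) = (axis b 1 - axis a 1 :: real ^ 'n)" by simp
      moreover have "{b, a} \<in> E" using 1(1) by (simp add: insert_commute)
      ultimately have "axis a 1 - axis b 1 \<in> Q_gens E" "- (axis a 1 - axis b 1) \<in> Q_gens E"
        using Q_gensI(4)[OF 1(1)] Q_gensI(4)[of b a E] by simp_all
      moreover have "lift (axis a 1 - axis b 1) = axis (Some a) 1 - axis (Some b) 1"
        unfolding lm lift_axis by simp
      moreover have "(i = Some a \<and> j = Some b) \<or> (i = Some b \<and> j = Some a)"
        using 1(2) by (simp add: doubleton_eq_iff)
      ultimately show ?thesis using x by (intro ex[of "axis a 1 - axis b 1"]) auto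
    next
      case (2 a)
      have "(i = Some a \<and> j = None) \<or> (i = None \<and> j = Some a)"
        using 2 by (simp add: doubleton_eq_iff)
      then show ?thesis using x Q_gensI(2,3) by (intro ex[of "axis a 1"]) (auto simp: lift_axis)
    qed
  qed
  have s: "{Some a, None} \<in> suspension E" for a by (auto simp: suspension_def)
  have pm: "lift (axis a 1) \<in> ?A" "- lift (axis a 1) \<in> ?A" for a :: 'n
    using s[of a] unfolding lift_axis by blast+
  have 2: "lift ` Q_gens E \<subseteq> convex hull ?A"
  proof clarify
    fix g assume "g \<in> Q_gens E"
    then show "lift g \<in> convex hull ?A"
    proof (cases rule: Q_gens_cases)
      case 1
      \<comment> \<open>Any vertex will do: 0 is the midpoint of the two opposite generators at its
        edge to the apex.\<close>
      obtain a :: 'n where True by blast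
      have "(1 / 2) *\<^sub>R lift (axis a 1) + (1 / 2) *\<^sub>R (- lift (axis a 1)) \<in> convex hull ?A"
        by (rule convexD[OF convex_convex_hull]) (use pm[of a] in \<open>auto intro: hull_inc\<close>)
      then show ?thesis using 1 by (simp add: linear_0[OF linear_lift])
    next
      case (2 i) show ?thesis unfolding 2 by (rule hull_inc[OF pm(1)])
    next
      case (3 i) show ?thesis unfolding 3 lm(1) by (rule hull_inc[OF pm(2)])
    next
      case (4 i j)
      have "{Some i, Some j} = Some ` {i, j}" by simp
      then have "{Some i, Some j} \<in> suspension E" using 4(2) unfolding suspension_def by blast
      moreover have "lift g = axis (Some i) 1 - axis (Some j) 1" unfolding 4 lm lift_axis by simp
      ultimately have "lift g \<in> ?A" by blast
      then show ?thesis by (rule hull_inc)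
    qed
  qed
  have "convex hull (lift ` Q_gens E) = convex hull ?A"
  proof
    show "convex hull (lift ` Q_gens E) \<subseteq> convex hull ?A" by (rule hull_minimal[OF 2]) (rule convex_convex_hull)
    show "convex hull ?A \<subseteq> convex hull (lift ` Q_gens E)" by (rule hull_mono[OF 1])
  qed
  then show ?thesis
    unfolding A_polytope_def Q_polytope_def convex_hull_linear_image[OF linear_lift] by simp
qed

lemma affine_hull_Q: "affine hull (Q_polytope E) = UNIV" for E :: "'n::finite set set"
proof -
  have "aff_dim (Q_polytope E) = int DIM(real ^ 'n)" using aff_dim_Q[of E] by simp
  then show ?thesis using aff_dim_eq_full by blast
qed

lemma unimodularly_equivalent_A_Q:
  fixes E :: "'n::finite set set"
  shows "unimodularly_equivalent (A_polytope (suspension E)) (Q_polytope E)"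
proof -
  have hull: "affine hull (A_polytope (suspension E)) = range lift"
  proof -
    have "bounded_linear (lift :: real ^ 'n \<Rightarrow> _)" using linear_lift by (simp add: linear_conv_bounded_linear)
    from affine_hull_linear_image[OF this, of "Q_polytope E"] show ?thesis
      unfolding A_polytope_lift affine_hull_Q by (rule sym)
  qed
  have "bij_betw unlift (int_lattice \<inter> range lift) (int_lattice :: (real ^ 'n) set)"
    by (rule bij_betw_byWitness[where f' = lift]) (auto simp: lift_int)
  then show ?thesis
    unfolding unimodularly_equivalent_def hull affine_hull_Q
    by (intro exI[of _ unlift] exI[of _ 0]) (auto simp: linear_unlift A_polytope_lift image_image)
qed

lemma aff_dim_A: "aff_dim (A_polytope (suspension E)) = int CARD('n)" for E :: "'n::finite set set"
  unfolding A_polytope_lift using aff_dim_injective_linear_image[OF linear_lift inj_lift] aff_dim_Q by metis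

lemma ehrhart_A: "ehrhart_series (A_polytope (suspension E)) = ehrhart_series (Q_polytope E)"
  for E :: "'n::finite set set"
proof (rule fps_ext)
  fix m
  have "(\<lambda>x. real m *\<^sub>R x) ` lift ` Q_polytope E = lift ` (\<lambda>x. real m *\<^sub>R x) ` Q_polytope E"
    by (simp add: image_image linear_cmul[OF linear_lift])
  moreover have "lift ` K \<inter> int_lattice = lift ` (K \<inter> int_lattice)" for K :: "(real ^ 'n) set"
    using lift_int by auto
  ultimately have "(\<lambda>x. real m *\<^sub>R x) ` A_polytope (suspension E) \<inter> int_lattice =
    lift ` ((\<lambda>x. real m *\<^sub>R x) ` Q_polytope E \<inter> int_lattice)" by (simp only: A_polytope_lift)
  then have "card ((\<lambda>x. real m *\<^sub>R x) ` A_polytope (suspension E) \<inter> int_lattice) =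
    card ((\<lambda>x. real m *\<^sub>R x) ` Q_polytope E \<inter> int_lattice)"
    by (simp only: card_image[OF inj_on_subset[OF inj_lift subset_UNIV]])
  then show "fps_nth (ehrhart_series (A_polytope (suspension E))) m = fps_nth (ehrhart_series (Q_polytope E)) m"
    by (simp add: ehrhart_series_def)
qed

section \<open>Summation over cuts\<close>

lemma mem_scaled:
  fixes K :: "(real ^ 'n) set"
  assumes "m > 0"
  shows "z \<in> (\<lambda>x. real m *\<^sub>R x) ` K \<longleftrightarrow> (1 / real m) *\<^sub>R z \<in> K"
  using assms by (force simp: image_iff intro!: bexI[of _ "(1 / real m) *\<^sub>R z"])

text \<open>Where \<open>z\<close> vanishes the sign is kept in the first component; this makes the
  map an involution.\<close>

definition swap_signs :: "(real ^ 'n) \<times> (real ^ 'n) \<Rightarrow> (real ^ 'n) \<times> (real ^ 'n)" where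
  "swap_signs = (\<lambda>(\<epsilon>, z). (\<chi> i. if z $ i = 0 then \<epsilon> $ i else sgn (z $ i), flip \<epsilon> (absv z)))"

lemma swap_signs_swap_signs:
  assumes "\<epsilon> \<in> sign_vectors"
  shows "swap_signs (swap_signs (\<epsilon>, z)) = (\<epsilon>, z)"
proof -
  have e: "\<epsilon> $ i = 1 \<or> \<epsilon> $ i = - 1" for i by (rule sign_cases[OF assms])
  have "fst (swap_signs (swap_signs (\<epsilon>, z))) $ i = \<epsilon> $ i" "snd (swap_signs (swap_signs (\<epsilon>, z))) $ i = z $ i" for i
    using e[of i] by (auto simp: swap_signs_def sgn_mult abs_mult sgn_mult_abs)
  then show ?thesis by (metis prod.collapse vec_eq_iff fst_conv snd_conv)
qed

text \<open>An integer point together with a sign vector: exchanging the signs of its nonzero coordinates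
  with the sign vector turns the points of all the polytopes \<open>B\<close> into the points of \<open>Q\<close>,
  each taken once for every sign vector.\<close>

lemma ehrhart_Q:
  fixes E :: "'n::finite set set"
  assumes E: "\<And>i. {i} \<notin> E"
  shows "fps_const (2 ^ CARD('n)) * ehrhart_series (Q_polytope E) =
    (\<Sum>S\<in>UNIV. ehrhart_series (B_polytope (cut_graph E S)))"
proof (rule fps_ext)
  fix m
  have bij: "bij_betw pos_set (sign_vectors :: (real ^ 'n) set) UNIV"
    by (rule bij_betw_byWitness[where f' = "\<lambda>S. \<chi> i. if i \<in> S then 1 else - 1"])
       (auto simp: pos_set_def sign_vectors_def vec_eq_iff, metis)
  have cards: "card (sign_vectors :: (real ^ 'n) set) = 2 ^ CARD('n)"
    using bij_betw_same_card[OF bij] card_UNIV_set by simp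
  have fins: "finite (sign_vectors :: (real ^ 'n) set)"
    using bij_betw_finite[OF bij] by simp
  show "fps_nth (fps_const (2 ^ CARD('n)) * ehrhart_series (Q_polytope E)) m =
    fps_nth (\<Sum>S\<in>UNIV. ehrhart_series (B_polytope (cut_graph E S))) m"
  proof (cases "m = 0")
    case True
    then show ?thesis using card_UNIV_set[where 'a = 'n] by (simp add: ehrhart_series_def fps_sum_nth)
  next
    case False
    then have m: "m > 0" by simp
    let ?M = "\<lambda>K. (\<lambda>x. real m *\<^sub>R x) ` K \<inter> int_lattice"
    have memB: "z \<in> ?M (B_polytope (cut_graph E (pos_set \<epsilon>))) \<longleftrightarrow>
        z \<in> int_lattice \<and> flip \<epsilon> (absv z) \<in> (\<lambda>x. real m *\<^sub>R x) ` Q_polytope E"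
      if \<epsilon>: "\<epsilon> \<in> sign_vectors" for z \<epsilon>
    proof -
      have "absv ((1 / real m) *\<^sub>R z) = (1 / real m) *\<^sub>R absv z" by (auto simp: vec_eq_iff abs_mult)
      moreover have "(1 / real m) *\<^sub>R flip \<epsilon> (absv z) = flip \<epsilon> ((1 / real m) *\<^sub>R absv z)" by (auto simp: vec_eq_iff)
      moreover have "flip \<epsilon> ((1 / real m) *\<^sub>R absv z) \<in> Q_polytope E \<longleftrightarrow>
          (1 / real m) *\<^sub>R absv z \<in> P_polytope (cut_graph E (pos_set \<epsilon>))"
        by (rule Q_polytope_flip[OF E \<epsilon>]) simp
      ultimately show ?thesis unfolding Int_iff mem_scaled[OF m] mem_B_polytope by auto
    qed
    have finQ: "finite (?M (Q_polytope E))"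
    proof (rule finite_subset[OF _ finite_bounded_int[of "real m"]])
      show "?M (Q_polytope E) \<subseteq> {z \<in> int_lattice. \<forall>i. \<bar>z $ i\<bar> \<le> real m}"
        using Q_polytope_bound m by (auto simp: abs_mult mult_le_cancel_left1)
    qed
    have finB: "finite (?M (B_polytope (cut_graph E S)))" for S
    proof (rule finite_subset[OF _ finite_bounded_int[of "real m"]])
      show "?M (B_polytope (cut_graph E S)) \<subseteq> {z \<in> int_lattice. \<forall>i. \<bar>z $ i\<bar> \<le> real m}"
      proof
        fix z assume z: "z \<in> ?M (B_polytope (cut_graph E S))"
        define x where "x = (1 / real m) *\<^sub>R z"
        have x: "z = real m *\<^sub>R x" "absv x \<in> P_polytope (cut_graph E S)"
          using z m unfolding Int_iff mem_scaled[OF m] mem_B_polytope x_def by simp_all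
        have "\<bar>x $ i\<bar> \<le> 1" for i
          using P_polytope_stable[OF x(2), of "{i}"] mem_cut_graph[OF E, of i i] by fastforce
        then show "z \<in> {z \<in> int_lattice. \<forall>i. \<bar>z $ i\<bar> \<le> real m}"
          using z m unfolding x(1) by (auto simp: abs_mult mult_le_cancel_left1)
      qed
    qed
    let ?G = "SIGMA \<epsilon> : (sign_vectors :: (real ^ 'n) set). ?M (B_polytope (cut_graph E (pos_set \<epsilon>)))"
    let ?D = "(sign_vectors :: (real ^ 'n) set) \<times> ?M (Q_polytope E)"
    have sv: "fst (swap_signs (\<epsilon>, z)) \<in> sign_vectors" if "\<epsilon> \<in> sign_vectors" for \<epsilon> z :: "real ^ 'n"
      using sign_cases[OF that] unfolding swap_signs_def sign_vectors_def by (auto simp: sgn_if)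
    have int: "flip \<epsilon> (absv z) \<in> int_lattice" if "\<epsilon> \<in> sign_vectors" "z \<in> int_lattice" for \<epsilon> z :: "real ^ 'n"
    proof -
      have "\<epsilon> $ i * \<bar>z $ i\<bar> \<in> \<int>" for i
        using that sign_cases[OF that(1), of i] by (auto simp: int_lattice_def intro: Ints_minus Ints_abs)
      then show ?thesis by (simp add: int_lattice_def)
    qed
    have "bij_betw swap_signs ?G ?D"
    proof (rule bij_betw_byWitness[where f' = swap_signs])
      show "\<forall>a\<in>?G. swap_signs (swap_signs a) = a" "\<forall>a\<in>?D. swap_signs (swap_signs a) = a"
        using swap_signs_swap_signs by auto
      show "swap_signs ` ?G \<subseteq> ?D"
      proof (rule image_subsetI)
        fix a :: "(real ^ 'n) \<times> (real ^ 'n)" assume a: "a \<in> ?G"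
        obtain \<epsilon> z \<sigma> w where az: "a = (\<epsilon>, z)" and sw: "swap_signs (\<epsilon>, z) = (\<sigma>, w)"
          by (metis surj_pair)
        have \<epsilon>: "\<epsilon> \<in> sign_vectors" and z: "z \<in> ?M (B_polytope (cut_graph E (pos_set \<epsilon>)))"
          using a unfolding az by blast+
        have "\<sigma> \<in> sign_vectors" using sv[OF \<epsilon>, of z] sw by simp
        moreover have w: "w = flip \<epsilon> (absv z)" using sw by (simp add: swap_signs_def)
        moreover have "w \<in> ?M (Q_polytope E)" unfolding w using memB[OF \<epsilon>, of z] z int[OF \<epsilon>, of z] by blast
        ultimately show "swap_signs a \<in> ?D" unfolding az sw by blast
      qed
      show "swap_signs ` ?D \<subseteq> ?G"
      proof (rule image_subsetI)
        fix a :: "(real ^ 'n) \<times> (real ^ 'n)" assume a: "a \<in> ?D"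
        obtain \<epsilon> z \<sigma> w where az: "a = (\<epsilon>, z)" and sw: "swap_signs (\<epsilon>, z) = (\<sigma>, w)"
          by (metis surj_pair)
        have \<epsilon>: "\<epsilon> \<in> sign_vectors" and z: "z \<in> ?M (Q_polytope E)"
          using a unfolding az by blast+
        have \<sigma>: "\<sigma> \<in> sign_vectors" using sv[OF \<epsilon>, of z] sw by simp
        have w: "w = flip \<epsilon> (absv z)" using sw by (simp add: swap_signs_def)
        have "swap_signs (\<sigma>, w) = (\<epsilon>, z)" using swap_signs_swap_signs[OF \<epsilon>, of z] sw by simp
        then have zw: "flip \<sigma> (absv w) = z" by (simp add: swap_signs_def)
        have "w \<in> int_lattice" unfolding w by (rule int[OF \<epsilon>]) (use z in blast)
        then have "w \<in> ?M (B_polytope (cut_graph E (pos_set \<sigma>)))"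
          unfolding memB[OF \<sigma>] zw using z by blast
        then show "swap_signs a \<in> ?G" unfolding az sw using \<sigma> by blast
      qed
    qed
    then have "card ?G = card ?D" by (rule bij_betw_same_card)
    then have "(\<Sum>\<epsilon>\<in>sign_vectors. card (?M (B_polytope (cut_graph E (pos_set \<epsilon>))))) = 2 ^ CARD('n) * card (?M (Q_polytope E))"
      using fins finB finQ cards by (simp add: card_SigmaI card_cartesian_product)
    moreover have "(\<Sum>\<epsilon>\<in>sign_vectors. card (?M (B_polytope (cut_graph E (pos_set \<epsilon>))))) = (\<Sum>S\<in>UNIV. card (?M (B_polytope (cut_graph E S))))"
      by (rule sum.reindex_bij_betw[OF bij, of "\<lambda>S. card (?M (B_polytope (cut_graph E S)))"])
    ultimately have "real (\<Sum>S\<in>UNIV. card (?M (B_polytope (cut_graph E S)))) = real (2 ^ CARD('n) * card (?M (Q_polytope E)))"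
      by simp
    then show ?thesis using m by (simp add: ehrhart_series_def fps_sum_nth)
  qed
qed

text \<open>Every partition has two different blocks, as a set never equals its complement, and
  \<open>g\<close> agrees on them, so the choice made by \<open>block\<close> does not
  matter.\<close>

lemma sum_cut_partitions:
  fixes g :: "'n::finite set \<Rightarrow> 'k::comm_ring_1"
  assumes g: "\<And>S. g (- S) = g S"
  shows "(\<Sum>S\<in>UNIV. g S) = 2 * (\<Sum>P\<in>cut_partitions. g (block P))"
proof -
  have fin: "finite (cut_partitions :: 'n set set set)" by (rule finite_subset[of _ UNIV]) auto
  have "(\<Sum>S\<in>UNIV. g S) = (\<Sum>P\<in>cut_partitions. \<Sum>S\<in>{S \<in> UNIV. {S, - S} = P}. g S)"
    by (rule sum.group[symmetric]) (auto simp: fin cut_partitions_def)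
  also have "\<dots> = (\<Sum>P\<in>cut_partitions. 2 * g (block P))"
  proof (rule sum.cong[OF refl])
    fix P :: "'n set set" assume "P \<in> cut_partitions"
    then obtain T where T: "P = {T, - T}" by (auto simp: cut_partitions_def)
    have "block P \<in> P" unfolding block_def by (rule someI[of _ T]) (simp add: T)
    then have b: "g (block P) = g T" using g T by auto
    have "{S \<in> UNIV. {S, - S} = P} = {T, - T}" unfolding T by (auto simp: doubleton_eq_iff)
    moreover have "T \<noteq> - T" by blast
    ultimately show "(\<Sum>S\<in>{S \<in> UNIV. {S, - S} = P}. g S) = 2 * g (block P)" using g b by simp
  qed
  finally show ?thesis by (simp add: sum_distrib_left)
qed

section \<open>The interior polynomial of the extended bipartite graph\<close>

lemma fiber_vectors_relabel:
  assumes \<alpha>: "bij_betw \<alpha> X X'" and \<beta>: "bij_betw \<beta> Y Y'"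
    and R: "\<And>x y. x \<in> X \<Longrightarrow> y \<in> Y \<Longrightarrow> R x y \<longleftrightarrow> R' (\<alpha> x) (\<beta> y)"
    and p: "p \<in> fiber_vectors X' Y' R'"
  shows "(\<lambda>x. if x \<in> X then p (\<alpha> x) else 0) \<in> fiber_vectors X Y R"
proof -
  obtain \<phi>' where \<phi>': "pfun X' Y' R' \<phi>'" "p = fiber_count Y' \<phi>'" using p by (auto simp: fiber_vectors_def)
  define \<phi> where "\<phi> = (\<lambda>y. case \<phi>' (\<beta> y) of None \<Rightarrow> None | Some x \<Rightarrow> Some (inv_into X \<alpha> x))"
  have inv1: "inv_into X \<alpha> x \<in> X" "\<alpha> (inv_into X \<alpha> x) = x" if "x \<in> X'" for x
    using that \<alpha> by (auto simp: bij_betw_def inv_into_into f_inv_into_f)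
  have inv2: "inv_into X \<alpha> (\<alpha> x) = x" if "x \<in> X" for x
    using that \<alpha> by (simp add: bij_betw_def)
  have \<beta>Y: "\<beta> y \<in> Y'" if "y \<in> Y" for y using \<beta> that by (rule bij_betwE[rule_format])
  have pf: "pfun X Y R \<phi>"
    unfolding pfun_def
  proof (intro ballI allI impI)
    fix y x assume y: "y \<in> Y" and x: "\<phi> y = Some x"
    obtain x' where x': "\<phi>' (\<beta> y) = Some x'" "x = inv_into X \<alpha> x'"
      using x by (auto simp: \<phi>_def split: option.splits)
    then have "x' \<in> X'" "R' x' (\<beta> y)" using \<phi>'(1) \<beta>Y[OF y] by (auto simp: pfun_def)
    then show "x \<in> X \<and> R x y" using inv1[of x'] R[of x y] y x'(2) by simp
  qed
  have "fiber_count Y \<phi> = (\<lambda>x. if x \<in> X then p (\<alpha> x) else 0)"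
  proof
    fix x
    show "fiber_count Y \<phi> x = (if x \<in> X then p (\<alpha> x) else 0)"
    proof (cases "x \<in> X")
      case True
      have "\<phi> y = Some x \<longleftrightarrow> \<phi>' (\<beta> y) = Some (\<alpha> x)" if y: "y \<in> Y" for y
      proof
        assume "\<phi> y = Some x"
        then obtain x' where x': "\<phi>' (\<beta> y) = Some x'" "x = inv_into X \<alpha> x'"
          by (auto simp: \<phi>_def split: option.splits)
        then have "x' \<in> X'" using \<phi>'(1) \<beta>Y[OF y] by (auto simp: pfun_def)
        then show "\<phi>' (\<beta> y) = Some (\<alpha> x)" using x' inv1(2) by simp
      next
        assume "\<phi>' (\<beta> y) = Some (\<alpha> x)"
        then show "\<phi> y = Some x" using inv2[OF True] by (simp add: \<phi>_def)
      qed
      then have eq: "{y \<in> Y. \<phi> y = Some x} = {y \<in> Y. \<phi>' (\<beta> y) = Some (\<alpha> x)}" by auto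
      have "bij_betw \<beta> {y \<in> Y. \<phi>' (\<beta> y) = Some (\<alpha> x)} {y \<in> Y'. \<phi>' y = Some (\<alpha> x)}"
        using \<beta> unfolding bij_betw_def by (auto simp: inj_on_def)
      from bij_betw_same_card[OF this] show ?thesis using True by (simp add: fiber_count_def \<phi>'(2) eq)
    next
      case False
      then show ?thesis using fiber_count_outside[OF pf] by simp
    qed
  qed
  then show ?thesis using pf by (force simp: fiber_vectors_def)
qed

lemma fiber_poly_relabel:
  assumes \<alpha>: "bij_betw \<alpha> X X'" and \<beta>: "bij_betw \<beta> Y Y'"
    and R: "\<And>x y. x \<in> X \<Longrightarrow> y \<in> Y \<Longrightarrow> R x y \<longleftrightarrow> R' (\<alpha> x) (\<beta> y)"
  shows "fiber_poly X' Y' R' = fiber_poly X Y R"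
proof -
  let ?ai = "inv_into X \<alpha>" and ?bi = "inv_into Y \<beta>"
  have ai: "bij_betw ?ai X' X" and bi: "bij_betw ?bi Y' Y" using \<alpha> \<beta> by (auto intro: bij_betw_inv_into)
  have inv1: "\<alpha> (?ai x) = x" "?ai x \<in> X" if "x \<in> X'" for x
    using that \<alpha> by (auto simp: bij_betw_def inv_into_into f_inv_into_f)
  have inv1': "\<beta> (?bi y) = y" "?bi y \<in> Y" if "y \<in> Y'" for y
    using that \<beta> by (auto simp: bij_betw_def inv_into_into f_inv_into_f)
  have inv2: "?ai (\<alpha> x) = x" "\<alpha> x \<in> X'" if "x \<in> X" for x
    using that \<alpha> by (auto simp: bij_betw_def)
  have R': "R' x y \<longleftrightarrow> R (?ai x) (?bi y)" if "x \<in> X'" "y \<in> Y'" for x y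
    using R[OF inv1(2)[OF that(1)] inv1'(2)[OF that(2)]] inv1(1)[OF that(1)] inv1'(1)[OF that(2)] by simp
  show ?thesis
    unfolding fiber_poly_def
  proof (rule sum.reindex_bij_witness[where i = "\<lambda>p x. if x \<in> X' then p (?ai x) else 0" and j = "\<lambda>p x. if x \<in> X then p (\<alpha> x) else 0"])
    fix p assume p: "p \<in> fiber_vectors X' Y' R'"
    show "(\<lambda>x. if x \<in> X' then (if ?ai x \<in> X then p (\<alpha> (?ai x)) else 0) else 0) = p"
      using inv1 fiber_vectors_outside[OF p] by (auto simp: fun_eq_iff)
    show "(\<lambda>x. if x \<in> X then p (\<alpha> x) else 0) \<in> fiber_vectors X Y R"
      by (rule fiber_vectors_relabel[OF \<alpha> \<beta> R p])
    have "bij_betw \<alpha> {x \<in> X. (if x \<in> X then p (\<alpha> x) else 0) \<noteq> 0} {x \<in> X'. p x \<noteq> 0}"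
      using \<alpha> unfolding bij_betw_def by (auto simp: inj_on_def)
    then show "monom 1 (supp_card X (\<lambda>x. if x \<in> X then p (\<alpha> x) else 0)) = monom (1 :: real) (supp_card X' p)"
      unfolding supp_card_def by (simp only: bij_betw_same_card)
  next
    fix p assume p: "p \<in> fiber_vectors X Y R"
    show "(\<lambda>x. if x \<in> X then (if \<alpha> x \<in> X' then p (?ai (\<alpha> x)) else 0) else 0) = p"
      using inv2 fiber_vectors_outside[OF p] by (auto simp: fun_eq_iff)
    show "(\<lambda>x. if x \<in> X' then p (?ai x) else 0) \<in> fiber_vectors X' Y' R'"
      by (rule fiber_vectors_relabel[OF ai bi R' p])
  qed
qed

section \<open>Hypergraphs inducing the extended graph\<close>

abbreviation emb :: "'n \<Rightarrow> 'n option option" where "emb i \<equiv> Some (Some i)"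

lemma tilde_graph_iff:
  "{emb i, emb j} \<in> tilde_graph S F \<longleftrightarrow> {i, j} \<in> F"
  "{emb i, Some None} \<in> tilde_graph S F \<longleftrightarrow> i \<in> S"
  "{emb i, None} \<in> tilde_graph S F \<longleftrightarrow> i \<notin> S"
  "{Some None, None} \<in> tilde_graph S F"
proof -
  have inj: "inj (\<lambda>i. emb i)" by (auto simp: inj_def)
  have img: "{emb i, emb j} = (\<lambda>i. emb i) ` e \<longleftrightarrow> e = {i, j}" for e :: "'a set"
  proof -
    have "{emb i, emb j} = (\<lambda>i. emb i) ` {i, j}" by simp
    then show ?thesis using inj_image_eq_iff[OF inj, of "{i, j}" e] by auto
  qed
  have 1: "{emb i, emb j} \<in> (\<lambda>e. (\<lambda>i. emb i) ` e) ` F \<longleftrightarrow> {i, j} \<in> F"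
    using img by (auto simp: image_iff)
  show "{emb i, emb j} \<in> tilde_graph S F \<longleftrightarrow> {i, j} \<in> F"
    unfolding tilde_graph_def Un_iff 1 by (auto simp: doubleton_eq_iff)
  have n: "{emb i, Some None} \<noteq> (\<lambda>i. emb i) ` e" "{emb i, None} \<noteq> (\<lambda>i. emb i) ` e" for e :: "'a set"
    by (auto simp: set_eq_iff)
  show "{emb i, Some None} \<in> tilde_graph S F \<longleftrightarrow> i \<in> S" "{emb i, None} \<in> tilde_graph S F \<longleftrightarrow> i \<notin> S"
    unfolding tilde_graph_def using n by (auto simp: doubleton_eq_iff)
  show "{Some None, None} \<in> tilde_graph S F" by (simp add: tilde_graph_def)
qed

lemma bip_edges_iff: "{Inl v, Inr j} \<in> bip_edges es \<longleftrightarrow> j < length es \<and> v \<in> es ! j"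
  by (auto simp: bip_edges_def doubleton_eq_iff)

lemma bip_edges_sides: "{u, w} \<in> bip_edges es \<Longrightarrow> (\<exists>v j. u = Inl v \<and> w = Inr j) \<or> (\<exists>v j. u = Inr j \<and> w = Inl v)"
  by (auto simp: bip_edges_def doubleton_eq_iff)

lemma hypergraph_mem: "hypergraph V es \<Longrightarrow> j < length es \<Longrightarrow> v \<in> es ! j \<Longrightarrow> v \<in> V"
  unfolding hypergraph_def by (meson nth_mem subsetD)

text \<open>\<open>A\<close> is the additional vertex on the side of the hypergraph vertices,
  \<open>B\<close> the one on the side of the hyperedges. Neighbours of \<open>A\<close> must be
  hyperedges and neighbours of \<open>B\<close> vertices, so the sides are forced: \<open>T\<close>
  with \<open>B\<close> against \<open>- T\<close> with \<open>A\<close>. Hence \<open>A\<close>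
  lies in every hyperedge and \<open>B\<close> contains every vertex.\<close>

lemma interior_polynomial_rooted:
  fixes \<phi> :: "'v + nat \<Rightarrow> 'n::finite option option"
  assumes hyp: "hypergraph V es" and bij: "bij_betw \<phi> (bip_vertices V es) UNIV"
    and G: "G = (\<lambda>e. \<phi> ` e) ` bip_edges es"
    and A: "\<And>i. A \<noteq> emb i" and B: "\<And>i. B \<noteq> emb i" and AB: "{A, B} \<in> G" "A \<noteq> B"
    and v0: "Inl v0 \<in> bip_vertices V es" "\<phi> (Inl v0) = A" and j0: "Inr j0 \<in> bip_vertices V es" "\<phi> (Inr j0) = B"
    and TA: "\<And>i. {emb i, A} \<in> G \<longleftrightarrow> i \<in> T" and TB: "\<And>i. {emb i, B} \<in> G \<longleftrightarrow> i \<notin> T"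
    and F: "\<And>i j. {emb i, emb j} \<in> G \<longleftrightarrow> {i, j} \<in> F" and cov: "\<And>c. c = A \<or> c = B \<or> (\<exists>i. c = emb i)"
  shows "interior_polynomial V es = fiber_poly T (- T) (\<lambda>i j. {i, j} \<in> F)"
proof -
  let ?U = "bip_vertices V es"
  have inj: "inj_on \<phi> ?U" and surj: "\<phi> ` ?U = UNIV" using bij by (auto simp: bij_betw_def)
  have sub: "e \<subseteq> ?U" if "e \<in> bip_edges es" for e
    using that hypergraph_mem[OF hyp] by (auto simp: bip_edges_def bip_vertices_def)
  have adj: "{u, w} \<in> bip_edges es \<longleftrightarrow> {\<phi> u, \<phi> w} \<in> G" if "u \<in> ?U" "w \<in> ?U" for u w
  proof
    assume "{u, w} \<in> bip_edges es"
    then have "\<phi> ` {u, w} \<in> G" unfolding G by (rule imageI)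
    then show "{\<phi> u, \<phi> w} \<in> G" by simp
  next
    assume "{\<phi> u, \<phi> w} \<in> G"
    then obtain e where e: "e \<in> bip_edges es" "\<phi> ` {u, w} = \<phi> ` e" unfolding G by auto
    have "{u, w} = e" using inj_on_image_eq_iff[OF inj, of "{u, w}" e] e(2) sub[OF e(1)] that by auto
    then show "{u, w} \<in> bip_edges es" using e(1) by simp
  qed
  define \<psi> where "\<psi> = inv_into ?U \<phi>"
  have \<psi>: "\<psi> c \<in> ?U" "\<phi> (\<psi> c) = c" for c
    using surj by (auto simp: \<psi>_def inv_into_into f_inv_into_f)
  have \<psi>\<phi>: "\<psi> (\<phi> u) = u" if "u \<in> ?U" for u using inj that by (simp add: \<psi>_def)
  have inr: "\<exists>j. \<psi> (emb i) = Inr j" if "i \<in> T" for i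
    using bip_edges_sides[of "\<psi> (emb i)" "Inl v0" es] adj[of "\<psi> (emb i)" "Inl v0"] \<psi> v0 TA that by auto
  have inl: "\<exists>v. \<psi> (emb i) = Inl v" if "i \<notin> T" for i
    using bip_edges_sides[of "\<psi> (emb i)" "Inr j0" es] adj[of "\<psi> (emb i)" "Inr j0"] \<psi> j0 TB that by auto
  obtain jx where jx: "\<And>i. i \<in> T \<Longrightarrow> \<psi> (emb i) = Inr (jx i)" using inr by metis
  obtain vx where vx: "\<And>i. i \<in> - T \<Longrightarrow> \<psi> (emb i) = Inl (vx i)" using inl by (metis ComplD)
  have \<phi>jx: "\<phi> (Inr (jx i)) = emb i" "Inr (jx i) \<in> ?U" if "i \<in> T" for i using jx[OF that] \<psi>[of "emb i"] by auto
  have \<phi>vx: "\<phi> (Inl (vx i)) = emb i" "Inl (vx i) \<in> ?U" if "i \<in> - T" for i using vx[OF that] \<psi>[of "emb i"] by auto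
  have memV: "Inl v \<in> ?U \<longleftrightarrow> v \<in> V" and memn: "Inr j \<in> ?U \<longleftrightarrow> j < length es" for v j
    by (auto simp: bip_vertices_def)
  have bj: "bij_betw jx T ({..<length es} - {j0})"
    unfolding bij_betw_def
  proof
    show "inj_on jx T" using \<phi>jx(1) by (metis inj_onI option.inject)
    show "jx ` T = {..<length es} - {j0}"
    proof (intro equalityI subsetI)
      fix j assume "j \<in> jx ` T"
      then obtain i where i: "i \<in> T" "j = jx i" by blast
      then show "j \<in> {..<length es} - {j0}" using \<phi>jx[OF i(1)] j0(2) B[of i] memn by auto
    next
      fix j assume j: "j \<in> {..<length es} - {j0}"
      then have jU: "Inr j \<in> ?U" using memn by simp
      have "\<phi> (Inr j) \<noteq> A" using v0 jU inj by (metis inj_onD sum.distinct(1))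
      moreover have "\<phi> (Inr j) \<noteq> B" using j0 jU inj j by (metis DiffE inj_onD singletonI sum.inject(2))
      ultimately obtain i where i: "\<phi> (Inr j) = emb i" using cov by blast
      then have p: "\<psi> (emb i) = Inr j" using \<psi>\<phi>[OF jU] by simp
      have "i \<in> T"
      proof (rule ccontr)
        assume "i \<notin> T"
        then show False using inl[of i] p by auto
      qed
      then show "j \<in> jx ` T" using jx[of i] p by auto
    qed
  qed
  have bv: "bij_betw vx (- T) (V - {v0})"
    unfolding bij_betw_def
  proof
    show "inj_on vx (- T)" using \<phi>vx(1) by (metis inj_onI option.inject)
    show "vx ` (- T) = V - {v0}"
    proof (intro equalityI subsetI)
      fix v assume "v \<in> vx ` (- T)"
      then obtain i where i: "i \<in> - T" "v = vx i" by blast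
      then show "v \<in> V - {v0}" using \<phi>vx[OF i(1)] v0(2) A[of i] memV by auto
    next
      fix v assume v: "v \<in> V - {v0}"
      then have vU: "Inl v \<in> ?U" using memV by simp
      have "\<phi> (Inl v) \<noteq> B" using j0 vU inj by (metis inj_onD sum.distinct(1))
      moreover have "\<phi> (Inl v) \<noteq> A" using v0 vU inj v by (metis DiffE inj_onD singletonI sum.inject(1))
      ultimately obtain i where i: "\<phi> (Inl v) = emb i" using cov by blast
      then have p: "\<psi> (emb i) = Inl v" using \<psi>\<phi>[OF vU] by simp
      have "i \<in> - T"
      proof (rule ccontr)
        assume "i \<notin> - T"
        then show False using inr[of i] p by auto
      qed
      then show "v \<in> vx ` (- T)" using vx[of i] p by auto
    qed
  qed
  have e: "v \<in> es ! j \<longleftrightarrow> {\<phi> (Inl v), \<phi> (Inr j)} \<in> G" if "v \<in> V" "j < length es" for v j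
    using adj[of "Inl v" "Inr j"] bip_edges_iff[of v j es] that memV memn by simp
  have n: "j = j0 \<or> (\<exists>i\<in>T. j = jx i)" if "j < length es" for j using that bj by (auto simp: bij_betw_def)
  have m: "v = v0 \<or> (\<exists>i\<in>- T. v = vx i)" if "v \<in> V" for v using that bv unfolding bij_betw_def by blast
  have v0V: "v0 \<in> V" and j0n: "j0 < length es" using v0 j0 memV memn by auto
  have "pointed_hypergraph V es v0 j0"
  proof
    show "v0 \<in> es ! j" if "j < length es" for j
      using n[OF that] e[OF v0V that] v0(2) j0(2) AB TA \<phi>jx by (auto simp: insert_commute)
    have "v \<in> es ! j0" if "v \<in> V" for v
      using m[OF that] e[OF that j0n] v0(2) j0(2) AB TB \<phi>vx by auto
    moreover have "es ! j0 \<subseteq> V" using hyp j0n by (simp add: hypergraph_def)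
    ultimately show "es ! j0 = V" by blast
  qed (use hyp v0V j0n in auto)
  then have "interior_polynomial V es = fiber_poly ({..<length es} - {j0}) (V - {v0}) (\<lambda>j v. v \<in> es ! j)"
    unfolding fiber_poly_def by (rule pointed_hypergraph.interior_polynomial_eq)
  also have "\<dots> = fiber_poly T (- T) (\<lambda>i j. {i, j} \<in> F)"
  proof (rule fiber_poly_relabel[OF bj bv])
    fix i j assume i: "i \<in> T" and j: "j \<in> - T"
    have "vx j \<in> es ! jx i \<longleftrightarrow> {emb j, emb i} \<in> G"
      using e[of "vx j" "jx i"] \<phi>jx[OF i] \<phi>vx[OF j] memV memn by simp
    then show "{i, j} \<in> F \<longleftrightarrow> vx j \<in> es ! jx i" using F[of i j] by (simp add: insert_commute)
  qed
  finally show ?thesis .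
qed

text \<open>The choice operator in \<open>graph_interior_polynomial\<close> requires a witness. Its
  vertices are \<open>- S\<close> and \<open>d + 1\<close>; its hyperedges are the neighbourhoods of
  the elements of \<open>S\<close> and of \<open>d + 2\<close>.\<close>

lemma tilde_hypergraph_exists:
  fixes F :: "'n::finite set set"
  assumes F: "\<And>e. e \<in> F \<Longrightarrow> \<exists>i j. e = {i, j} \<and> i \<in> S \<and> j \<notin> S"
  shows "\<exists>(V :: 'n option option set) es. hypergraph V es \<and>
    graph_isomorphic (bip_vertices V es) (bip_edges es) UNIV (tilde_graph S F)"
proof -
  let ?G = "tilde_graph S F"
  define V where "V = insert (Some None) ((\<lambda>j. emb j) ` (- S))"
  obtain xs where xs: "set xs = insert None ((\<lambda>i. emb i) ` S)" "distinct xs"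
    using finite_distinct_list[of "insert None ((\<lambda>i. emb i) ` S)"] by auto
  define es where "es = map (\<lambda>x. {v \<in> V. {x, v} \<in> ?G}) xs"
  have len: "length es = length xs" by (simp add: es_def)
  have "Some None \<in> {v \<in> V. {x, v} \<in> ?G}" if "x \<in> set xs" for x
    using that tilde_graph_iff(2)[of _ S F] tilde_graph_iff(4)[of S F] by (auto simp: V_def xs insert_commute)
  then have hyp: "hypergraph V es"
    unfolding hypergraph_def es_def by (auto simp: V_def)
  define \<phi> where "\<phi> = (\<lambda>u. case u of Inl v \<Rightarrow> v | Inr j \<Rightarrow> xs ! j)"
  have disj: "V \<inter> set xs = {}" by (auto simp: V_def xs)
  have un: "V \<union> set xs = UNIV"
  proof -
    have "c \<in> V \<union> set xs" for c
      by (cases c; cases "the c") (auto simp: V_def xs)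
    then show ?thesis by blast
  qed
  have "bij_betw \<phi> (bip_vertices V es) UNIV"
    unfolding bij_betw_def
  proof
    show "inj_on \<phi> (bip_vertices V es)"
    proof (rule inj_onI)
      fix u w assume uw: "u \<in> bip_vertices V es" "w \<in> bip_vertices V es" "\<phi> u = \<phi> w"
      show "u = w"
        using uw disj nth_eq_iff_index_eq[OF xs(2)] nth_mem[of _ xs]
        by (cases u; cases w) (auto simp: \<phi>_def bip_vertices_def len)
    qed
    show "\<phi> ` bip_vertices V es = UNIV"
    proof -
      have "\<phi> ` bip_vertices V es = V \<union> (\<lambda>j. xs ! j) ` {..<length xs}"
        unfolding bip_vertices_def image_Un image_image len by (simp add: \<phi>_def)
      also have "(\<lambda>j. xs ! j) ` {..<length xs} = set xs" by (auto simp: set_conv_nth)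
      finally show ?thesis using un by simp
    qed
  qed
  moreover have "?G = (\<lambda>e. \<phi> ` e) ` bip_edges es"
  proof (intro equalityI subsetI)
    fix e assume e: "e \<in> ?G"
    have "\<exists>x\<in>set xs. \<exists>v\<in>V. e = {x, v}"
    proof -
      have mem: "emb i \<in> set xs" "Some None \<in> V" "None \<in> set xs" if "i \<in> S" for i
        using that by (simp_all add: V_def xs)
      have mem': "emb j \<in> V" "None \<in> set xs" if "j \<notin> S" for j
        using that by (simp_all add: V_def xs)
      from e have "((e \<in> (\<lambda>e. (\<lambda>i. emb i) ` e) ` F \<or> e \<in> {{emb i, Some None} | i. i \<in> S}) \<or>
          e \<in> {{emb j, None} | j. j \<in> - S}) \<or> e \<in> {{Some None, None}}"
        unfolding tilde_graph_def Un_iff .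
      then show ?thesis
      proof (elim disjE)
        assume "e \<in> (\<lambda>e. (\<lambda>i. emb i) ` e) ` F"
        then obtain f where f: "f \<in> F" "e = (\<lambda>i. emb i) ` f" by (elim imageE)
        obtain i j where ij: "f = {i, j}" "i \<in> S" "j \<notin> S" using F[OF f(1)] by (elim exE conjE)
        have "e = {emb i, emb j}" unfolding f(2) ij(1) by simp
        then show ?thesis by (rule bexI[OF bexI[OF _ mem'(1)[OF ij(3)]] mem(1)[OF ij(2)]])
      next
        assume "e \<in> {{emb i, Some None} | i. i \<in> S}"
        then obtain i where i: "i \<in> S" "e = {emb i, Some None}" unfolding mem_Collect_eq by (elim exE conjE)
        show ?thesis using i(2) mem(2)[OF i(1)] mem(1)[OF i(1)] by blast
      next
        assume "e \<in> {{emb j, None} | j. j \<in> - S}"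
        then obtain j where j: "j \<in> - S" "e = {emb j, None}" unfolding mem_Collect_eq by (elim exE conjE)
        have "e = {None, emb j}" using j(2) by (simp only: insert_commute)
        moreover have "j \<notin> S" using j(1) by simp
        ultimately show ?thesis using mem'[of j] by blast
      next
        assume "e \<in> {{Some None, None}}"
        then have "e = {None, Some None}" by (simp only: singleton_iff insert_commute)
        moreover have "None \<in> set xs" "Some None \<in> V" by (simp_all add: V_def xs)
        ultimately show ?thesis by blast
      qed
    qed
    then obtain x v where x: "x \<in> set xs" and v: "v \<in> V" and exv: "e = {x, v}" by blast
    obtain j where j: "j < length xs" "xs ! j = x" using x by (auto simp: in_set_conv_nth)
    have "v \<in> es ! j" using j v e exv by (simp add: es_def)
    then have "{Inl v, Inr j} \<in> bip_edges es" using j len by (simp add: bip_edges_iff)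
    moreover have "e = \<phi> ` {Inl v, Inr j}" using exv j by (auto simp: \<phi>_def)
    ultimately show "e \<in> (\<lambda>e. \<phi> ` e) ` bip_edges es" by blast
  next
    fix e assume "e \<in> (\<lambda>e. \<phi> ` e) ` bip_edges es"
    then obtain v j where j: "j < length es" "v \<in> es ! j" and e: "e = \<phi> ` {Inl v, Inr j}"
      by (auto simp: bip_edges_def)
    then have "{xs ! j, v} \<in> ?G" by (simp add: es_def)
    then show "e \<in> ?G" using e by (simp add: \<phi>_def insert_commute)
  qed
  ultimately show ?thesis using hyp unfolding graph_isomorphic_def by blast
qed

text \<open>A hypergraph inducing the graph may have \<open>d + 1\<close> or \<open>d + 2\<close> on
  its vertex side. The two cases give fiber polynomials in opposite directions, which agree by
  duality, so the chosen value is determined.\<close>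

theorem graph_interior_polynomial_tilde:
  fixes F :: "'n::finite set set"
  assumes F: "\<And>e. e \<in> F \<Longrightarrow> \<exists>i j. e = {i, j} \<and> i \<in> S \<and> j \<notin> S"
  shows "graph_interior_polynomial UNIV (tilde_graph S F) = fiber_poly S (- S) (\<lambda>i j. {i, j} \<in> F)"
proof -
  let ?G = "tilde_graph S F"
  have cov: "c = Some None \<or> c = None \<or> (\<exists>i. c = emb i)" for c :: "'n option option"
    by (metis not_None_eq)
  have all: "interior_polynomial V es = fiber_poly S (- S) (\<lambda>i j. {i, j} \<in> F)"
    if hyp: "hypergraph V es" and iso: "graph_isomorphic (bip_vertices V es) (bip_edges es) UNIV ?G"
    for V :: "'n option option set" and es
  proof -
    obtain \<phi> where bij: "bij_betw \<phi> (bip_vertices V es) UNIV" and G: "?G = (\<lambda>e. \<phi> ` e) ` bip_edges es"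
      using iso by (auto simp: graph_isomorphic_def)
    have "{Some None, None} \<in> (\<lambda>e. \<phi> ` e) ` bip_edges es" using tilde_graph_iff(4)[of S F] G by simp
    then obtain v j where vj: "j < length es" "v \<in> es ! j" "{Some None, None} = {\<phi> (Inl v), \<phi> (Inr j)}"
      by (auto simp: bip_edges_def)
    have U: "Inl v \<in> bip_vertices V es" "Inr j \<in> bip_vertices V es"
      using vj hypergraph_mem[OF hyp] by (auto simp: bip_vertices_def)
    from vj(3) consider "\<phi> (Inl v) = Some None" "\<phi> (Inr j) = None" | "\<phi> (Inl v) = None" "\<phi> (Inr j) = Some None"
      by (auto simp: doubleton_eq_iff)
    then show ?thesis
    proof cases
      case 1
      show ?thesis
        by (rule interior_polynomial_rooted[OF hyp bij G _ _ _ _ U(1) 1(1) U(2) 1(2)])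
           (use cov in \<open>auto simp: tilde_graph_iff\<close>)
    next
      case 2
      have ba: "{None, Some None} \<in> ?G" using tilde_graph_iff(4)[of S F] by (simp only: insert_commute)
      have "interior_polynomial V es = fiber_poly (- S) (- (- S)) (\<lambda>i j. {i, j} \<in> F)"
        by (rule interior_polynomial_rooted[OF hyp bij G _ _ _ _ U(1) 2(1) U(2) 2(2)])
           (use cov ba in \<open>auto simp: tilde_graph_iff\<close>)
      also have "\<dots> = fiber_poly S (- S) (\<lambda>j i. {i, j} \<in> F)"
        using fiber_poly_swap[of "- S" S "\<lambda>i j. {i, j} \<in> F"] by simp
      finally show ?thesis by (simp add: insert_commute)
    qed
  qed
  show ?thesis
    unfolding graph_interior_polynomial_def
    by (rule someI2_ex) (use tilde_hypergraph_exists[OF F] all in blast)+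
qed

section \<open>The transformation of polynomials\<close>

lemma poly_map_of_real:
  fixes z :: "'a::real_field"
  assumes "degree p \<le> n"
  shows "poly (map_poly of_real p) z = (\<Sum>i\<le>n. of_real (coeff p i) * z ^ i)"
proof -
  have "degree (map_poly of_real p :: 'a poly) \<le> n" using assms by (simp add: degree_map_poly)
  then have "poly (map_poly of_real p) z = (\<Sum>i\<le>n. coeff (map_poly of_real p) i * z ^ i)"
    unfolding poly_altdef by (intro sum.mono_neutral_left) (auto simp: coeff_eq_0)
  then show ?thesis by (simp add: coeff_map_poly)
qed

lemma degree_gamma_poly_term: "degree ([:0, 4 :: real:] ^ k * [:1, 1:] ^ m) \<le> k + m"
proof -
  have "degree ([:0, 4 :: real:] ^ k) \<le> k" "degree ([:1, 1 :: real:] ^ m) \<le> m"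
    using degree_power_le[of "[:0, 4 :: real:]" k] degree_power_le[of "[:1, 1 :: real:]" m] by simp_all
  then show ?thesis using degree_mult_le[of "[:0, 4 :: real:] ^ k" "[:1, 1 :: real:] ^ m"] by linarith
qed

lemma degree_gamma_poly: "degree (gamma_poly d f) \<le> d"
  unfolding gamma_poly_def
proof (rule degree_sum_le)
  fix k assume "k \<in> {..d div 2}"
  then have "k + (d - 2 * k) \<le> d" by auto
  then show "degree (smult (coeff f k) ([:0, 4:] ^ k * [:1, 1:] ^ (d - 2 * k))) \<le> d"
    using degree_gamma_poly_term[of k "d - 2 * k"] degree_smult_le order_trans by (metis)
qed simp

text \<open>The summand for \<open>k\<close> has degree at most \<open>d - k\<close>, so only
  \<open>k = 0\<close> reaches degree \<open>d\<close>. A nonzero constant term of \<open>f\<close>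
  thus fixes the degree.\<close>

lemma coeff_gamma_poly_top: "coeff (gamma_poly d f) d = coeff f 0"
proof -
  have lead: "coeff ([:1, 1 :: real:] ^ d) d = 1"
    using lead_coeff_power[of "[:1, 1 :: real:]" d] degree_power_eq[of "[:1, 1 :: real:]" d] by simp
  have "coeff ([:0, 4 :: real:] ^ k * [:1, 1:] ^ (d - 2 * k)) d = 0" if "0 < k" "k \<le> d div 2" for k
    by (rule coeff_eq_0) (use degree_gamma_poly_term[of k "d - 2 * k"] that in linarith)
  then have "coeff (gamma_poly d f) d = (\<Sum>k\<le>d div 2. if k = 0 then coeff f 0 else 0)"
    unfolding gamma_poly_def coeff_sum by (intro sum.cong) (auto simp: lead)
  then show ?thesis by simp
qed

lemma map_poly_of_real_hom:
  fixes p q :: "real poly" and z :: "'a::real_field"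
  shows "poly (map_poly of_real (p + q)) z = poly (map_poly of_real p) z + poly (map_poly of_real q) z"
    and "poly (map_poly of_real (smult c p)) z = of_real c * poly (map_poly of_real p) z"
    and "poly (map_poly of_real (p * q)) z = poly (map_poly of_real p) z * poly (map_poly of_real q) z"
proof -
  have a: "map_poly of_real (p + q) = (map_poly of_real p + map_poly of_real q :: 'a poly)" for p q :: "real poly"
    by (rule poly_eqI) (simp add: coeff_map_poly)
  have s: "map_poly of_real (smult c p) = (smult (of_real c) (map_poly of_real p) :: 'a poly)" for c and p :: "real poly"
    by (rule poly_eqI) (simp add: coeff_map_poly)
  have m: "map_poly of_real (p * q) = (map_poly of_real p * map_poly of_real q :: 'a poly)" for p q :: "real poly"
    by (rule poly_eqI) (simp add: coeff_map_poly coeff_mult)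
  show "poly (map_poly of_real (p + q)) z = poly (map_poly of_real p) z + poly (map_poly of_real q) z"
    "poly (map_poly of_real (smult c p)) z = of_real c * poly (map_poly of_real p) z"
    "poly (map_poly of_real (p * q)) z = poly (map_poly of_real p) z * poly (map_poly of_real q) z"
    by (simp_all add: a s m)
qed

lemma map_poly_of_real_power:
  "poly (map_poly of_real (p ^ n)) z = poly (map_poly of_real p) (z :: 'a::real_field) ^ n"
  by (induction n) (simp_all add: map_poly_of_real_hom(3) map_poly_1)

lemma map_poly_of_real_sum:
  "poly (map_poly of_real (sum f A)) z = (\<Sum>a\<in>A. poly (map_poly of_real (f a)) (z :: 'a::real_field))"
  by (induction A rule: infinite_finite_induct) (simp_all add: map_poly_of_real_hom(1))

lemma poly_gamma_poly:
  fixes z :: "'a::real_field"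
  shows "poly (map_poly of_real (gamma_poly d f)) z = (\<Sum>k\<le>d div 2. of_real (coeff f k) * ((4 * z) ^ k * (1 + z) ^ (d - 2 * k)))"
proof -
  have "poly (map_poly of_real [:0, 4 :: real:]) z = 4 * z" "poly (map_poly of_real [:1, 1 :: real:]) z = 1 + z"
    by (simp_all add: map_poly_pCons)
  then show ?thesis
    unfolding gamma_poly_def map_poly_of_real_sum map_poly_of_real_hom(2,3) map_poly_of_real_power by simp
qed

text \<open>A general field extension of the reals covers both the formula at real points and the
  complex roots.\<close>

lemma poly_gamma_poly_eq:
  fixes z :: "'a::real_field"
  assumes f: "degree f \<le> d div 2" and z: "z \<noteq> - 1"
  shows "poly (map_poly of_real (gamma_poly d f)) z = (z + 1) ^ d * poly (map_poly of_real f) (4 * z / (z + 1)\<^sup>2)"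
proof -
  have nz: "1 + z \<noteq> 0" using z by (metis add_eq_0_iff)
  have "(4 * z) ^ k * (1 + z) ^ (d - 2 * k) = (z + 1) ^ d * (4 * z / (z + 1)\<^sup>2) ^ k" if "k \<le> d div 2" for k
  proof -
    have "(1 + z) ^ d = (1 + z) ^ (2 * k) * (1 + z) ^ (d - 2 * k)"
      using that by (simp add: power_add[symmetric])
    then show ?thesis using nz by (simp add: power_divide power_mult add.commute[of z 1])
  qed
  then show ?thesis unfolding poly_gamma_poly poly_map_of_real[OF f] sum_distrib_left
    by (intro sum.cong refl) (simp add: mult.left_commute)
qed

lemma map_poly_of_real_id: "map_poly of_real p = (p :: real poly)"
  by (rule poly_eqI) (simp add: coeff_map_poly)

section \<open>Gamma-positivity and real roots\<close>

lemma gamma_positive_gamma_poly: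
  assumes pos: "\<And>k. 0 \<le> coeff f k" and f0: "coeff f 0 = 1"
  shows "gamma_positive (gamma_poly d f)"
proof -
  let ?h = "gamma_poly d f"
  have deg: "degree ?h = d"
    using degree_gamma_poly[of d f] le_degree[of ?h d] coeff_gamma_poly_top[of d f] f0 by simp
  have eval: "poly ?h x = (\<Sum>k\<le>d div 2. coeff f k * ((4 * x) ^ k * (1 + x) ^ (d - 2 * k)))" for x
    using poly_gamma_poly[of d f x] by (simp add: map_poly_of_real_id)
  have "poly (reflect_poly ?h) x = poly ?h x" if x: "x \<noteq> 0" for x
  proof -
    have "x ^ d * ((4 * inverse x) ^ k * (1 + inverse x) ^ (d - 2 * k)) = (4 * x) ^ k * (1 + x) ^ (d - 2 * k)"
      if k: "k \<le> d div 2" for k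
    proof -
      have "d = k + (k + (d - 2 * k))" using k by simp
      then have "x ^ d = x ^ k * x ^ k * x ^ (d - 2 * k)" by (metis power_add mult.assoc)
      then have "x ^ d * ((4 * inverse x) ^ k * (1 + inverse x) ^ (d - 2 * k)) =
        (x ^ k * (x ^ k * (4 * inverse x) ^ k)) * (x ^ (d - 2 * k) * (1 + inverse x) ^ (d - 2 * k))"
        by (simp only: mult_ac)
      also have "\<dots> = (x * (x * (4 * inverse x))) ^ k * (x * (1 + inverse x)) ^ (d - 2 * k)"
        by (simp only: power_mult_distrib)
      also have "x * (x * (4 * inverse x)) = 4 * x" using x by simp
      also have "x * (1 + inverse x) = 1 + x" using x by (simp add: distrib_left add.commute)
      finally show ?thesis .
    qed
    then have "x ^ d * poly ?h (inverse x) = poly ?h x"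
      unfolding eval sum_distrib_left by (intro sum.cong refl) (simp add: mult.left_commute)
    then show ?thesis using poly_reflect_poly_nz[OF x, of ?h] deg by simp
  qed
  \<comment> \<open>The factor \<open>x\<close> covers the point 0, where the computation with
    \<open>inverse x\<close> does not apply.\<close>
  then have "poly ([:0, 1:] * (reflect_poly ?h - ?h)) x = 0" for x by (cases "x = 0") auto
  then have "[:0, 1:] * (reflect_poly ?h - ?h) = 0" using poly_all_0_iff_0 by blast
  then have "reflect_poly ?h = ?h" by simp
  moreover have "?h = (\<Sum>i\<le>degree ?h div 2. smult (coeff f i * 4 ^ i) (monom 1 i * [:1, 1:] ^ (degree ?h - 2 * i)))"
  proof -
    have x4: "[:0, 4 :: real:] = smult 4 [:0, 1:]" by simp
    have "[:0, 4 :: real:] ^ i = smult (4 ^ i) (monom 1 i)" for i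
      unfolding x4 smult_power monom_altdef smult_1_left ..
    then show ?thesis unfolding deg by (simp add: gamma_poly_def)
  qed
  ultimately show ?thesis
    unfolding gamma_positive_def using pos
    by (intro conjI exI[of _ "\<lambda>i. coeff f i * 4 ^ i"]) auto
qed

text \<open>Roots are related by \<open>w = 4 z / (z + 1)^2\<close>. A real \<open>z\<close> gives a
  real \<open>w\<close>; conversely a real \<open>w\<close> could come from nonreal
  \<open>z\<close>, but only for \<open>w > 1\<close>, which nonnegative coefficients with constant
  term 1 exclude.\<close>

lemma real_rooted_gamma_poly:
  assumes deg: "degree f \<le> d div 2" and pos: "\<And>k. 0 \<le> coeff f k" and f0: "coeff f 0 = 1"
  shows "real_rooted (gamma_poly d f) \<longleftrightarrow> real_rooted f"
proof
  assume h: "real_rooted (gamma_poly d f)"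
  show "real_rooted f"
    unfolding real_rooted_def
  proof (intro allI impI)
    fix w :: complex assume w: "poly (map_poly of_real f) w = 0"
    have "w \<noteq> 0" using w f0 by (auto simp: poly_0_coeff_0 coeff_map_poly)
    \<comment> \<open>A solution of \<open>4 z = w (z + 1)^2\<close>, a quadratic equation with
      leading coefficient \<open>w\<close>; at \<open>z = - 1\<close> the equation would read
      \<open>- 4 = 0\<close>.\<close>
    define z where "z = (4 - 2 * w + csqrt ((4 - 2 * w)\<^sup>2 - 4 * w\<^sup>2)) / (2 * w)"
    have "(2 * w * z - (4 - 2 * w))\<^sup>2 = (4 - 2 * w)\<^sup>2 - 4 * w\<^sup>2"
      using \<open>w \<noteq> 0\<close> by (simp add: z_def)
    then have "4 * w * (w * z\<^sup>2 + (2 * w - 4) * z + w) = 0" by (simp add: power2_eq_square algebra_simps)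
    then have q: "w * z\<^sup>2 + (2 * w - 4) * z + w = 0" using \<open>w \<noteq> 0\<close> by simp
    have z1: "z \<noteq> - 1" using q by auto
    have "4 * z = w * (z + 1)\<^sup>2" using q by (simp add: power2_eq_square algebra_simps)
    moreover have "(z + 1)\<^sup>2 \<noteq> 0" using z1 by (simp add: add_eq_0_iff2)
    ultimately have wz: "w = 4 * z / (z + 1)\<^sup>2" by (simp add: field_simps)
    then have "poly (map_poly of_real (gamma_poly d f)) z = 0" using poly_gamma_poly_eq[OF deg z1] w by simp
    then have "z \<in> \<real>" using h by (simp add: real_rooted_def)
    then show "w \<in> \<real>" unfolding wz by (intro Reals_divide Reals_mult Reals_power Reals_add) auto
  qed
next
  assume f: "real_rooted f"
  show "real_rooted (gamma_poly d f)"
    unfolding real_rooted_def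
  proof (intro allI impI)
    fix z :: complex assume z: "poly (map_poly of_real (gamma_poly d f)) z = 0"
    show "z \<in> \<real>"
    proof (cases "z = - 1")
      case False
      then have nz: "z + 1 \<noteq> 0" by (simp add: add_eq_0_iff2)
      let ?w = "4 * z / (z + 1)\<^sup>2"
      have w0: "poly (map_poly of_real f) ?w = 0" using z poly_gamma_poly_eq[OF deg False] nz by simp
      then have "?w \<in> \<real>" using f by (simp add: real_rooted_def)
      then obtain r where r: "?w = of_real r" by (auto elim: Reals_cases)
      have "complex_of_real (poly f r) = 0"
        using w0 unfolding r poly_map_of_real[OF order_refl] by (simp add: poly_altdef)
      then have fr: "poly f r = 0" by simp
      have "r < 0"
      proof (rule ccontr)
        assume "\<not> r < 0"
        then have "coeff f 0 * r ^ 0 \<le> (\<Sum>i\<le>degree f. coeff f i * r ^ i)"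
          using pos by (intro member_le_sum) auto
        then show False using fr f0 by (simp add: poly_altdef)
      qed
      have eq: "4 * z = of_real r * (z + 1)\<^sup>2" using r nz by (simp add: field_simps)
      obtain a b where ab: "z = Complex a b" by (cases z)
      have re: "4 * a = r * ((a + 1)\<^sup>2 - b\<^sup>2)" and im: "4 * b = r * (2 * (a + 1) * b)"
        using arg_cong[OF eq, of Re] arg_cong[OF eq, of Im] unfolding ab
        by (simp_all add: power2_eq_square algebra_simps)
      have "b = 0"
      proof (rule ccontr)
        assume b: "b \<noteq> 0"
        \<comment> \<open>For nonreal \<open>z\<close> the imaginary part gives
          \<open>r (a + 1) = 2\<close>; the real part then forces \<open>a \<ge> 1\<close>, so that
          \<open>r (a + 1)\<close> is not positive.\<close>
        have "b * 4 = b * (2 * (r * (a + 1)))" using im by (simp add: algebra_simps)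
        then have "4 = 2 * (r * (a + 1))" unfolding mult_left_cancel[OF b] .
        then have ra: "r * (a + 1) = 2" by linarith
        have "4 * a = (r * (a + 1)) * (a + 1) - r * b\<^sup>2" using re by (simp add: power2_eq_square algebra_simps)
        then have "r * b\<^sup>2 = 2 * (1 - a)" unfolding ra by simp
        moreover have "r * b\<^sup>2 \<le> 0" using \<open>r < 0\<close> by (simp add: mult_nonpos_nonneg)
        ultimately have "1 \<le> a" by simp
        then have "r * (a + 1) \<le> 0" using \<open>r < 0\<close> by (simp add: mult_nonpos_nonneg)
        then show False using ra by simp
      qed
      then show ?thesis using ab by (simp add: complex_is_Real_iff)
    qed simp
  qed
qed

text \<open>The constant term counts only the zero vector, the fiber vector of the nowhere defined
  function. The support is at most as large as either side, which bounds the degree.\<close>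

lemma coeff_fiber_poly:
  fixes X :: "'a set" and Y :: "'b set"
  assumes X: "finite X" and Y: "finite Y"
  shows "0 \<le> coeff (fiber_poly X Y R) k" "coeff (fiber_poly X Y R) 0 = 1" "2 * degree (fiber_poly X Y R) \<le> card X + card Y"
proof -
  have fin: "finite (fiber_vectors X Y R)" using X Y by (rule finite_fiber_vectors)
  show "0 \<le> coeff (fiber_poly X Y R) k" by (simp add: fiber_poly_def coeff_sum sum_nonneg)
  have "fiber_count Y (\<lambda>_. None) \<in> fiber_vectors X Y R" by (auto simp: fiber_vectors_def pfun_def)
  moreover have "fiber_count Y (\<lambda>_. None) = (\<lambda>_ :: 'a. 0)" by (auto simp: fiber_count_def)
  ultimately have z: "(\<lambda>_. 0) \<in> fiber_vectors X Y R" by simp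
  have "supp_card X p = 0 \<longleftrightarrow> p = (\<lambda>_. 0)" if "p \<in> fiber_vectors X Y R" for p
    using fiber_vectors_outside[OF that] X by (auto simp: supp_card_def fun_eq_iff)
  then have "coeff (fiber_poly X Y R) 0 = (\<Sum>p\<in>fiber_vectors X Y R. if p = (\<lambda>_. 0) then 1 else 0)"
    unfolding fiber_poly_def coeff_sum by (intro sum.cong) auto
  then show "coeff (fiber_poly X Y R) 0 = 1" using z fin by simp
  have "degree (fiber_poly X Y R) \<le> (card X + card Y) div 2"
    unfolding fiber_poly_def
  proof (rule degree_sum_le[OF fin])
    fix p assume "p \<in> fiber_vectors X Y R"
    then have "supp_card X p \<le> (card X + card Y) div 2" using supp_card_bound[OF Y X, of p R] by linarith
    then show "degree (monom (1 :: real) (supp_card X p)) \<le> (card X + card Y) div 2"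
      using degree_monom_le order_trans by blast
  qed
  then show "2 * degree (fiber_poly X Y R) \<le> card X + card Y" by linarith
qed

theorem theorem4p3:
  fixes E :: "'n::finite set set"
  assumes "simple_graph UNIV E"
  shows "(\<exists>Q :: (real ^ 'n) set.
            unimodularly_equivalent (A_polytope (suspension E)) Q \<and>
            locally_anti_blocking Q \<and> reflexive_polytope Q)
    \<and> h_star (A_polytope (suspension E)) =
        smult (1 / 2 ^ (CARD('n) - 1))
          (\<Sum>P\<in>cut_partitions. h_star (B_polytope (cut_graph E (block P))))
    \<and> (\<forall>x::real. x \<noteq> -1 \<longrightarrow>
        poly (h_star (A_polytope (suspension E))) x =
          (x + 1) ^ CARD('n) * poly (f_poly E) (4 * x / (x + 1)\<^sup>2))
    \<and> gamma_positive (h_star (A_polytope (suspension E)))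
    \<and> (real_rooted (h_star (A_polytope (suspension E))) \<longleftrightarrow> real_rooted (f_poly E))"
proof -
  let ?d = "CARD('n)"
  define fv where "fv = (\<lambda>S. fiber_poly S (- S) (\<lambda>i j. {i, j} \<in> cut_graph E S))"
  have loop: "{i} \<notin> E" for i using assms by (force simp: simple_graph_def)
  have edge: "\<exists>i j. e = {i, j} \<and> i \<in> S \<and> j \<notin> S" if "e \<in> cut_graph E S" for e S
  proof -
    have "e \<in> E" using that by (simp add: cut_graph_def)
    then have "card e = 2" using assms by (simp add: simple_graph_def)
    then obtain i j where ij: "e = {i, j}" by (auto simp: card_2_iff)
    then have "(i \<in> S) \<noteq> (j \<in> S)" using that mem_cut_graph[OF loop] by blast
    then show ?thesis using ij by (metis insert_commute)
  qed
  have bip: "(i \<in> S) \<noteq> (j \<in> S)" if "{i, j} \<in> cut_graph E S" for i j S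
    using that mem_cut_graph[OF loop] by blast
  have hB: "h_star (B_polytope (cut_graph E S)) = gamma_poly ?d (fv S)" for S
    unfolding fv_def by (rule h_star_B_polytope) (rule bip)
  have cut_compl: "cut_graph E (- S) = cut_graph E S" for S
  proof -
    have "e \<in> cut_graph E (- S) \<longleftrightarrow> e \<in> cut_graph E S" for e
    proof (cases "e \<in> E")
      case True
      then have "card e = 2" using assms by (simp add: simple_graph_def)
      then obtain i j where "e = {i, j}" by (auto simp: card_2_iff)
      then show ?thesis using mem_cut_graph[OF loop] by auto
    qed (simp add: cut_graph_def)
    then show ?thesis by blast
  qed
  \<comment> \<open>The type of vertices is nonempty, so the exponent \<open>d - 1\<close> is not
    truncated.\<close>
  have two: "1 / 2 ^ ?d * 2 = (1 / 2 ^ (?d - 1) :: real)"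
  proof -
    have "?d = Suc (?d - 1)" by simp
    then have "(2 :: real) ^ ?d = 2 * 2 ^ (?d - 1)" by (metis power_Suc)
    then show ?thesis by simp
  qed
  have fE: "f_poly E = smult (1 / 2 ^ (?d - 1)) (\<Sum>P\<in>cut_partitions. fv (block P))"
    unfolding f_poly_def fv_def using graph_interior_polynomial_tilde[OF edge] by simp
  have "ehrhart_series (A_polytope (suspension E)) * (1 - fps_X) ^ Suc ?d =
    fps_of_poly (smult (1 / 2 ^ ?d) (\<Sum>S\<in>UNIV. gamma_poly ?d (fv S)))"
  proof -
    have "fps_const (1 / 2 ^ ?d) * (fps_const (2 ^ ?d) * ehrhart_series (Q_polytope E)) = ehrhart_series (Q_polytope E)"
      by (simp add: mult.assoc[symmetric])
    then have "ehrhart_series (A_polytope (suspension E)) =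
      fps_const (1 / 2 ^ ?d) * (\<Sum>S\<in>UNIV. ehrhart_series (B_polytope (cut_graph E S)))"
      unfolding ehrhart_A ehrhart_Q[OF loop] by (rule sym)
    then have "ehrhart_series (A_polytope (suspension E)) * (1 - fps_X) ^ Suc ?d =
      fps_const (1 / 2 ^ ?d) * (\<Sum>S\<in>UNIV. ehrhart_series (B_polytope (cut_graph E S)) * (1 - fps_X) ^ Suc ?d)"
      by (simp only: sum_distrib_right mult.assoc)
    also have "(\<Sum>S\<in>UNIV. ehrhart_series (B_polytope (cut_graph E S)) * (1 - fps_X) ^ Suc ?d) =
      (\<Sum>S\<in>UNIV. fps_of_poly (gamma_poly ?d (fv S)))"
      unfolding fv_def by (intro sum.cong refl B_polytope_series) (rule bip)
    finally show ?thesis by (simp add: fps_of_poly_smult fps_of_poly_sum del: power_Suc)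
  qed
  \<comment> \<open>The average over all \<open>2^d\<close> sets; passing to unordered partitions
    absorbs a factor 2.\<close>
  then have hA0: "h_star (A_polytope (suspension E)) = smult (1 / 2 ^ ?d) (\<Sum>S\<in>UNIV. gamma_poly ?d (fv S))"
    by (rule h_star_eqI) (rule aff_dim_A)
  have "(\<Sum>S\<in>UNIV. gamma_poly ?d (fv S)) = 2 * (\<Sum>P\<in>cut_partitions. gamma_poly ?d (fv (block P)))"
    by (rule sum_cut_partitions) (simp add: hB[symmetric] cut_compl)
  then have "h_star (A_polytope (suspension E)) = smult (1 / 2 ^ ?d) (smult 2 (\<Sum>P\<in>cut_partitions. gamma_poly ?d (fv (block P))))"
    unfolding hA0 by (simp add: numeral_poly)
  then have hA: "h_star (A_polytope (suspension E)) = smult (1 / 2 ^ (?d - 1)) (\<Sum>P\<in>cut_partitions. gamma_poly ?d (fv (block P)))"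
    unfolding smult_smult two .
  then have hAg: "h_star (A_polytope (suspension E)) = gamma_poly ?d (f_poly E)"
    unfolding fE gamma_poly_smult gamma_poly_sum .
  have card_compl: "card S + card (- S) = ?d" for S :: "'n set"
    by (simp add: card_Un_disjoint[symmetric])
  have fv: "0 \<le> coeff (fv S) k" "coeff (fv S) 0 = 1" "degree (fv S) \<le> ?d div 2" for S k
    unfolding fv_def using coeff_fiber_poly[of S "- S" "\<lambda>i j. {i, j} \<in> cut_graph E S"] card_compl[of S] by auto
  have fin: "finite (cut_partitions :: 'n set set set)" by (rule finite_subset[of _ UNIV]) auto
  \<comment> \<open>The same double counting, applied to the constant 1, yields the number of
    partitions, so that \<open>f_poly E\<close> averages polynomials with constant term 1.\<close>
  have card_cut: "real (card (cut_partitions :: 'n set set set)) = 2 ^ (?d - 1)"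
  proof -
    have "2 ^ ?d = 2 * real (card (cut_partitions :: 'n set set set))"
      using sum_cut_partitions[of "\<lambda>_ :: 'n set. 1 :: real"] card_UNIV_set[where 'a = 'n] by simp
    then show ?thesis using two by (simp add: field_simps)
  qed
  have pos: "0 \<le> coeff (f_poly E) k" for k
    unfolding fE using fv by (simp add: coeff_sum sum_nonneg)
  have f0: "coeff (f_poly E) 0 = 1"
    unfolding fE using fv card_cut by (simp add: coeff_sum)
  have deg: "degree (f_poly E) \<le> ?d div 2"
    unfolding fE using fv(3) fin by (intro order_trans[OF degree_smult_le] degree_sum_le) auto
  have "unimodularly_equivalent (A_polytope (suspension E)) (Q_polytope E) \<and>
      locally_anti_blocking (Q_polytope E) \<and> reflexive_polytope (Q_polytope E)"
    using unimodularly_equivalent_A_Q locally_anti_blocking_Q[OF loop] reflexive_Q[OF loop] by blast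
  moreover have "poly (h_star (A_polytope (suspension E))) x = (x + 1) ^ ?d * poly (f_poly E) (4 * x / (x + 1)\<^sup>2)"
    if "x \<noteq> - 1" for x
    unfolding hAg using poly_gamma_poly_eq[OF deg that] by (simp add: map_poly_of_real_id)
  moreover have "gamma_positive (h_star (A_polytope (suspension E)))"
    unfolding hAg by (rule gamma_positive_gamma_poly[OF pos f0])
  moreover have "real_rooted (h_star (A_polytope (suspension E))) \<longleftrightarrow> real_rooted (f_poly E)"
    unfolding hAg by (rule real_rooted_gamma_poly[OF deg pos f0])
  ultimately show ?thesis using hA unfolding hB by blast
qed

end
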